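(* Let $p>5$, $m=\frac{p-1}{2}$ and $s_c=\frac32-\frac1m$. There is a constant $C>0$ depending only on $p$ such that the following holds. Let $w_L$ be a radial solution of the linear wave equation $\partial_{tt}w_L-\Delta w_L=0$ on $\mathbb{R}\times\mathbb{R}^3$ with initial data $(w_0,w_1)\in\dot H^{s_c}(\mathbb{R}^3)\times\dot H^{s_c-1}(\mathbb{R}^3)$, and let $$E_m(t)=\int_0^\infty|\partial_r(rw_L)(t,r)|^m+|\partial_t(rw_L)(t,r)|^m\,dr .$$ Then for all $t\in\mathbb{R}$, $C^{-1}E_m(0)\le E_m(t)\le C\,E_m(0)$.
   Context: All functions are real-valued and radial in the space variable, $r=|x|$. The solution of the linear wave equation with data $(w_0,w_1)$ is $w_L(t)=\cos(t\sqrt{-\Delta})w_0+\frac{\sin(t\sqrt{-\Delta})}{\sqrt{-\Delta}}w_1$. *)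

theory Defs
  imports "HOL-Analysis.Analysis"
begin

primrec iter_deriv :: "'a list \<Rightarrow> ('a::euclidean_space \<Rightarrow> 'b::real_normed_vector) \<Rightarrow> 'a \<Rightarrow> 'b" where
  "iter_deriv [] f = f"
| "iter_deriv (b # bs) f = (\<lambda>x. frechet_derivative (iter_deriv bs f) (at x) b)"

definition smooth :: "('a::euclidean_space \<Rightarrow> 'b::real_normed_vector) \<Rightarrow> bool" where
  "smooth f \<longleftrightarrow> (\<forall>bs. set bs \<subseteq> Basis \<longrightarrow> iter_deriv bs f differentiable_on UNIV)"

definition schwartz :: "('a::euclidean_space \<Rightarrow> complex) \<Rightarrow> bool" where
  "schwartz \<phi> \<longleftrightarrow> smooth \<phi> \<and>
     (\<forall>bs k. set bs \<subseteq> Basis \<longrightarrow> (\<exists>B. \<forall>x. (1 + norm x) ^ k * norm (iter_deriv bs \<phi> x) \<le> B))"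

definition test_function_on :: "'a::euclidean_space set \<Rightarrow> ('a \<Rightarrow> real) \<Rightarrow> bool" where
  "test_function_on S \<phi> \<longleftrightarrow> smooth \<phi> \<and> (\<exists>K. compact K \<and> K \<subseteq> S \<and> (\<forall>x. x \<notin> K \<longrightarrow> \<phi> x = 0))"

definition locally_integrable_on :: "('a::euclidean_space \<Rightarrow> real) \<Rightarrow> 'a set \<Rightarrow> bool" where
  "locally_integrable_on f S \<longleftrightarrow> (\<forall>K. compact K \<longrightarrow> K \<subseteq> S \<longrightarrow> set_integrable lborel K f)"

text \<open>Fourier transform, with the normalisation for which \<open>- \<Delta>\<close> is the multiplier
  \<open>(norm \<xi>)^2\<close>.\<close>

definition fourier :: "('a::euclidean_space \<Rightarrow> complex) \<Rightarrow> 'a \<Rightarrow> complex" where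
  "fourier \<phi> \<xi> = (\<integral>x. cis (- (x \<bullet> \<xi>)) * \<phi> x \<partial>lborel)"

text \<open>Functions that define a tempered distribution by integration.  Testing against a Gaussian
  shows that such a function is Borel measurable and locally integrable.\<close>

definition tempered :: "('a::euclidean_space \<Rightarrow> complex) \<Rightarrow> bool" where
  "tempered f \<longleftrightarrow> (\<forall>\<phi>. schwartz \<phi> \<longrightarrow> integrable lborel (\<lambda>x. f x * \<phi> x))"

text \<open>The Fourier transform of the tempered distribution \<open>f\<close> is the function \<open>g\<close>
  (unique up to null sets).\<close>

definition has_fourier :: "('a::euclidean_space \<Rightarrow> complex) \<Rightarrow> ('a \<Rightarrow> complex) \<Rightarrow> bool" where
  "has_fourier f g \<longleftrightarrow> tempered f \<and> tempered g \<and>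
     (\<forall>\<phi>. schwartz \<phi> \<longrightarrow>
        (\<integral>x. f x * fourier \<phi> x \<partial>lborel) = (\<integral>\<xi>. g \<xi> * \<phi> \<xi> \<partial>lborel))"

text \<open>The space of order \<open>s\<close> on an \<open>n\<close>-dimensional space, for \<open>0 \<le> s < n / 2\<close>.  In this range
  every element is a function, and finiteness of the integral below makes \<open>g\<close> locally
  integrable, so demanding that \<open>f\<close> and \<open>g\<close> be functions loses nothing.\<close>

definition hom_sobolev :: "real \<Rightarrow> ('a::euclidean_space \<Rightarrow> real) \<Rightarrow> bool" where
  "hom_sobolev s f \<longleftrightarrow>
     (\<exists>g. has_fourier (\<lambda>x. complex_of_real (f x)) g \<and>
          integrable lborel (\<lambda>\<xi>. (norm \<xi> powr s * norm (g \<xi>))\<^sup>2))"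

text \<open>\<open>w t = cos (t (-\<Delta>)^(1/2)) w0 + sin (t (-\<Delta>)^(1/2)) (-\<Delta>)^(-1/2) w1\<close> for every \<open>t\<close>.\<close>

definition linear_wave_solution ::
  "(real \<Rightarrow> 'a::euclidean_space \<Rightarrow> real) \<Rightarrow> ('a \<Rightarrow> real) \<Rightarrow> ('a \<Rightarrow> real) \<Rightarrow> bool" where
  "linear_wave_solution w w0 w1 \<longleftrightarrow>
     (\<exists>g0 g1. has_fourier (\<lambda>x. complex_of_real (w0 x)) g0 \<and>
              has_fourier (\<lambda>x. complex_of_real (w1 x)) g1 \<and>
              (\<forall>t. has_fourier (\<lambda>x. complex_of_real (w t x))
                     (\<lambda>\<xi>. complex_of_real (cos (t * norm \<xi>)) * g0 \<xi> +
                           complex_of_real (sin (t * norm \<xi>) / norm \<xi>) * g1 \<xi>)))"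

definition radial :: "('a::real_normed_vector \<Rightarrow> 'b) \<Rightarrow> bool" where
  "radial f \<longleftrightarrow> (\<exists>F. \<forall>x. f x = F (norm x))"

text \<open>The value \<open>f r\<close>, \<open>r \<ge> 0\<close>, of a radial function of \<open>r = norm x\<close>.\<close>

definition radial_profile :: "(real^3 \<Rightarrow> real) \<Rightarrow> real \<Rightarrow> real" where
  "radial_profile f r = f (r *\<^sub>R axis 1 1)"

text \<open>Derivatives in the sense of distributions on the half-line \<open>r > 0\<close>: \<open>v = \<partial>\<^sub>r u\<close> for a
  function of \<open>r\<close>, and \<open>v = \<partial>\<^sub>t u(t)\<close> for a time-dependent function of \<open>r\<close>.\<close>

definition has_weak_deriv_r :: "(real \<Rightarrow> real) \<Rightarrow> (real \<Rightarrow> real) \<Rightarrow> bool" where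
  "has_weak_deriv_r u v \<longleftrightarrow>
     locally_integrable_on u {0<..} \<and> locally_integrable_on v {0<..} \<and>
     (\<forall>\<phi>. test_function_on {0<..} \<phi> \<longrightarrow>
        (\<integral>r. u r * deriv \<phi> r \<partial>lborel) = - (\<integral>r. v r * \<phi> r \<partial>lborel))"

definition has_weak_deriv_t :: "(real \<Rightarrow> real \<Rightarrow> real) \<Rightarrow> real \<Rightarrow> (real \<Rightarrow> real) \<Rightarrow> bool" where
  "has_weak_deriv_t u t v \<longleftrightarrow>
     (\<forall>\<tau>. locally_integrable_on (u \<tau>) {0<..}) \<and> locally_integrable_on v {0<..} \<and>
     (\<forall>\<phi>. test_function_on {0<..} \<phi> \<longrightarrow>
        ((\<lambda>\<tau>. \<integral>r. u \<tau> r * \<phi> r \<partial>lborel) has_real_derivative (\<integral>r. v r * \<phi> r \<partial>lborel)) (at t))"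

text \<open>\<open>\<integral>\<^sub>0\<^sup>\<infinity> |\<partial>\<^sub>r u|^m + |\<partial>\<^sub>t u|^m dr\<close> at time \<open>t\<close>, with values in \<open>[0, \<infinity>]\<close>.  Weak derivatives are
  unique up to null sets, so the infimum ranges over at most one value; it is \<open>\<infinity>\<close> if one of the
  two distributional derivatives is not a locally integrable function.\<close>

definition radial_energy :: "real \<Rightarrow> (real \<Rightarrow> real \<Rightarrow> real) \<Rightarrow> real \<Rightarrow> ennreal" where
  "radial_energy m u t =
     (INF (v, z) \<in> {(v, z). has_weak_deriv_r (u t) v \<and> has_weak_deriv_t u t z}.
        \<integral>\<^sup>+r\<in>{0<..}. ennreal (\<bar>v r\<bar> powr m + \<bar>z r\<bar> powr m) \<partial>lborel)"

end

theory Submission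
  imports Defs "HOL-Probability.Probability" "HOL-Real_Asymp.Real_Asymp"
begin

text \<open>
  With \<open>u(t,r) = r w(t,r)\<close>, extended oddly in \<open>r\<close>, the wave equation becomes one-dimensional, and
  \<open>\<partial>\<^sub>r u + \<partial>\<^sub>t u\<close> is transported along \<open>r + t\<close>.  Hence the even part \<open>\<partial>\<^sub>r u\<close> and the odd part
  \<open>\<partial>\<^sub>t u\<close> at one time determine those at any other time, and the two energies are comparable with
  the \<open>L\<^sup>m\<close> norm of one function \<open>G\<close> on the line.

  Transport is read off the Fourier side: for a test function \<open>\<phi>\<close> on \<open>r > 0\<close>,
  \<open>\<integral> u(t) \<phi> dr\<close> is, up to a constant, the integral of the Fourier transform of \<open>w(t)\<close> against the
  sine transform of \<open>\<phi>\<close> divided by \<open>|\<xi>|\<close>.  This is obtained from Gaussian regularisations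
  \<open>exp (-a |\<xi>|\<^sup>2) F(|\<xi>|\<^sup>2)\<close> with \<open>F\<close> entire of small growth, which are Schwartz functions and whose
  Fourier transforms follow from that of the Gaussian by differentiating in \<open>a\<close>.

  The hypotheses only see \<open>r > 0\<close>.  That \<open>\<partial>\<^sub>r u\<close> and \<open>\<partial>\<^sub>t u\<close> carry no mass at \<open>r = 0\<close>, where a
  wave could focus, is where the Sobolev regularity \<open>1/2 < s\<^sub>c < 3/2\<close> is needed.
\<close>

section \<open>Differentiation under the integral\<close>

text \<open>Weak derivatives on r > 0 would not notice a point mass at r = 0 in the even extension
  of the r-derivative, and transport would later carry it into r > 0. A quantitative match excludes
  it. Sine and cosine transforms of a test function decay like V / (1 + k), where V involves only
  the L1 norms of the function and of its derivative. Monotone cutoffs that vanish near 0 have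
  unbounded derivatives but bounded total variation, so V stays bounded along them. The spectral
  data, in turn, are integrable against 1 / (1 + |xi|), because |xi|^(-s) / (1 + |xi|) is square
  integrable for 1/2 < s < 3/2. Dominated convergence then reaches test functions that do not vanish
  at 0.

  The Fourier transforms in the wave equation and in the Sobolev conditions are separate existential
  witnesses; they are compared only through their pairings with Gaussian tests.

  The constant \<open>8 * 4 powr m\<close> is 2 * 4^m for gluing the two derivatives into
  \<open>G\<close>, times 4 for splitting it again into even and odd parts at the new time.\<close>

lemma has_vector_derivative_iff_quotient:
  fixes f :: "real \<Rightarrow> 'b::real_normed_vector"
  shows "(f has_vector_derivative D) (at t) \<longleftrightarrow> ((\<lambda>s. (f s - f t) /\<^sub>R (s - t)) \<longlongrightarrow> D) (at t)"
proof -
  have "(f has_vector_derivative D) (at t) \<longleftrightarrow>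
      ((\<lambda>s. norm (f s - f t - (s - t) *\<^sub>R D) / norm (s - t)) \<longlongrightarrow> 0) (at t)"
    by (simp add: has_vector_derivative_def has_derivative_iff_norm bounded_linear_scaleR_left)
  also have "\<dots> \<longleftrightarrow> ((\<lambda>s. norm ((f s - f t) /\<^sub>R (s - t) - D)) \<longlongrightarrow> 0) (at t)"
  proof (rule tendsto_cong)
    have *: "norm (f s - f t - (s - t) *\<^sub>R D) / norm (s - t) = norm ((f s - f t) /\<^sub>R (s - t) - D)"
      if "s \<noteq> t" for s
    proof -
      have "(f s - f t) /\<^sub>R (s - t) - D = (f s - f t - (s - t) *\<^sub>R D) /\<^sub>R (s - t)"
        using that by (simp add: scaleR_diff_right)
      then show ?thesis by (simp add: divide_inverse mult.commute)
    qed
    show "\<forall>\<^sub>F s in at t. norm (f s - f t - (s - t) *\<^sub>R D) / norm (s - t) = norm ((f s - f t) /\<^sub>R (s - t) - D)"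
      using * by (auto simp: eventually_at_filter)
  qed
  also have "\<dots> \<longleftrightarrow> ((\<lambda>s. (f s - f t) /\<^sub>R (s - t)) \<longlongrightarrow> D) (at t)"
    by (simp add: tendsto_norm_zero_iff LIM_zero_iff)
  finally show ?thesis .
qed

text \<open>The mean value inequality turns the bound on \<open>f'\<close> into the same bound on
  all difference quotients, so dominated convergence applies along every sequence tending to
  \<open>t0\<close>.\<close>

lemma has_vector_derivative_integral:
  fixes f f' :: "real \<Rightarrow> 'a \<Rightarrow> 'b::{banach,second_countable_topology}"
  assumes d: "\<delta> > 0"
    and int: "\<And>t. \<bar>t - t0\<bar> < \<delta> \<Longrightarrow> integrable M (f t)"
    and deriv: "\<And>t x. \<bar>t - t0\<bar> < \<delta> \<Longrightarrow> x \<in> space M \<Longrightarrow> ((\<lambda>t. f t x) has_vector_derivative f' t x) (at t)"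
    and bound: "\<And>t x. \<bar>t - t0\<bar> < \<delta> \<Longrightarrow> x \<in> space M \<Longrightarrow> norm (f' t x) \<le> B x"
    and B: "integrable M B"
  shows "integrable M (f' t0)"
    and "((\<lambda>t. \<integral>x. f t x \<partial>M) has_vector_derivative (\<integral>x. f' t0 x \<partial>M)) (at t0)"
proof -
  let ?q = "\<lambda>s x. (f s x - f t0 x) /\<^sub>R (s - t0)"
  have lip: "norm (?q s x) \<le> B x"
    if s: "\<bar>s - t0\<bar> < \<delta>" "s \<noteq> t0" and x: "x \<in> space M" for s x
  proof -
    let ?I = "{t. \<bar>t - t0\<bar> < \<delta>}"
    have I: "?I = ball t0 \<delta>" by (auto simp: dist_real_def)
    have "norm (f s x - f t0 x) \<le> B x * norm (s - t0)"
    proof (rule differentiable_bound[where S = ?I and f = "\<lambda>t. f t x" and f' = "\<lambda>t h. h *\<^sub>R f' t x"])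
      show "convex ?I" unfolding I by simp
      show "((\<lambda>t. f t x) has_derivative (\<lambda>h. h *\<^sub>R f' t x)) (at t within ?I)" if "t \<in> ?I" for t
        using deriv[of t x] that x unfolding has_vector_derivative_def
        by (auto intro: has_derivative_at_withinI)
      show "onorm (\<lambda>h. h *\<^sub>R f' t x) \<le> B x" if "t \<in> ?I" for t
      proof (rule onorm_le)
        show "norm (h *\<^sub>R f' t x) \<le> B x * norm h" for h :: real
          using mult_right_mono[OF bound[of t x], of "norm h"] that x by (simp add: mult.commute)
      qed
    qed (use s d in auto)
    then show ?thesis using s by (simp add: divide_simps mult.commute)
  qed
  have key: "(\<lambda>n. (?q (X n) x)) \<longlonglongrightarrow> f' t0 x"
    if "\<And>n. X n \<noteq> t0" "X \<longlonglongrightarrow> t0" "x \<in> space M" for X x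
    using deriv[of t0 x] d that
    unfolding has_vector_derivative_iff_quotient tendsto_at_iff_sequentially by (auto simp: o_def)
  have main: "integrable M (f' t0)"
       "(\<lambda>n. \<integral>x. ?q (X n) x \<partial>M) \<longlonglongrightarrow> (\<integral>x. f' t0 x \<partial>M)"
    if X: "\<And>n. X n \<noteq> t0" "X \<longlonglongrightarrow> t0" "\<And>n. \<bar>X n - t0\<bar> < \<delta>" for X
  proof -
    have meas: "(\<lambda>x. ?q (X n) x) \<in> borel_measurable M" for n
      using int[OF X(3)] int[of t0] d by (auto intro!: borel_measurable_integrable)
    have lim: "AE x in M. (\<lambda>n. ?q (X n) x) \<longlonglongrightarrow> f' t0 x"
      using key[OF X(1,2)] by auto
    have m: "f' t0 \<in> borel_measurable M"
      by (rule borel_measurable_LIMSEQ_metric[OF meas key[OF X(1,2)]])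
    have bd: "AE x in M. norm (?q (X n) x) \<le> B x" for n
      using lip[OF X(3,1)] by auto
    show "integrable M (f' t0)"
      by (rule integrable_dominated_convergence[OF m meas B lim bd])
    show "(\<lambda>n. \<integral>x. ?q (X n) x \<partial>M) \<longlonglongrightarrow> (\<integral>x. f' t0 x \<partial>M)"
      by (rule integral_dominated_convergence[OF m meas B lim bd])
  qed
  \<comment> \<open>Any sequence inside the interval that avoids \<open>t0\<close> serves here;
    measurability of \<open>f' t0\<close> comes from its being a pointwise limit.\<close>
  show "integrable M (f' t0)"
  proof (rule main(1))
    show "(\<lambda>n. t0 + (\<delta>/2) * inverse (real (Suc n))) \<longlonglongrightarrow> t0"
      by (rule tendsto_eq_intros LIMSEQ_inverse_real_of_nat refl)+ simp
    show "t0 + (\<delta>/2) * inverse (real (Suc n)) \<noteq> t0" for n using d by simp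
    show "\<bar>t0 + (\<delta>/2) * inverse (real (Suc n)) - t0\<bar> < \<delta>" for n
    proof -
      have "inverse (real (Suc n)) \<le> 1" by (simp add: field_simps)
      then have "(\<delta>/2) * inverse (real (Suc n)) \<le> \<delta> / 2" using d by (simp add: mult_left_le)
      moreover have "0 \<le> (\<delta>/2) * inverse (real (Suc n))" using d by simp
      ultimately show ?thesis using d by linarith
    qed
  qed
  show "((\<lambda>t. \<integral>x. f t x \<partial>M) has_vector_derivative (\<integral>x. f' t0 x \<partial>M)) (at t0)"
    unfolding has_vector_derivative_iff_quotient tendsto_at_iff_sequentially
  proof (intro allI impI)
    fix X :: "nat \<Rightarrow> real" assume X: "\<forall>n. X n \<in> UNIV - {t0}" "X \<longlonglongrightarrow> t0"
    obtain N where N: "\<And>n. n \<ge> N \<Longrightarrow> \<bar>X n - t0\<bar> < \<delta>"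
      using X(2) d unfolding LIMSEQ_def dist_real_def by blast
    \<comment> \<open>Only a tail of \<open>X\<close> is known to lie within \<delta> of
      \<open>t0\<close>, where the integrals exist.\<close>
    have "(\<lambda>n. \<integral>x. ?q (X (n + N)) x \<partial>M) \<longlonglongrightarrow> (\<integral>x. f' t0 x \<partial>M)"
      by (rule main(2)) (use X N LIMSEQ_ignore_initial_segment in auto)
    moreover have "(\<integral>x. ?q (X (n + N)) x \<partial>M)
       = ((\<integral>x. f (X (n + N)) x \<partial>M) - (\<integral>x. f t0 x \<partial>M)) /\<^sub>R (X (n + N) - t0)" for n
      using int[of "X (n+N)"] int[of t0] N[of "n+N"] d by simp
    ultimately have "(\<lambda>n. ((\<integral>x. f (X (n + N)) x \<partial>M) - (\<integral>x. f t0 x \<partial>M)) /\<^sub>R (X (n + N) - t0)) \<longlonglongrightarrow> (\<integral>x. f' t0 x \<partial>M)"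
      by (simp only:)
    from LIMSEQ_offset[OF this]
    show "((\<lambda>s. ((\<integral>x. f s x \<partial>M) - (\<integral>x. f t0 x \<partial>M)) /\<^sub>R (s - t0)) \<circ> X) \<longlonglongrightarrow> (\<integral>x. f' t0 x \<partial>M)"
      by (simp add: o_def)
  qed
qed

section \<open>Entire functions of small growth\<close>

text \<open>Decay faster than any geometric rate makes \<open>egf c\<close> an entire function of
  exponential type zero: for every \<delta> > 0 it is bounded by a multiple of
  \<open>exp (\<delta> * \<bar>x\<bar>)\<close>. With x = |xi|^2, it can therefore be multiplied by
  any Gaussian in xi and leave Gaussian decay.\<close>

definition slow_seq :: "(nat \<Rightarrow> real) \<Rightarrow> bool" where
  "slow_seq c \<longleftrightarrow> (\<forall>\<delta>>0. \<exists>C. \<forall>k. \<bar>c k\<bar> \<le> C * \<delta> ^ k)"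

definition egf :: "(nat \<Rightarrow> real) \<Rightarrow> real \<Rightarrow> real" where
  "egf c x = (\<Sum>k. c k * x ^ k / fact k)"

lemma slow_seqD:
  assumes "slow_seq c" "\<delta> > 0"
  shows "\<exists>C\<ge>0. \<forall>k. \<bar>c k\<bar> \<le> C * \<delta> ^ k"
proof -
  obtain C where C: "\<And>k. \<bar>c k\<bar> \<le> C * \<delta> ^ k" using assms unfolding slow_seq_def by blast
  have "0 \<le> C" using C[of 0] by simp
  with C show ?thesis by blast
qed

lemma summable_exp_real: "summable (\<lambda>k. (x::real) ^ k / fact k)"
  using summable_exp_generic[of x] by (simp add: divide_inverse mult.commute)

lemma egf_terms_le:
  fixes c :: "nat \<Rightarrow> real"
  assumes "\<And>k. \<bar>c k\<bar> \<le> C * \<delta> ^ k" "C \<ge> 0" "\<delta> > 0"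
  shows "summable (\<lambda>k. \<bar>c k * x ^ k / fact k\<bar>)"
    "(\<Sum>k. \<bar>c k * x ^ k / fact k\<bar>) \<le> C * exp (\<delta> * \<bar>x\<bar>)"
proof -
  have le: "\<bar>c k * x ^ k / fact k\<bar> \<le> C * ((\<delta> * \<bar>x\<bar>) ^ k / fact k)" for k
    using mult_right_mono[OF assms(1)[of k], of "\<bar>x\<bar>^k / fact k"]
    by (simp add: abs_mult power_abs power_mult_distrib mult.assoc)
  have s: "summable (\<lambda>k. C * ((\<delta> * \<bar>x\<bar>) ^ k / fact k))"
    by (intro summable_mult summable_exp_real)
  show 1: "summable (\<lambda>k. \<bar>c k * x ^ k / fact k\<bar>)"
    by (rule summable_comparison_test'[OF s]) (use le in auto)
  have "(\<Sum>k. \<bar>c k * x ^ k / fact k\<bar>) \<le> (\<Sum>k. C * ((\<delta> * \<bar>x\<bar>) ^ k / fact k))"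
    by (rule suminf_le[OF le 1 s])
  also have "\<dots> = C * exp (\<delta> * \<bar>x\<bar>)"
    by (subst suminf_mult[OF summable_exp_real]) (simp add: exp_def divide_inverse mult.commute)
  finally show "(\<Sum>k. \<bar>c k * x ^ k / fact k\<bar>) \<le> C * exp (\<delta> * \<bar>x\<bar>)" .
qed

lemma egf_abs_summable:
  assumes "slow_seq c"
  shows "summable (\<lambda>k. \<bar>c k * x ^ k / fact k\<bar>)"
proof -
  obtain C where "C \<ge> 0" "\<And>k. \<bar>c k\<bar> \<le> C * 1 ^ k" using slow_seqD[OF assms zero_less_one] by auto
  then show ?thesis by (intro egf_terms_le(1)[of c C 1]) auto
qed

lemma egf_summable: "slow_seq c \<Longrightarrow> summable (\<lambda>k. c k * x ^ k / fact k)"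
  by (rule summable_rabs_cancel[OF egf_abs_summable])

lemma egf_sums: "slow_seq c \<Longrightarrow> (\<lambda>k. c k * x ^ k / fact k) sums egf c x"
  unfolding egf_def by (intro summable_sums egf_summable)

lemma egf_le:
  assumes "slow_seq c" "\<delta> > 0"
  shows "\<exists>C\<ge>0. \<forall>x. \<bar>egf c x\<bar> \<le> C * exp (\<delta> * \<bar>x\<bar>)"
proof -
  obtain C where C: "C \<ge> 0" "\<And>k. \<bar>c k\<bar> \<le> C * \<delta> ^ k" using slow_seqD[OF assms] by auto
  have "\<bar>egf c x\<bar> \<le> C * exp (\<delta> * \<bar>x\<bar>)" for x
    unfolding egf_def
    by (rule order_trans[OF summable_rabs[OF egf_terms_le(1)] egf_terms_le(2)]) (use C assms in auto)
  with C(1) show ?thesis by blast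
qed

lemma slow_seq_cmult [intro]: "slow_seq c \<Longrightarrow> slow_seq (\<lambda>k. a * c k)"
  unfolding slow_seq_def
proof (intro allI impI)
  fix \<delta> :: real assume a: "\<forall>\<delta>>0. \<exists>C. \<forall>k. \<bar>c k\<bar> \<le> C * \<delta> ^ k" "0 < \<delta>"
  then obtain C where "\<forall>k. \<bar>c k\<bar> \<le> C * \<delta> ^ k" by blast
  then have "\<bar>a * c k\<bar> \<le> (\<bar>a\<bar> * C) * \<delta> ^ k" for k
    using mult_left_mono[of "\<bar>c k\<bar>" "C * \<delta> ^ k" "\<bar>a\<bar>"] by (simp add: abs_mult mult.assoc)
  then show "\<exists>C. \<forall>k. \<bar>a * c k\<bar> \<le> C * \<delta> ^ k" by blast
qed

lemma slow_seq_diff [intro]: "slow_seq c \<Longrightarrow> slow_seq d \<Longrightarrow> slow_seq (\<lambda>k. c k - d k)"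
  unfolding slow_seq_def
proof (intro allI impI)
  fix \<delta> :: real assume a: "\<forall>\<delta>>0. \<exists>C. \<forall>k. \<bar>c k\<bar> \<le> C * \<delta> ^ k" "\<forall>\<delta>>0. \<exists>C. \<forall>k. \<bar>d k\<bar> \<le> C * \<delta> ^ k" "0 < \<delta>"
  then obtain C D where "\<forall>k. \<bar>c k\<bar> \<le> C * \<delta> ^ k" "\<forall>k. \<bar>d k\<bar> \<le> D * \<delta> ^ k" by meson
  then have "\<bar>c k\<bar> + \<bar>d k\<bar> \<le> (C + D) * \<delta> ^ k" for k
    by (simp add: distrib_right add_mono)
  then have "\<bar>c k - d k\<bar> \<le> (C + D) * \<delta> ^ k" for k
    using abs_triangle_ineq4 order_trans by blast
  then show "\<exists>C. \<forall>k. \<bar>c k - d k\<bar> \<le> C * \<delta> ^ k" by blast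
qed

lemma slow_seq_Suc [intro]: "slow_seq c \<Longrightarrow> slow_seq (\<lambda>k. c (Suc k))"
  unfolding slow_seq_def
proof (intro allI impI)
  fix \<delta> :: real assume a: "\<forall>\<delta>>0. \<exists>C. \<forall>k. \<bar>c k\<bar> \<le> C * \<delta> ^ k" "0 < \<delta>"
  then obtain C where "\<forall>k. \<bar>c k\<bar> \<le> C * \<delta> ^ k" by blast
  then have "\<bar>c (Suc k)\<bar> \<le> C * \<delta> ^ Suc k" for k by blast
  then have "\<bar>c (Suc k)\<bar> \<le> (C * \<delta>) * \<delta> ^ k" for k by (simp add: mult.assoc)
  then show "\<exists>C. \<forall>k. \<bar>c (Suc k)\<bar> \<le> C * \<delta> ^ k" by blast
qed

text \<open>The factorial in \<open>egf\<close> makes differentiation a shift of the coefficients,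
  so the class is closed under it.\<close>

lemma egf_deriv:
  assumes "slow_seq c"
  shows "(egf c has_real_derivative egf (\<lambda>k. c (Suc k)) x) (at x)"
proof -
  have "((\<lambda>x. \<Sum>k. (c k / fact k) * x ^ k) has_real_derivative (\<Sum>k. diffs (\<lambda>k. c k / fact k) k * x ^ k)) (at x)"
  proof (rule termdiffs_strong_converges_everywhere)
    show "summable (\<lambda>k. (c k / fact k) * y ^ k)" for y
      using egf_summable[OF assms, of y] by simp
  qed
  moreover have "diffs (\<lambda>k. c k / fact k) k * x ^ k = c (Suc k) * x ^ k / fact k" for k
    unfolding diffs_def by (simp add: fact_Suc del: of_nat_Suc)
  ultimately show ?thesis unfolding egf_def[abs_def] by simp
qed

lemma egf_measurable:
  assumes "slow_seq c"
  shows "egf c \<in> borel_measurable borel"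
  by (intro borel_measurable_continuous_onI continuous_at_imp_continuous_on ballI
      DERIV_isCont[OF egf_deriv[OF assms]])

text \<open>A row of binomial coefficients sums to 2^k, so decay of the product at rate \<delta>
  follows from decay of both factors at rate \<delta>/2. The value is the Cauchy product of two
  absolutely convergent series.\<close>

lemma egf_binomial_mult:
  fixes c d :: "nat \<Rightarrow> real"
  assumes c: "slow_seq c" and d: "slow_seq d"
  shows "slow_seq (\<lambda>k. \<Sum>i\<le>k. (k choose i) * c i * d (k - i))"
    and "egf (\<lambda>k. \<Sum>i\<le>k. (k choose i) * c i * d (k - i)) x = egf c x * egf d x"
proof -
  show "slow_seq (\<lambda>k. \<Sum>i\<le>k. (k choose i) * c i * d (k - i))"
    unfolding slow_seq_def
  proof (intro allI impI)
    fix \<delta> :: real assume d0: "\<delta> > 0"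
    obtain C where C: "C \<ge> 0" "\<And>k. \<bar>c k\<bar> \<le> C * (\<delta>/2) ^ k" using slow_seqD[OF c, of "\<delta>/2"] d0 by auto
    obtain D where D: "D \<ge> 0" "\<And>k. \<bar>d k\<bar> \<le> D * (\<delta>/2) ^ k" using slow_seqD[OF d, of "\<delta>/2"] d0 by auto
    have "\<bar>\<Sum>i\<le>k. (k choose i) * c i * d (k - i)\<bar> \<le> (C * D) * \<delta> ^ k" for k
    proof -
      have "\<bar>\<Sum>i\<le>k. (k choose i) * c i * d (k - i)\<bar> \<le> (\<Sum>i\<le>k. \<bar>(k choose i) * c i * d (k - i)\<bar>)"
        by (rule sum_abs)
      also have "\<dots> \<le> (\<Sum>i\<le>k. (k choose i) * (C * D * (\<delta>/2) ^ k))"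
      proof (rule sum_mono)
        fix i assume i: "i \<in> {..k}"
        have "\<bar>c i\<bar> * \<bar>d (k - i)\<bar> \<le> (C * (\<delta>/2) ^ i) * (D * (\<delta>/2) ^ (k - i))"
          by (intro mult_mono C D) (use C d0 in auto)
        also have "\<dots> = C * D * ((\<delta>/2) ^ i * (\<delta>/2) ^ (k - i))" by simp
        also have "(\<delta>/2) ^ i * (\<delta>/2) ^ (k - i) = (\<delta>/2) ^ k" using i by (simp flip: power_add)
        finally have "\<bar>c i\<bar> * \<bar>d (k - i)\<bar> \<le> C * D * (\<delta>/2) ^ k" .
        from mult_left_mono[OF this, of "real (k choose i)"]
        show "\<bar>(k choose i) * c i * d (k - i)\<bar> \<le> (k choose i) * (C * D * (\<delta>/2) ^ k)"
          by (simp add: abs_mult mult.assoc)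
      qed
      also have "\<dots> = (\<Sum>i\<le>k. real (k choose i)) * (C * D * (\<delta>/2) ^ k)"
        by (simp add: sum_distrib_right)
      also have "(\<Sum>i\<le>k. real (k choose i)) = 2 ^ k"
        using choose_row_sum[of k] by (metis of_nat_numeral of_nat_power of_nat_sum)
      finally show ?thesis by (simp add: power_divide)
    qed
    then show "\<exists>C. \<forall>k. \<bar>\<Sum>i\<le>k. (k choose i) * c i * d (k - i)\<bar> \<le> C * \<delta> ^ k" by blast
  qed
  have nrm: "summable (\<lambda>k. norm (c k * x ^ k / fact k))" if "slow_seq c" for c
    using egf_abs_summable[OF that] by simp
  have "egf c x * egf d x = (\<Sum>k. \<Sum>i\<le>k. (c i * x ^ i / fact i) * (d (k - i) * x ^ (k - i) / fact (k - i)))"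
    unfolding egf_def by (rule Cauchy_product[OF nrm[OF c] nrm[OF d]])
  also have "\<dots> = egf (\<lambda>k. \<Sum>i\<le>k. (k choose i) * c i * d (k - i)) x"
    unfolding egf_def
  proof (rule suminf_cong)
    fix k
    have "(c i * x ^ i / fact i) * (d (k - i) * x ^ (k - i) / fact (k - i))
        = (k choose i) * c i * d (k - i) * x ^ k / fact k" if i: "i \<le> k" for i
    proof -
      have "x ^ k = x ^ i * x ^ (k - i)" using i by (simp flip: power_add)
      moreover have "real (k choose i) = fact k / (fact i * fact (k - i))" using binomial_fact[OF i] .
      ultimately show ?thesis by simp
    qed
    then show "(\<Sum>i\<le>k. (c i * x ^ i / fact i) * (d (k - i) * x ^ (k - i) / fact (k - i)))
       = (\<Sum>i\<le>k. (k choose i) * c i * d (k - i)) * x ^ k / fact k"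
      by (simp add: sum_distrib_right sum_divide_distrib)
  qed
  finally show "egf (\<lambda>k. \<Sum>i\<le>k. (k choose i) * c i * d (k - i)) x = egf c x * egf d x" by simp
qed

section \<open>Factorial bounds and the power series of cosine and sinc\<close>

lemma power_div_fact_le_exp:
  fixes x :: real
  assumes "x \<ge> 0"
  shows "x ^ k / fact k \<le> exp x"
proof -
  have "x ^ n / fact n \<ge> 0" for n using assms by simp
  then have "sum (\<lambda>n. x ^ n / fact n) {k} \<le> (\<Sum>n. x ^ n / fact n)"
    by (intro sum_le_suminf summable_exp_real) simp_all
  then show ?thesis by (simp add: exp_def divide_inverse mult.commute)
qed

text \<open>(Y / \<delta>)^k / k! is a single term of the series of exp (Y / \<delta>), hence
  bounded in k.\<close>

lemma slow_seqI_factorial: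
  fixes c :: "nat \<Rightarrow> real"
  assumes "Y \<ge> 0" "\<And>k. \<bar>c k\<bar> \<le> B * Y ^ k / fact k"
  shows "slow_seq c"
  unfolding slow_seq_def
proof (intro allI impI)
  fix \<delta> :: real assume d: "0 < \<delta>"
  have B: "B \<ge> 0" using assms(2)[of 0] by simp
  have "\<bar>c k\<bar> \<le> (B * exp (Y / \<delta>)) * \<delta> ^ k" for k
  proof -
    have "(Y / \<delta>) ^ k / fact k \<le> exp (Y / \<delta>)"
      using assms(1) d by (intro power_div_fact_le_exp) simp
    then have "B * ((Y / \<delta>) ^ k / fact k) * \<delta> ^ k \<le> B * exp (Y / \<delta>) * \<delta> ^ k"
      by (intro mult_right_mono mult_left_mono) (use B d in auto)
    with assms(2)[of k] d show ?thesis by (simp add: power_divide)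
  qed
  then show "\<exists>C. \<forall>k. \<bar>c k\<bar> \<le> C * \<delta> ^ k" by blast
qed

lemma fact_ratio_le: "fact k / fact (2 * k + j) \<le> (1::real) / fact k"
proof -
  have "fact k * fact k \<le> (fact (2 * k) :: real)"
  proof -
    have "fact k * fact k dvd (fact (k + k) :: nat)" by (rule fact_fact_dvd_fact)
    then have "fact k * fact k \<le> (fact (2 * k) :: nat)" by (simp add: dvd_imp_le mult_2)
    then have "real (fact k * fact k) \<le> real (fact (2 * k))" by (rule of_nat_mono)
    then show ?thesis by simp
  qed
  also have "(fact (2 * k) :: real) \<le> fact (2 * k + j)" by (rule fact_mono) simp
  finally show ?thesis by (simp add: field_simps)
qed

lemma egf_const: "slow_seq (\<lambda>k. if k = 0 then 1 else 0)" "egf (\<lambda>k. if k = 0 then 1 else 0) x = 1"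
proof -
  show "slow_seq (\<lambda>k. if k = 0 then 1 else 0)"
    unfolding slow_seq_def by (auto intro!: exI[of _ 1])
  show "egf (\<lambda>k. if k = 0 then 1 else 0) x = 1"
    unfolding egf_def by (subst suminf_finite[of "{0}"]) auto
qed

text \<open>Evenness in k makes cos (t k) and sin (t k) / k entire functions of x = k^2;
  \<open>cos_seq\<close> and \<open>sinc_seq\<close> are their coefficients in x, with
  \<open>fact k\<close> offsetting the division in \<open>egf\<close>.\<close>

definition cos_seq :: "real \<Rightarrow> nat \<Rightarrow> real" where
  "cos_seq t k = (-1) ^ k * t ^ (2 * k) * (fact k / fact (2 * k))"

definition sinc_seq :: "real \<Rightarrow> nat \<Rightarrow> real" where
  "sinc_seq t k = (-1) ^ k * t ^ (2 * k + 1) * (fact k / fact (2 * k + 1))"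

lemma cos_seq: "slow_seq (cos_seq t)" "egf (cos_seq t) (k\<^sup>2) = cos (t * k)"
proof -
  show "slow_seq (cos_seq t)"
  proof (rule slow_seqI_factorial)
    show "\<bar>cos_seq t k\<bar> \<le> 1 * (t\<^sup>2) ^ k / fact k" for k
      using mult_left_mono[OF fact_ratio_le[of k 0], of "(t\<^sup>2) ^ k"]
      by (simp add: cos_seq_def abs_mult power_abs power_mult)
  qed simp
  have "(\<lambda>n. (-1) ^ n / fact (2 * n) * (t * k) ^ (2 * n)) sums cos (t * k)"
    by (rule cos_paired)
  moreover have "cos_seq t n * (k\<^sup>2) ^ n / fact n = (-1) ^ n / fact (2 * n) * (t * k) ^ (2 * n)" for n
    by (simp add: cos_seq_def power_mult_distrib power_mult)
  ultimately show "egf (cos_seq t) (k\<^sup>2) = cos (t * k)"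
    unfolding egf_def by (simp add: sums_iff)
qed

lemma sinc_seq_le:
  "\<bar>sinc_seq t k\<bar> \<le> \<bar>t\<bar> * (t\<^sup>2) ^ k / fact k"
proof -
  have "\<bar>sinc_seq t k\<bar> = \<bar>t\<bar> * (t\<^sup>2) ^ k * (fact k / fact (2 * k + 1))"
    by (simp add: sinc_seq_def abs_mult power_abs power_mult)
  also have "\<dots> \<le> \<bar>t\<bar> * (t\<^sup>2) ^ k * (1 / fact k)"
    by (intro mult_left_mono fact_ratio_le) auto
  finally show ?thesis by simp
qed

text \<open>The factor \<open>k\<close> stays on the series side so that the identity also holds at
  k = 0.\<close>

lemma sinc_seq_sums: "(\<lambda>n. sinc_seq t n * (k\<^sup>2) ^ n / fact n * k) sums sin (t * k)"
proof -
  have "(\<lambda>n. (-1) ^ n / fact (2 * n + 1) * (t * k) ^ (2 * n + 1)) sums sin (t * k)"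
    by (rule sin_paired)
  moreover have "sinc_seq t n * (k\<^sup>2) ^ n / fact n * k = (-1) ^ n / fact (2 * n + 1) * (t * k) ^ (2 * n + 1)" for n
    by (simp add: sinc_seq_def power_mult_distrib power_mult)
  ultimately show ?thesis by simp
qed

lemma sinc_seq: "slow_seq (sinc_seq t)" "k \<noteq> 0 \<Longrightarrow> egf (sinc_seq t) (k\<^sup>2) = sin (t * k) / k"
proof -
  show s: "slow_seq (sinc_seq t)"
    by (rule slow_seqI_factorial[OF _ sinc_seq_le]) simp
  assume k: "k \<noteq> 0"
  have "(\<lambda>n. sinc_seq t n * (k\<^sup>2) ^ n / fact n * k) sums (egf (sinc_seq t) (k\<^sup>2) * k)"
    by (rule sums_mult2[OF egf_sums[OF s]])
  then have "egf (sinc_seq t) (k\<^sup>2) * k = sin (t * k)" using sinc_seq_sums sums_unique2 by blast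
  then show "egf (sinc_seq t) (k\<^sup>2) = sin (t * k) / k" using k by (simp add: field_simps)
qed

section \<open>Gaussian test functions are Schwartz\<close>

lemma egf_diff_cmult:
  assumes "slow_seq c" "slow_seq d"
  shows "egf (\<lambda>k. c k - a * d k) x = egf c x - a * egf d x"
proof -
  have "(\<lambda>k. c k * x ^ k / fact k - a * (d k * x ^ k / fact k)) sums (egf c x - a * egf d x)"
    by (intro sums_diff sums_mult egf_sums assms)
  then show ?thesis
    unfolding egf_def by (simp add: sums_iff algebra_simps diff_divide_distrib)
qed

text \<open>Differentiating the radial functions of \<open>base\<close> produces linear factors.
  Closing under these and under linear combinations gives a class stable under all partial
  derivatives, so one decay estimate for the class covers every iterated derivative.\<close>

inductive gaussian_class :: "real \<Rightarrow> ('a::euclidean_space \<Rightarrow> real) \<Rightarrow> bool" for a where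
  base: "slow_seq c \<Longrightarrow> gaussian_class a (\<lambda>\<xi>. exp (- a * (norm \<xi>)\<^sup>2) * egf c ((norm \<xi>)\<^sup>2))"
| add: "gaussian_class a f \<Longrightarrow> gaussian_class a g \<Longrightarrow> gaussian_class a (\<lambda>\<xi>. f \<xi> + g \<xi>)"
| cmult: "gaussian_class a f \<Longrightarrow> gaussian_class a (\<lambda>\<xi>. t * f \<xi>)"
| mult: "gaussian_class a f \<Longrightarrow> gaussian_class a (\<lambda>\<xi>. (\<xi> \<bullet> b) * f \<xi>)"

lemma gaussian_class_deriv:
  assumes "gaussian_class a f"
  shows "\<exists>f'. (\<forall>\<xi>. (f has_derivative f' \<xi>) (at \<xi>)) \<and> (\<forall>b. gaussian_class a (\<lambda>\<xi>. f' \<xi> b))"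
  using assms
proof induction
  case (base c)
  \<comment> \<open>The derivative of \<open>exp (- a * x) * egf c x\<close> is
    \<open>exp (- a * x)\<close> times the function generated by this sequence.\<close>
  let ?d = "\<lambda>k. c (Suc k) - a * c k"
  let ?f' = "\<lambda>\<xi> h. (\<xi> \<bullet> (2 *\<^sub>R h)) * (exp (- a * (norm \<xi>)\<^sup>2) * egf ?d ((norm \<xi>)\<^sup>2))"
  have d: "slow_seq ?d" using base by (intro slow_seq_diff slow_seq_cmult slow_seq_Suc)
  have "((\<lambda>\<xi>. exp (- a * (norm \<xi>)\<^sup>2) * egf c ((norm \<xi>)\<^sup>2)) has_derivative ?f' \<xi>) (at \<xi>)" for \<xi> :: 'a
  proof -
    have 1: "((\<lambda>\<xi>::'a. (norm \<xi>)\<^sup>2) has_derivative (\<lambda>h. \<xi> \<bullet> (2 *\<^sub>R h))) (at \<xi>)"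
      unfolding power2_norm_eq_inner
      by (auto intro!: derivative_eq_intros simp: inner_commute)
    have 2: "((\<lambda>x. exp (- a * x) * egf c x) has_real_derivative exp (- a * x) * egf ?d x) (at x)" for x
    proof -
      have "((\<lambda>x. exp (- a * x)) has_real_derivative exp (- a * x) * (- a)) (at x)"
        by (auto intro!: derivative_eq_intros)
      from DERIV_mult[OF this egf_deriv[OF base]] show ?thesis
        by (simp only: egf_diff_cmult[OF slow_seq_Suc[OF base] base]) (simp add: algebra_simps)
    qed
    have "((\<lambda>x. exp (- a * x) * egf c x) has_derivative (\<lambda>h. h * (exp (- a * x) * egf ?d x))) (at x)" for x
      using 2[of x] unfolding has_field_derivative_def
      by (rule has_derivative_eq_rhs) (simp add: fun_eq_iff mult.commute)
    from has_derivative_compose[OF 1 this] show ?thesis by simp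
  qed
  moreover have "gaussian_class a (\<lambda>\<xi>. ?f' \<xi> b)" for b
    by (intro gaussian_class.mult gaussian_class.base d)
  ultimately show ?case by (intro exI[of _ ?f']) auto
next
  case (add f g)
  then obtain f' g' where
    f: "\<And>\<xi>. (f has_derivative f' \<xi>) (at \<xi>)" "\<And>b. gaussian_class a (\<lambda>\<xi>. f' \<xi> b)" and
    g: "\<And>\<xi>. (g has_derivative g' \<xi>) (at \<xi>)" "\<And>b. gaussian_class a (\<lambda>\<xi>. g' \<xi> b)" by auto
  have "((\<lambda>\<xi>. f \<xi> + g \<xi>) has_derivative (\<lambda>h. f' \<xi> h + g' \<xi> h)) (at \<xi>)" for \<xi>
    by (intro has_derivative_add f g)
  then show ?case
    by (intro exI[of _ "\<lambda>\<xi> h. f' \<xi> h + g' \<xi> h"] conjI allI gaussian_class.add f g)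
next
  case (cmult f t)
  then obtain f' where
    f: "\<And>\<xi>. (f has_derivative f' \<xi>) (at \<xi>)" "\<And>b. gaussian_class a (\<lambda>\<xi>. f' \<xi> b)" by auto
  have "((\<lambda>\<xi>. t * f \<xi>) has_derivative (\<lambda>h. t * f' \<xi> h)) (at \<xi>)" for \<xi>
    by (intro has_derivative_mult_right f)
  then show ?case
    by (intro exI[of _ "\<lambda>\<xi> h. t * f' \<xi> h"] conjI allI gaussian_class.cmult f)
next
  case (mult f b)
  then obtain f' where
    f: "\<And>\<xi>. (f has_derivative f' \<xi>) (at \<xi>)" "\<And>b. gaussian_class a (\<lambda>\<xi>. f' \<xi> b)" by auto
  have "((\<lambda>\<xi>. (\<xi> \<bullet> b) * f \<xi>) has_derivative (\<lambda>h. (\<xi> \<bullet> b) * f' \<xi> h + (h \<bullet> b) * f \<xi>)) (at \<xi>)" for \<xi>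
    by (intro has_derivative_mult f has_derivative_inner_left has_derivative_ident)
  then show ?case
    by (intro exI[of _ "\<lambda>\<xi> h. (\<xi> \<bullet> b) * f' \<xi> h + (h \<bullet> b) * f \<xi>"] conjI allI
        gaussian_class.mult gaussian_class.add gaussian_class.cmult f mult.hyps)
qed

lemma one_plus_square_le_exp:
  fixes x \<eta> :: real
  assumes "\<eta> > 0"
  shows "1 + x\<^sup>2 \<le> (1 + 1 / \<eta>) * exp (\<eta> * x\<^sup>2)"
proof -
  have "\<eta> * x\<^sup>2 \<le> exp (\<eta> * x\<^sup>2)" using exp_ge_add_one_self[of "\<eta> * x\<^sup>2"] by linarith
  then have "x\<^sup>2 \<le> (1 / \<eta>) * exp (\<eta> * x\<^sup>2)" using assms by (simp add: field_simps)
  moreover have "1 \<le> exp (\<eta> * x\<^sup>2)" using assms by simp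
  ultimately show ?thesis by (simp add: distrib_right del: one_le_exp_iff)
qed

text \<open>The rate \<delta> is left arbitrary below \<open>a\<close> because a linear factor has
  to be paid for by a slightly slower Gaussian.\<close>

lemma gaussian_class_bound:
  assumes "gaussian_class a f" "\<delta> < a"
  shows "\<exists>C\<ge>0. \<forall>\<xi>. \<bar>f \<xi>\<bar> \<le> C * exp (- \<delta> * (norm \<xi>)\<^sup>2)"
  using assms
proof (induction arbitrary: \<delta>)
  case (base c)
  from egf_le[OF base(1), of "a - \<delta>"] base(2) obtain C where
    C: "C \<ge> 0" "\<And>x. \<bar>egf c x\<bar> \<le> C * exp ((a - \<delta>) * \<bar>x\<bar>)" by auto
  have "\<bar>exp (- a * (norm \<xi>)\<^sup>2) * egf c ((norm \<xi>)\<^sup>2)\<bar> \<le> C * exp (- \<delta> * (norm \<xi>)\<^sup>2)" for \<xi> :: 'a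
  proof -
    have "\<bar>exp (- a * (norm \<xi>)\<^sup>2) * egf c ((norm \<xi>)\<^sup>2)\<bar> \<le> exp (- a * (norm \<xi>)\<^sup>2) * (C * exp ((a - \<delta>) * (norm \<xi>)\<^sup>2))"
      using mult_left_mono[OF C(2)[of "(norm \<xi>)\<^sup>2"], of "exp (- a * (norm \<xi>)\<^sup>2)"] by (simp add: abs_mult)
    also have "\<dots> = C * exp (- a * (norm \<xi>)\<^sup>2 + (a - \<delta>) * (norm \<xi>)\<^sup>2)" by (simp only: exp_add mult_ac)
    also have "- a * (norm \<xi>)\<^sup>2 + (a - \<delta>) * (norm \<xi>)\<^sup>2 = - \<delta> * (norm \<xi>)\<^sup>2" by (simp add: algebra_simps)
    finally show ?thesis .
  qed
  with C(1) show ?case by blast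
next
  case (add f g)
  then obtain C D where C: "C \<ge> 0" "D \<ge> 0" "\<And>\<xi>. \<bar>f \<xi>\<bar> \<le> C * exp (- \<delta> * (norm \<xi>)\<^sup>2)"
    "\<And>\<xi>. \<bar>g \<xi>\<bar> \<le> D * exp (- \<delta> * (norm \<xi>)\<^sup>2)" by metis
  have "\<bar>f \<xi> + g \<xi>\<bar> \<le> (C + D) * exp (- \<delta> * (norm \<xi>)\<^sup>2)" for \<xi>
    using add_mono[OF C(3,4)] abs_triangle_ineq[of "f \<xi>" "g \<xi>"] by (metis distrib_right order_trans)
  then show ?case using C(1,2) by (intro exI[of _ "C + D"]) auto
next
  case (cmult f t)
  then obtain C where C: "C \<ge> 0" "\<And>\<xi>. \<bar>f \<xi>\<bar> \<le> C * exp (- \<delta> * (norm \<xi>)\<^sup>2)" by metis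
  have "\<bar>t * f \<xi>\<bar> \<le> (\<bar>t\<bar> * C) * exp (- \<delta> * (norm \<xi>)\<^sup>2)" for \<xi>
    using mult_left_mono[OF C(2), of "\<bar>t\<bar>"] by (simp add: abs_mult mult.assoc)
  then show ?case using C(1) by (intro exI[of _ "\<bar>t\<bar> * C"]) auto
next
  case (mult f b)
  \<comment> \<open>Half of the available gap: the induction hypothesis is used at rate \<delta> +
    \<eta>, and exp (\<eta> |xi|^2) is left to absorb the linear factor.\<close>
  define \<eta> where "\<eta> = (a - \<delta>) / 2"
  have \<eta>: "\<eta> > 0" "\<delta> + \<eta> < a" using mult.prems by (auto simp: \<eta>_def field_simps)
  from mult.IH[OF \<eta>(2)] obtain C where C: "C \<ge> 0" "\<And>\<xi>. \<bar>f \<xi>\<bar> \<le> C * exp (- (\<delta> + \<eta>) * (norm \<xi>)\<^sup>2)" by metis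
  have "\<bar>(\<xi> \<bullet> b) * f \<xi>\<bar> \<le> (norm b * (1 + 1 / \<eta>) * C) * exp (- \<delta> * (norm \<xi>)\<^sup>2)" for \<xi>
  proof -
    have "norm \<xi> \<le> 1 + (norm \<xi>)\<^sup>2"
      using zero_le_power2[of "norm \<xi> - 1/2"] by (simp add: power2_eq_square algebra_simps)
    also have "\<dots> \<le> (1 + 1 / \<eta>) * exp (\<eta> * (norm \<xi>)\<^sup>2)" by (rule one_plus_square_le_exp[OF \<eta>(1)])
    finally have "\<bar>\<xi> \<bullet> b\<bar> \<le> ((1 + 1 / \<eta>) * exp (\<eta> * (norm \<xi>)\<^sup>2)) * norm b"
      using Cauchy_Schwarz_ineq2[of \<xi> b] by (meson mult_right_mono norm_ge_zero order_trans)
    then have "\<bar>\<xi> \<bullet> b\<bar> * \<bar>f \<xi>\<bar> \<le> ((1 + 1 / \<eta>) * exp (\<eta> * (norm \<xi>)\<^sup>2) * norm b) * (C * exp (- (\<delta> + \<eta>) * (norm \<xi>)\<^sup>2))"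
      using \<eta> by (intro mult_mono C(2)) auto
    also have "\<dots> = (norm b * (1 + 1 / \<eta>) * C) * exp (\<eta> * (norm \<xi>)\<^sup>2 + - (\<delta> + \<eta>) * (norm \<xi>)\<^sup>2)"
      by (simp only: exp_add mult_ac)
    also have "\<eta> * (norm \<xi>)\<^sup>2 + - (\<delta> + \<eta>) * (norm \<xi>)\<^sup>2 = - \<delta> * (norm \<xi>)\<^sup>2" by (simp add: algebra_simps)
    finally show ?thesis by (simp add: abs_mult)
  qed
  then show ?case using C(1) \<eta>(1) by (intro exI[of _ "norm b * (1 + 1 / \<eta>) * C"]) auto
qed

lemma gaussian_class_iter_deriv:
  assumes "gaussian_class a f"
  shows "\<exists>g. gaussian_class a g \<and> iter_deriv bs (\<lambda>\<xi>. complex_of_real (f \<xi>)) = (\<lambda>\<xi>. complex_of_real (g \<xi>))"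
proof (induction bs)
  case Nil
  show ?case using assms by auto
next
  case (Cons b bs)
  then obtain g where g: "gaussian_class a g"
    "iter_deriv bs (\<lambda>\<xi>. complex_of_real (f \<xi>)) = (\<lambda>\<xi>. complex_of_real (g \<xi>))" by auto
  obtain g' where g': "\<And>\<xi>. (g has_derivative g' \<xi>) (at \<xi>)" "\<And>b. gaussian_class a (\<lambda>\<xi>. g' \<xi> b)"
    using gaussian_class_deriv[OF g(1)] by auto
  have "((\<lambda>\<xi>. complex_of_real (g \<xi>)) has_derivative (\<lambda>h. complex_of_real (g' \<xi> h))) (at \<xi>)" for \<xi>
    by (intro has_derivative_of_real g')
  then have "frechet_derivative (\<lambda>\<xi>. complex_of_real (g \<xi>)) (at \<xi>) = (\<lambda>h. complex_of_real (g' \<xi> h))" for \<xi>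
    by (metis frechet_derivative_at)
  then show ?case using g g' by (intro exI[of _ "\<lambda>\<xi>. g' \<xi> b"]) simp
qed

lemma gaussian_class_schwartz:
  assumes f: "gaussian_class a f" and a: "a > 0"
  shows "schwartz (\<lambda>\<xi>. complex_of_real (f \<xi>))"
  unfolding schwartz_def
proof (intro conjI allI impI)
  show "smooth (\<lambda>\<xi>. complex_of_real (f \<xi>))"
    unfolding smooth_def
  proof (intro allI impI)
    fix bs :: "'a list"
    obtain g where g: "gaussian_class a g"
      "iter_deriv bs (\<lambda>\<xi>. complex_of_real (f \<xi>)) = (\<lambda>\<xi>. complex_of_real (g \<xi>))"
      using gaussian_class_iter_deriv[OF f] by blast
    obtain g' where "\<And>\<xi>. (g has_derivative g' \<xi>) (at \<xi>)"
      using gaussian_class_deriv[OF g(1)] by auto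
    then have "((\<lambda>\<xi>. complex_of_real (g \<xi>)) has_derivative (\<lambda>h. complex_of_real (g' \<xi> h))) (at \<xi>)" for \<xi>
      by (intro has_derivative_of_real)
    then show "iter_deriv bs (\<lambda>\<xi>. complex_of_real (f \<xi>)) differentiable_on UNIV"
      unfolding g(2) differentiable_on_def differentiable_def by auto
  qed
next
  fix bs :: "'a list" and k :: nat
  obtain g where g: "gaussian_class a g"
    "iter_deriv bs (\<lambda>\<xi>. complex_of_real (f \<xi>)) = (\<lambda>\<xi>. complex_of_real (g \<xi>))"
    using gaussian_class_iter_deriv[OF f] by blast
  obtain C where C: "C \<ge> 0" "\<And>\<xi>. \<bar>g \<xi>\<bar> \<le> C * exp (- (a/2) * (norm \<xi>)\<^sup>2)"
    using gaussian_class_bound[OF g(1), of "a/2"] a by auto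
  have "(1 + norm x) ^ k * norm (iter_deriv bs (\<lambda>\<xi>. complex_of_real (f \<xi>)) x) \<le> C * exp ((real k)\<^sup>2 / (2 * a))" for x
  proof -
    have "(1 + norm x) ^ k \<le> exp (norm x) ^ k" by (intro power_mono exp_ge_add_one_self) simp
    also have "\<dots> = exp (k * norm x)" by (simp add: exp_of_nat_mult)
    finally have "(1 + norm x) ^ k * \<bar>g x\<bar> \<le> exp (k * norm x) * (C * exp (- (a/2) * (norm x)\<^sup>2))"
      by (intro mult_mono C) auto
    also have "\<dots> = C * exp (k * norm x + - (a/2) * (norm x)\<^sup>2)" by (simp only: exp_add mult_ac)
    also have "\<dots> \<le> C * exp ((real k)\<^sup>2 / (2 * a))"
    proof -
      \<comment> \<open>Completing the square shows where the maximum of k r - (a/2) r^2 lies and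
        that it equals k^2 / (2 a).\<close>
      have "0 \<le> (a * norm x - k)\<^sup>2 / (2 * a)" using a by simp
      also have "\<dots> = (real k)\<^sup>2 / (2 * a) - (k * norm x + - (a/2) * (norm x)\<^sup>2)"
        using a by (simp add: power2_eq_square field_simps)
      finally show ?thesis using C(1) by (intro mult_left_mono) auto
    qed
    finally show ?thesis by (simp add: g(2))
  qed
  then show "\<exists>B. \<forall>x. (1 + norm x) ^ k * norm (iter_deriv bs (\<lambda>\<xi>. complex_of_real (f \<xi>)) x) \<le> B" by blast
qed

section \<open>Laplace transforms and Gaussian integrals\<close>

text \<open>Lebesgue measure on a Euclidean space is the image of a finite product of copies of the
  real line, which reduces this to Fubini.\<close>

lemma lborel_integral_prod:
  fixes f :: "'a::euclidean_space \<Rightarrow> real \<Rightarrow> complex"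
  assumes int: "\<And>b. b \<in> Basis \<Longrightarrow> integrable lborel (f b)"
  shows "integrable lborel (\<lambda>x. \<Prod>b\<in>Basis. f b (x \<bullet> b))"
    and "(\<integral>x. (\<Prod>b\<in>Basis. f b (x \<bullet> b)) \<partial>lborel) = (\<Prod>b\<in>Basis. \<integral>x. f b x \<partial>lborel)"
proof -
  interpret product_sigma_finite "\<lambda>_::'a. lborel :: real measure" by unfold_locales
  have meas: "f b \<in> borel_measurable borel" if "b \<in> Basis" for b
    using borel_measurable_integrable[OF int[OF that]] by simp
  have T: "(\<lambda>g. \<Sum>b\<in>Basis. g b *\<^sub>R b) \<in> (\<Pi>\<^sub>M b\<in>Basis. lborel) \<rightarrow>\<^sub>M (borel :: 'a measure)"
    by measurable
  have m: "(\<lambda>x::'a. \<Prod>b\<in>Basis. f b (x \<bullet> b)) \<in> borel_measurable borel"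
    by (intro borel_measurable_prod measurable_compose[OF _ meas]) auto
  have eq: "(\<Prod>b\<in>Basis. f b ((\<Sum>b'\<in>Basis. g b' *\<^sub>R b') \<bullet> b)) = (\<Prod>b\<in>Basis. f b (g b))" for g :: "'a \<Rightarrow> real"
    by (intro prod.cong refl) simp
  show "integrable lborel (\<lambda>x. \<Prod>b\<in>Basis. f b (x \<bullet> b))"
    by (subst lborel_eq, subst integrable_distr_eq[OF T m])
      (simp only: eq, rule product_integrable_prod[OF finite_Basis int])
  show "(\<integral>x. (\<Prod>b\<in>Basis. f b (x \<bullet> b)) \<partial>lborel) = (\<Prod>b\<in>Basis. \<integral>x. f b x \<partial>lborel)"
    by (subst lborel_eq, subst integral_distr[OF T m])
      (simp only: eq, rule product_integral_prod[OF finite_Basis int])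
qed

text \<open>Up to scaling this is the characteristic function of the standard normal
  distribution.\<close>

lemma gaussian_fourier_real:
  assumes a: "a > 0"
  shows "integrable lborel (\<lambda>k::real. exp (- \<i> * of_real (r * k) - of_real (a * k\<^sup>2)))"
    and "(\<integral>k. exp (- \<i> * of_real (r * k) - of_real (a * k\<^sup>2)) \<partial>lborel)
       = complex_of_real (sqrt (pi / a) * exp (- r\<^sup>2 / (4 * a)))"
proof -
  \<comment> \<open>Under x = s k the exponent - a k^2 becomes - x^2 / 2, and the frequency r
    becomes r / s.\<close>
  define s where "s = sqrt (2 * a)"
  have s: "s > 0" "s\<^sup>2 = 2 * a" using a by (auto simp: s_def)
  let ?f = "\<lambda>t. \<lambda>x::real. std_normal_density x *\<^sub>R iexp (t * x)"
  have i1: "integrable lborel (?f t)" for t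
  proof (rule Bochner_Integration.integrable_bound)
    show "integrable lborel std_normal_density" by simp
    show "AE x in lborel. norm (?f t x) \<le> norm (std_normal_density x)" by simp
  qed simp
  have i2: "(\<integral>x. ?f t x \<partial>lborel) = complex_of_real (exp (- t\<^sup>2 / 2))" for t
  proof -
    have "char std_normal_distribution t = (\<integral>x. ?f t x \<partial>lborel)"
      unfolding char_def by (subst integral_density) auto
    then show ?thesis by (simp add: char_std_normal_distribution)
  qed
  have eq: "?f (- r / s) (0 + s * k) = complex_of_real (1 / sqrt (2 * pi)) * exp (- \<i> * of_real (r * k) - of_real (a * k\<^sup>2))" for k
  proof -
    have "(s * k)\<^sup>2 = 2 * a * k\<^sup>2" by (simp add: power_mult_distrib s)
    then have 1: "std_normal_density (0 + s * k) = (1 / sqrt (2 * pi)) * exp (- (a * k\<^sup>2))"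
      by (simp add: normal_density_def)
    have 2: "iexp (- r / s * (0 + s * k)) = exp (- \<i> * of_real (r * k))"
      using s by simp
    have 3: "exp (- \<i> * of_real (r * k) - of_real (a * k\<^sup>2)) = exp (- \<i> * of_real (r * k)) * complex_of_real (exp (- (a * k\<^sup>2)))"
      by (simp flip: exp_add exp_of_real)
    show ?thesis
      by (simp only: 1 2 3 scaleR_conv_of_real) (simp only: of_real_mult mult_ac)
  qed
  let ?E = "\<lambda>k::real. exp (- \<i> * of_real (r * k) - of_real (a * k\<^sup>2))"
  have "integrable lborel (\<lambda>k. ?f (- r / s) (0 + s * k))"
    by (rule lborel_integrable_real_affine[OF i1]) (use s in simp)
  then have "integrable lborel (\<lambda>k. complex_of_real (sqrt (2 * pi)) * (complex_of_real (1 / sqrt (2 * pi)) * ?E k))"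
    unfolding eq by (rule integrable_mult_right)
  moreover have "complex_of_real (sqrt (2 * pi)) * (complex_of_real (1 / sqrt (2 * pi)) * z) = z" for z
    unfolding mult.assoc[symmetric] of_real_mult[symmetric] by simp
  ultimately show "integrable lborel ?E" by (simp only:)
  have "complex_of_real (exp (- (- r / s)\<^sup>2 / 2)) = \<bar>s\<bar> *\<^sub>R (\<integral>k. ?f (- r / s) (0 + s * k) \<partial>lborel)"
    unfolding i2[symmetric] by (rule lborel_integral_real_affine) (use s in simp)
  then have "complex_of_real (exp (- (- r / s)\<^sup>2 / 2))
     = s *\<^sub>R (complex_of_real (1 / sqrt (2 * pi)) * (\<integral>k. ?E k \<partial>lborel))"
    unfolding eq integral_mult_right_zero using s(1) by (simp only: abs_of_pos)
  then have "complex_of_real (exp (- (- r / s)\<^sup>2 / 2))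
     = (s / sqrt (2 * pi)) * (\<integral>k. ?E k \<partial>lborel)"
    by (simp add: scaleR_conv_of_real)
  moreover have "- (- r / s)\<^sup>2 / 2 = - r\<^sup>2 / (4 * a)" using s by (simp add: power_divide)
  moreover have "s / sqrt (2 * pi) * sqrt (pi / a) = 1"
    using a by (simp add: s_def real_sqrt_mult real_sqrt_divide)
  moreover have "(s / sqrt (2 * pi)) * complex_of_real (sqrt (pi / a) * exp (- r\<^sup>2 / (4 * a)))
     = complex_of_real ((s / sqrt (2 * pi) * sqrt (pi / a)) * exp (- r\<^sup>2 / (4 * a)))"
    by (simp only: of_real_mult mult.assoc)
  ultimately have "(s / sqrt (2 * pi)) * complex_of_real (sqrt (pi / a) * exp (- r\<^sup>2 / (4 * a)))
     = (s / sqrt (2 * pi)) * (\<integral>k. exp (- \<i> * of_real (r * k) - of_real (a * k\<^sup>2)) \<partial>lborel)"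
    by (simp only: mult_1_left)
  then show "(\<integral>k. exp (- \<i> * of_real (r * k) - of_real (a * k\<^sup>2)) \<partial>lborel)
       = complex_of_real (sqrt (pi / a) * exp (- r\<^sup>2 / (4 * a)))"
    using s by simp
qed

lemma gaussian_fourier_euclidean:
  fixes x :: "'a::euclidean_space"
  assumes a: "a > 0"
  shows "integrable lborel (\<lambda>\<xi>::'a. exp (- a * (norm \<xi>)\<^sup>2))"
    and "(\<integral>\<xi>. exp (- a * (norm \<xi>)\<^sup>2) *\<^sub>R cis (- (x \<bullet> \<xi>)) \<partial>lborel)
       = complex_of_real (sqrt (pi / a) ^ DIM('a) * exp (- (norm x)\<^sup>2 / (4 * a)))"
proof -
  let ?f = "\<lambda>x::'a. \<lambda>b k. exp (- \<i> * of_real ((x \<bullet> b) * k) - of_real (a * k\<^sup>2))"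
  have nrm: "(norm y)\<^sup>2 = (\<Sum>b\<in>Basis. (y \<bullet> b)\<^sup>2)" for y :: 'a
    unfolding power2_norm_eq_inner by (subst euclidean_inner) (simp add: power2_eq_square)
  have eq: "(\<Prod>b\<in>Basis. ?f x b (\<xi> \<bullet> b)) = exp (- a * (norm \<xi>)\<^sup>2) *\<^sub>R cis (- (x \<bullet> \<xi>))" for \<xi> x :: 'a
  proof -
    have "(\<Prod>b\<in>Basis. ?f x b (\<xi> \<bullet> b)) = exp (\<Sum>b\<in>Basis. - \<i> * of_real ((x \<bullet> b) * (\<xi> \<bullet> b)) - of_real (a * (\<xi> \<bullet> b)\<^sup>2))"
      by (simp add: exp_sum)
    also have "(\<Sum>b\<in>Basis. - \<i> * of_real ((x \<bullet> b) * (\<xi> \<bullet> b)) - of_real (a * (\<xi> \<bullet> b)\<^sup>2))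
       = \<i> * of_real (- (x \<bullet> \<xi>)) + of_real (- a * (norm \<xi>)\<^sup>2)"
      unfolding nrm euclidean_inner[of x \<xi>]
      by (simp add: sum_subtractf sum_negf sum_distrib_left)
    finally show ?thesis
      by (simp only: exp_add cis_conv_exp scaleR_conv_of_real exp_of_real mult.commute)
  qed
  have "integrable lborel (\<lambda>\<xi>::'a. exp (- a * (norm \<xi>)\<^sup>2) *\<^sub>R cis (- (0 \<bullet> \<xi>)))"
    unfolding eq[symmetric] by (rule lborel_integral_prod(1)[OF gaussian_fourier_real(1)[OF a]])
  then have "integrable lborel (\<lambda>\<xi>::'a. Re (exp (- a * (norm \<xi>)\<^sup>2) *\<^sub>R cis (- (0 \<bullet> \<xi>))))"
    by (rule integrable_Re)
  then show "integrable lborel (\<lambda>\<xi>::'a. exp (- a * (norm \<xi>)\<^sup>2))" by simp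
  have "(\<integral>\<xi>. exp (- a * (norm \<xi>)\<^sup>2) *\<^sub>R cis (- (x \<bullet> \<xi>)) \<partial>lborel)
     = (\<Prod>b\<in>Basis. complex_of_real (sqrt (pi / a) * exp (- (x \<bullet> b)\<^sup>2 / (4 * a))))"
    unfolding eq[symmetric]
    by (subst lborel_integral_prod(2)[OF gaussian_fourier_real(1)[OF a]]) (simp only: gaussian_fourier_real(2)[OF a])
  also have "\<dots> = complex_of_real (sqrt (pi / a) ^ DIM('a) * exp (- (norm x)\<^sup>2 / (4 * a)))"
    unfolding nrm by (simp add: prod.distrib exp_sum sum_divide_distrib flip: sum_negf)
  finally show "(\<integral>\<xi>. exp (- a * (norm \<xi>)\<^sup>2) *\<^sub>R cis (- (x \<bullet> \<xi>)) \<partial>lborel)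
       = complex_of_real (sqrt (pi / a) ^ DIM('a) * exp (- (norm x)\<^sup>2 / (4 * a)))" .
qed

section \<open>Derivatives and superpositions of Laplace transforms\<close>

lemma power_times_exp_le:
  fixes a q :: real
  assumes "a > 0" "q \<ge> 0"
  shows "q ^ k * exp (- a * q) \<le> (fact k / (a/2) ^ k) * exp (- (a/2) * q)"
proof -
  \<comment> \<open>Half of the exponential is spent on the power; the other half remains as
    decay.\<close>
  have "(a/2 * q) ^ k / fact k \<le> exp (a/2 * q)"
    using assms by (intro power_div_fact_le_exp) simp
  then have "(a/2) ^ k * q ^ k \<le> exp (a/2 * q) * fact k"
    by (simp only: power_mult_distrib pos_divide_le_eq[OF fact_gt_zero])
  then have "q ^ k \<le> (fact k / (a/2) ^ k) * exp (a/2 * q)"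
    using assms(1) by (simp add: pos_le_divide_eq mult.commute)
  then have "q ^ k * exp (- a * q) \<le> (fact k / (a/2) ^ k) * exp (a/2 * q) * exp (- a * q)"
    by (intro mult_right_mono) auto
  also have "\<dots> = (fact k / (a/2) ^ k) * exp (a/2 * q + - a * q)" by (simp only: exp_add mult.assoc)
  also have "a/2 * q + - a * q = - (a/2) * q" by simp
  finally show ?thesis .
qed

text \<open>Each derivative in \<open>a\<close> brings down a factor - q. Near \<open>a\<close> the
  parameter stays above a/2, so the integrand at a/2 dominates.\<close>

lemma laplace_power:
  fixes g :: "'a \<Rightarrow> complex"
  assumes q: "q \<in> borel_measurable M" "\<And>x. q x \<ge> 0"
    and int: "\<And>a. a > 0 \<Longrightarrow> integrable M (\<lambda>x. exp (- a * q x) *\<^sub>R g x)" and a: "a > 0"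
  shows "integrable M (\<lambda>x. (q x ^ k * exp (- a * q x)) *\<^sub>R g x)"
    and "((\<lambda>a. \<integral>x. (q x ^ k * exp (- a * q x)) *\<^sub>R g x \<partial>M) has_vector_derivative
          - (\<integral>x. (q x ^ Suc k * exp (- a * q x)) *\<^sub>R g x \<partial>M)) (at a)"
proof -
  let ?I = "\<lambda>k a x. (q x ^ k * exp (- a * q x)) *\<^sub>R g x"
  note q(1)[measurable]
  have [measurable]: "g \<in> borel_measurable M"
  proof -
    have "(\<lambda>x. exp (q x) *\<^sub>R (exp (- 1 * q x) *\<^sub>R g x)) \<in> borel_measurable M"
      using borel_measurable_integrable[OF int[of 1]] by measurable
    then show ?thesis by (simp add: exp_minus)
  qed
  have i: "integrable M (\<lambda>x. ?I k a x)" if a: "a > 0" for k a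
  proof (rule Bochner_Integration.integrable_bound)
    show "integrable M (\<lambda>x. (fact k / (a/2) ^ k) * norm (exp (- (a/2) * q x) *\<^sub>R g x))"
      using int[of "a/2"] a by (intro integrable_mult_right integrable_norm) auto
    show "AE x in M. norm (?I k a x)
       \<le> norm ((fact k / (a/2) ^ k) * norm (exp (- (a/2) * q x) *\<^sub>R g x))"
    proof (rule AE_I2)
      fix x
      from mult_right_mono[OF power_times_exp_le[OF a q(2)[of x], of k], of "norm (g x)"]
      show "norm (?I k a x)
       \<le> norm ((fact k / (a/2) ^ k) * norm (exp (- (a/2) * q x) *\<^sub>R g x))"
        using a q(2)[of x] by (simp add: abs_mult)
    qed
  qed measurable
  show "integrable M (\<lambda>x. ?I k a x)" by (rule i[OF a])
  have "((\<lambda>a. \<integral>x. ?I k a x \<partial>M) has_vector_derivative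
          (\<integral>x. - (?I (Suc k) a x) \<partial>M)) (at a)"
  proof (rule has_vector_derivative_integral(2)[where \<delta> = "a/2"
        and B = "\<lambda>x. norm (?I (Suc k) (a/2) x)"])
    show "0 < a/2" using a by simp
    show "integrable M (\<lambda>x. ?I k t x)" if "\<bar>t - a\<bar> < a/2" for t
      by (rule i) (use that a in linarith)
    show "integrable M (\<lambda>x. norm (?I (Suc k) (a/2) x))"
      using a by (intro integrable_norm i) auto
    show "((\<lambda>t. ?I k t x) has_vector_derivative
        - (?I (Suc k) t x)) (at t)" for t x
    proof -
      have "((\<lambda>t. q x ^ k * exp (- t * q x)) has_real_derivative - (q x ^ Suc k * exp (- t * q x))) (at t)"
        by (auto intro!: derivative_eq_intros)
      from has_vector_derivative_scaleR[OF this has_vector_derivative_const, of "g x"]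
      show ?thesis by simp
    qed
    show "norm (- (?I (Suc k) t x)) \<le> norm (?I (Suc k) (a/2) x)"
      if "\<bar>t - a\<bar> < a/2" for t x
    proof -
      have "exp (- t * q x) \<le> exp (- (a/2) * q x)"
      proof -
        have "a/2 \<le> t" using that by (simp add: abs_if split: if_splits)
        from mult_right_mono[OF this q(2)[of x]] show ?thesis by simp
      qed
      then show ?thesis using q(2)[of x]
        by (auto simp: abs_mult intro!: mult_right_mono mult_left_mono)
    qed
  qed
  then show "((\<lambda>a. \<integral>x. ?I k a x \<partial>M) has_vector_derivative
          - (\<integral>x. ?I (Suc k) a x \<partial>M)) (at a)" by simp
qed

text \<open>The growth condition with \<delta> = a/2 bounds every partial sum of
  \<open>egf c (q x)\<close> by C exp (a q / 2), and half of exp (- a q) is left over to dominate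
  the integrands.\<close>

lemma laplace_egf_sequence:
  fixes g :: "'a \<Rightarrow> complex"
  assumes q: "q \<in> borel_measurable M" "\<And>x. q x \<ge> 0"
    and int: "\<And>a. a > 0 \<Longrightarrow> integrable M (\<lambda>x. exp (- a * q x) *\<^sub>R g x)" and a: "a > 0" and c: "slow_seq c"
  shows "(\<lambda>n. \<Sum>k<n. (c k / fact k) *\<^sub>R (\<integral>x. (q x ^ k * exp (- a * q x)) *\<^sub>R g x \<partial>M))
     \<longlonglongrightarrow> (\<integral>x. (exp (- a * q x) * egf c (q x)) *\<^sub>R g x \<partial>M)"
proof -
  from slow_seqD[OF c, of "a/2"] a obtain C where C: "C \<ge> 0" "\<And>k. \<bar>c k\<bar> \<le> C * (a/2) ^ k" by auto
  note egt = egf_terms_le[OF C(2,1)]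
  let ?s = "\<lambda>n x. \<Sum>k<n. (c k / fact k) *\<^sub>R ((q x ^ k * exp (- a * q x)) *\<^sub>R g x)"
  have s: "?s n x = ((\<Sum>k<n. c k * q x ^ k / fact k) * exp (- a * q x)) *\<^sub>R g x" for n x
    unfolding sum_distrib_right scaleR_sum_left scaleR_scaleR by (intro sum.cong) auto
  have ints: "integrable M (?s n)" for n
    by (intro Bochner_Integration.integrable_sum integrable_scaleR_right laplace_power(1)[OF q int a])
  have lim: "(\<lambda>n. ?s n x) \<longlonglongrightarrow> (exp (- a * q x) * egf c (q x)) *\<^sub>R g x" for x
  proof -
    have "(\<lambda>n. \<Sum>k<n. c k * q x ^ k / fact k) \<longlonglongrightarrow> egf c (q x)"
      using egf_sums[OF c, of "q x"] by (simp add: sums_def)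
    then have "(\<lambda>n. ((\<Sum>k<n. c k * q x ^ k / fact k) * exp (- a * q x)) *\<^sub>R g x) \<longlonglongrightarrow> (egf c (q x) * exp (- a * q x)) *\<^sub>R g x"
      by (intro tendsto_intros)
    then show ?thesis unfolding s by (simp add: mult.commute)
  qed
  have "(\<lambda>n. \<integral>x. ?s n x \<partial>M) \<longlonglongrightarrow> (\<integral>x. (exp (- a * q x) * egf c (q x)) *\<^sub>R g x \<partial>M)"
  proof (rule integral_dominated_convergence[where w = "\<lambda>x. C * norm (exp (- (a/2) * q x) *\<^sub>R g x)"])
    show "?s n \<in> borel_measurable M" for n by (rule borel_measurable_integrable[OF ints])
    then show "(\<lambda>x. (exp (- a * q x) * egf c (q x)) *\<^sub>R g x) \<in> borel_measurable M"
      by (rule borel_measurable_LIMSEQ_metric[OF _ lim])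
    show "integrable M (\<lambda>x. C * norm (exp (- (a/2) * q x) *\<^sub>R g x))"
      using a by (intro integrable_mult_right integrable_norm int) auto
    show "AE x in M. (\<lambda>n. ?s n x) \<longlonglongrightarrow> (exp (- a * q x) * egf c (q x)) *\<^sub>R g x" using lim by simp
    show "AE x in M. norm (?s n x) \<le> C * norm (exp (- (a/2) * q x) *\<^sub>R g x)" for n
    proof (rule AE_I2)
      fix x
      have "\<bar>\<Sum>k<n. c k * q x ^ k / fact k\<bar> \<le> (\<Sum>k<n. \<bar>c k * q x ^ k / fact k\<bar>)" by (rule sum_abs)
      also have "\<dots> \<le> (\<Sum>k. \<bar>c k * q x ^ k / fact k\<bar>)"
        using egt(1)[of "q x"] a by (intro sum_le_suminf) auto
      also have "\<dots> \<le> C * exp (a/2 * q x)" using egt(2)[of "q x"] a q(2)[of x] by simp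
      finally have "\<bar>\<Sum>k<n. c k * q x ^ k / fact k\<bar> * exp (- a * q x) \<le> C * exp (a/2 * q x) * exp (- a * q x)"
        by (intro mult_right_mono) auto
      also have "\<dots> = C * exp (a/2 * q x + - a * q x)" by (simp only: exp_add mult.assoc)
      also have "a/2 * q x + - a * q x = - (a/2) * q x" by simp
      finally show "norm (?s n x) \<le> C * norm (exp (- (a/2) * q x) *\<^sub>R g x)"
        unfolding s by (auto simp: abs_mult mult.assoc[symmetric] intro!: mult_right_mono)
    qed
  qed
  moreover have "(\<integral>x. ?s n x \<partial>M) = (\<Sum>k<n. (c k / fact k) *\<^sub>R (\<integral>x. (q x ^ k * exp (- a * q x)) *\<^sub>R g x \<partial>M))" for n
  proof -
    have "(\<integral>x. ?s n x \<partial>M) = (\<Sum>k<n. \<integral>x. (c k / fact k) *\<^sub>R ((q x ^ k * exp (- a * q x)) *\<^sub>R g x) \<partial>M)"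
      by (rule Bochner_Integration.integral_sum)
        (intro integrable_scaleR_right laplace_power(1)[OF q int a])
    then show ?thesis by (simp only: integral_scaleR_right)
  qed
  ultimately show ?thesis by (simp only:)
qed

text \<open>Equality of the two Laplace transforms is differentiated in \<open>a\<close> and summed.\<close>

lemma laplace_egf_eq:
  fixes g :: "'a \<Rightarrow> complex" and g' :: "'b \<Rightarrow> complex"
  assumes q: "q \<in> borel_measurable M" "\<And>x. q x \<ge> 0"
    and int: "\<And>a. a > 0 \<Longrightarrow> integrable M (\<lambda>x. exp (- a * q x) *\<^sub>R g x)"
    and q': "q' \<in> borel_measurable M'" "\<And>x. q' x \<ge> 0"
    and int': "\<And>a. a > 0 \<Longrightarrow> integrable M' (\<lambda>x. exp (- a * q' x) *\<^sub>R g' x)"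
    and eq: "\<And>a. a > 0 \<Longrightarrow> (\<integral>x. exp (- a * q x) *\<^sub>R g x \<partial>M) = (\<integral>x. exp (- a * q' x) *\<^sub>R g' x \<partial>M')"
    and a: "a > 0" and c: "slow_seq c"
  shows "(\<integral>x. (exp (- a * q x) * egf c (q x)) *\<^sub>R g x \<partial>M) = (\<integral>x. (exp (- a * q' x) * egf c (q' x)) *\<^sub>R g' x \<partial>M')"
proof -
  let ?J = "\<lambda>k a. \<integral>x. (q x ^ k * exp (- a * q x)) *\<^sub>R g x \<partial>M"
  let ?J' = "\<lambda>k a. \<integral>x. (q' x ^ k * exp (- a * q' x)) *\<^sub>R g' x \<partial>M'"
  have J: "?J k a = ?J' k a" if "a > 0" for k a
    using that
  proof (induction k arbitrary: a)
    case 0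
    then show ?case using eq by simp
  next
    case (Suc k)
    have "(?J' k has_vector_derivative - ?J' (Suc k) a) (at a)"
      by (rule laplace_power(2)[OF q' int' Suc.prems])
    moreover have "(?J' k has_vector_derivative - ?J (Suc k) a) (at a)"
    proof (rule has_vector_derivative_transform_within_open[OF laplace_power(2)[OF q int Suc.prems]])
      show "open {0::real<..}" "a \<in> {0<..}" using Suc.prems by auto
      show "?J k t = ?J' k t" if "t \<in> {0<..}" for t using Suc.IH[of t] that by auto
    qed
    ultimately have "- ?J' (Suc k) a = - ?J (Suc k) a" by (rule vector_derivative_unique_at)
    then show ?case by simp
  qed
  have "(\<lambda>n. \<Sum>k<n. (c k / fact k) *\<^sub>R ?J k a) \<longlonglongrightarrow> (\<integral>x. (exp (- a * q' x) * egf c (q' x)) *\<^sub>R g' x \<partial>M')"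
    unfolding J[OF a] by (rule laplace_egf_sequence[OF q' int' a c])
  with laplace_egf_sequence[OF q int a c] show ?thesis by (rule LIMSEQ_unique)
qed

section \<open>Gaussian integrals against cosine and sine\<close>

lemma gaussian_cos:
  fixes a r :: real
  assumes a: "a > 0"
  shows "integrable lborel (\<lambda>k::real. exp (- a * k\<^sup>2) * cos (r * k))"
    and "(\<integral>k. exp (- a * k\<^sup>2) * cos (r * k) \<partial>lborel) = sqrt (pi / a) * exp (- r\<^sup>2 / (4 * a))"
proof -
  have re: "Re (exp (- \<i> * of_real (r * k) - of_real (a * k\<^sup>2))) = exp (- a * k\<^sup>2) * cos (r * k)" for k
    by (simp add: Re_exp)
  from integrable_Re[OF gaussian_fourier_real(1)[OF a, of r]]
  show "integrable lborel (\<lambda>k::real. exp (- a * k\<^sup>2) * cos (r * k))" unfolding re .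
  have "(\<integral>k. exp (- a * k\<^sup>2) * cos (r * k) \<partial>lborel)
     = Re (\<integral>k. exp (- \<i> * of_real (r * k) - of_real (a * k\<^sup>2)) \<partial>lborel)"
    unfolding re[symmetric] by (rule integral_Re[OF gaussian_fourier_real(1)[OF a, of r]])
  then show "(\<integral>k. exp (- a * k\<^sup>2) * cos (r * k) \<partial>lborel) = sqrt (pi / a) * exp (- r\<^sup>2 / (4 * a))"
    unfolding gaussian_fourier_real(2)[OF a] by simp
qed

lemma gaussian_real_integrable:
  fixes a :: real
  assumes "a > 0"
  shows "integrable lborel (\<lambda>k::real. exp (- a * k\<^sup>2))"
  using gaussian_cos(1)[OF assms, of 0] by simp

lemma gaussian_abs_integrable:
  fixes a :: real
  assumes a: "a > 0"
  shows "integrable lborel (\<lambda>k::real. \<bar>k\<bar> * exp (- a * k\<^sup>2))"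
proof (rule Bochner_Integration.integrable_bound)
  show "integrable lborel (\<lambda>k::real. (1 + 2 / a) * exp (- (a/2) * k\<^sup>2))"
    using a by (intro integrable_mult_right gaussian_real_integrable) simp
  show "AE k in lborel. norm (\<bar>k\<bar> * exp (- a * k\<^sup>2)) \<le> norm ((1 + 2 / a) * exp (- (a/2) * k\<^sup>2))"
  proof (rule AE_I2)
    fix k :: real
    have "\<bar>k\<bar> \<le> 1 + k\<^sup>2"
      using zero_le_power2[of "\<bar>k\<bar> - 1/2"] by (simp add: power2_eq_square algebra_simps)
    also have "\<dots> \<le> (1 + 1 / (a/2)) * exp (a/2 * k\<^sup>2)"
      using a by (intro one_plus_square_le_exp) simp
    finally have "\<bar>k\<bar> * exp (- a * k\<^sup>2) \<le> (1 + 1 / (a/2)) * exp (a/2 * k\<^sup>2) * exp (- a * k\<^sup>2)"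
      by (intro mult_right_mono) auto
    also have "\<dots> = (1 + 2 / a) * exp (a/2 * k\<^sup>2 + - a * k\<^sup>2)"
      by (simp only: exp_add mult.assoc) simp
    also have "a/2 * k\<^sup>2 + - a * k\<^sup>2 = - (a/2) * k\<^sup>2" by simp
    finally show "norm (\<bar>k\<bar> * exp (- a * k\<^sup>2)) \<le> norm ((1 + 2 / a) * exp (- (a/2) * k\<^sup>2))"
      using a by (simp add: abs_mult)
  qed
qed measurable

text \<open>Minus the derivative in \<open>r\<close> of the formula in \<open>gaussian_cos\<close>,
  with |k| exp (- a k^2) as dominating function.\<close>

lemma gaussian_k_sin:
  fixes a r :: real
  assumes a: "a > 0"
  shows "integrable lborel (\<lambda>k::real. exp (- a * k\<^sup>2) * (k * sin (r * k)))"
    and "(\<integral>k. exp (- a * k\<^sup>2) * (k * sin (r * k)) \<partial>lborel) = r / (2 * a) * (sqrt (pi / a) * exp (- r\<^sup>2 / (4 * a)))"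
proof -
  have bd: "\<bar>- (exp (- a * k\<^sup>2) * (k * sin (t * k)))\<bar> \<le> \<bar>k\<bar> * exp (- a * k\<^sup>2)" for t k
    using mult_left_mono[OF abs_sin_le_one[of "t * k"], of "exp (- a * k\<^sup>2) * \<bar>k\<bar>"]
    by (simp add: abs_mult mult_ac)
  note D = has_vector_derivative_integral[where \<delta> = 1 and M = lborel and ?t0.0 = r
      and f = "\<lambda>t k. exp (- a * k\<^sup>2) * cos (t * k)" and f' = "\<lambda>t k. - (exp (- a * k\<^sup>2) * (k * sin (t * k)))"
      and B = "\<lambda>k. \<bar>k\<bar> * exp (- a * k\<^sup>2)"]
  have dv: "((\<lambda>t. exp (- a * k\<^sup>2) * cos (t * k)) has_vector_derivative - (exp (- a * k\<^sup>2) * (k * sin (t * k)))) (at t)" for t k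
    unfolding has_real_derivative_iff_has_vector_derivative[symmetric]
    by (auto intro!: derivative_eq_intros)
  have "integrable lborel (\<lambda>k. - (exp (- a * k\<^sup>2) * (k * sin (r * k))))"
    by (rule D(1)) (use bd dv gaussian_abs_integrable[OF a] gaussian_cos(1)[OF a] in auto)
  then show "integrable lborel (\<lambda>k::real. exp (- a * k\<^sup>2) * (k * sin (r * k)))" by simp
  have "((\<lambda>t. \<integral>k. exp (- a * k\<^sup>2) * cos (t * k) \<partial>lborel) has_vector_derivative
     (\<integral>k. - (exp (- a * k\<^sup>2) * (k * sin (r * k))) \<partial>lborel)) (at r)"
    by (rule D(2)) (use bd dv gaussian_abs_integrable[OF a] gaussian_cos(1)[OF a] in auto)
  then have "((\<lambda>t. sqrt (pi / a) * exp (- t\<^sup>2 / (4 * a))) has_real_derivative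
     - (\<integral>k. (exp (- a * k\<^sup>2) * (k * sin (r * k))) \<partial>lborel)) (at r)"
    unfolding gaussian_cos(2)[OF a] has_real_derivative_iff_has_vector_derivative by simp
  moreover have "((\<lambda>t. sqrt (pi / a) * exp (- t\<^sup>2 / (4 * a))) has_real_derivative
     - (r / (2 * a) * (sqrt (pi / a) * exp (- r\<^sup>2 / (4 * a))))) (at r)"
    using a by (auto intro!: derivative_eq_intros simp: field_simps)
  ultimately show "(\<integral>k. exp (- a * k\<^sup>2) * (k * sin (r * k)) \<partial>lborel) = r / (2 * a) * (sqrt (pi / a) * exp (- r\<^sup>2 / (4 * a)))"
    using DERIV_unique by fastforce
qed

section \<open>Radial functions in three dimensions\<close>

text \<open>Both sides are Laplace integrals in \<open>a\<close>, one over R^3 with q = |xi|^2, the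
  other over the line with q = k^2. For a pure Gaussian both equal (pi / a)^(3/2) exp (- r^2 / (4
  a)), and \<open>laplace_egf_eq\<close> carries this over to the factor \<open>egf c\<close>. No
  integration over spheres is involved. The factor is 2 pi instead of the usual 4 pi because k runs
  over the whole line.\<close>

lemma fourier_gaussian_egf:
  fixes x :: "real^3"
  assumes a: "a > 0" and c: "slow_seq c" and x: "x \<noteq> 0"
  shows "fourier (\<lambda>\<xi>. complex_of_real (exp (- a * (norm \<xi>)\<^sup>2) * egf c ((norm \<xi>)\<^sup>2))) x
    = complex_of_real (2 * pi / norm x * (\<integral>k. exp (- a * k\<^sup>2) * egf c (k\<^sup>2) * (k * sin (norm x * k)) \<partial>lborel))"
proof -
  define r where "r = norm x"
  have r: "r > 0" using x by (simp add: r_def)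
  let ?g = "\<lambda>\<xi>::real^3. cis (- (x \<bullet> \<xi>))"
  let ?g' = "\<lambda>k. complex_of_real (2 * pi / r * (k * sin (r * k)))"
  have "fourier (\<lambda>\<xi>. complex_of_real (exp (- a * (norm \<xi>)\<^sup>2) * egf c ((norm \<xi>)\<^sup>2))) x
     = (\<integral>\<xi>. (exp (- a * (norm \<xi>)\<^sup>2) * egf c ((norm \<xi>)\<^sup>2)) *\<^sub>R ?g \<xi> \<partial>lborel)"
    unfolding fourier_def by (simp add: scaleR_conv_of_real inner_commute mult.commute)
  also have "\<dots> = (\<integral>k. (exp (- a * k\<^sup>2) * egf c (k\<^sup>2)) *\<^sub>R ?g' k \<partial>lborel)"
  proof (rule laplace_egf_eq[OF _ _ _ _ _ _ _ a c])
    fix a :: real assume a: "a > 0"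
    show "integrable lborel (\<lambda>\<xi>::real^3. exp (- a * (norm \<xi>)\<^sup>2) *\<^sub>R ?g \<xi>)"
    proof (rule Bochner_Integration.integrable_bound[OF gaussian_fourier_euclidean(1)[OF a]])
      show "(\<lambda>\<xi>::real^3. exp (- a * (norm \<xi>)\<^sup>2) *\<^sub>R ?g \<xi>) \<in> borel_measurable lborel"
        by (intro borel_measurable_continuous_onI borel_measurable_scaleR continuous_intros | simp)+
    qed simp
    have e: "exp (- a * k\<^sup>2) *\<^sub>R ?g' k = complex_of_real (2 * pi / r * (exp (- a * k\<^sup>2) * (k * sin (r * k))))" for k
      by (simp add: scaleR_conv_of_real mult_ac)
    show "integrable lborel (\<lambda>k. exp (- a * k\<^sup>2) *\<^sub>R ?g' k)"
      unfolding e by (intro integrable_of_real integrable_mult_right gaussian_k_sin(1)[OF a])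
    have "(\<integral>k. exp (- a * k\<^sup>2) *\<^sub>R ?g' k \<partial>lborel)
       = complex_of_real (2 * pi / r * (r / (2 * a) * (sqrt (pi / a) * exp (- r\<^sup>2 / (4 * a)))))"
      unfolding e integral_complex_of_real integral_mult_right_zero gaussian_k_sin(2)[OF a] ..
    also have "2 * pi / r * (r / (2 * a) * (sqrt (pi / a) * exp (- r\<^sup>2 / (4 * a))))
       = sqrt (pi / a) ^ 3 * exp (- r\<^sup>2 / (4 * a))"
      using a r by (simp add: power3_eq_cube)
    finally show "(\<integral>\<xi>. exp (- a * (norm \<xi>)\<^sup>2) *\<^sub>R ?g \<xi> \<partial>lborel) = (\<integral>k. exp (- a * k\<^sup>2) *\<^sub>R ?g' k \<partial>lborel)"
      unfolding gaussian_fourier_euclidean(2)[OF a] by (simp add: r_def)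
  qed auto
  also have "\<dots> = (\<integral>k. complex_of_real (2 * pi / r * (exp (- a * k\<^sup>2) * egf c (k\<^sup>2) * (k * sin (r * k)))) \<partial>lborel)"
    by (intro Bochner_Integration.integral_cong refl) (simp add: scaleR_conv_of_real mult_ac)
  also have "\<dots> = complex_of_real (2 * pi / r * (\<integral>k. exp (- a * k\<^sup>2) * egf c (k\<^sup>2) * (k * sin (r * k)) \<partial>lborel))"
    unfolding integral_complex_of_real integral_mult_right_zero ..
  finally show ?thesis unfolding r_def .
qed

text \<open>The half-lines {..r} determine a measure on the line; on them one side is the volume of
  a ball and the other the integral of 4 pi s^2.\<close>

lemma distr_norm_real3:
  "distr lborel borel (norm :: real^3 \<Rightarrow> real) = density lborel (\<lambda>r. ennreal (indicator {0<..} r * (4 * pi * r\<^sup>2)))"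
  (is "?M = ?N")
proof (rule measure_eqI_generator_eq[where E = "range atMost" and A = "\<lambda>n. {..real n}" and \<Omega> = UNIV])
  show "Int_stable (range (atMost :: real \<Rightarrow> _))" by (auto simp: Int_stable_def)
  have M: "emeasure ?M {..r} = (if r \<ge> 0 then ennreal (4 / 3 * pi * r ^ 3) else 0)" for r
  proof -
    have "emeasure ?M {..r} = emeasure lborel (cball (0::real^3) r)"
      by (subst emeasure_distr) (auto intro!: arg_cong[where f = "emeasure lborel"])
    also have "\<dots> = (if r \<ge> 0 then ennreal (4 / 3 * pi * r ^ 3) else 0)"
      by (simp add: emeasure_cball unit_ball_vol_3)
    finally show ?thesis .
  qed
  show "emeasure ?M X = emeasure ?N X" if X: "X \<in> range atMost" for X
  proof -
    obtain r where r: "X = {..r}" using X by auto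
    have "emeasure ?N {..r} = (\<integral>\<^sup>+s. ennreal (indicator {0<..} s * (4 * pi * s\<^sup>2)) * indicator {..r} s \<partial>lborel)"
      by (subst emeasure_density) auto
    also have "\<dots> = (if r \<ge> 0 then ennreal (4 / 3 * pi * r ^ 3) else 0)"
    proof (cases "r \<ge> 0")
      case True
      have "(\<integral>\<^sup>+s. ennreal (indicator {0<..} s * (4 * pi * s\<^sup>2)) * indicator {..r} s \<partial>lborel)
         = (\<integral>\<^sup>+s. ennreal (4 * pi * s\<^sup>2) * indicator {0..r} s \<partial>lborel)"
        by (rule nn_integral_cong) (auto split: split_indicator)
      also have "\<dots> = ennreal (4 / 3 * pi * r ^ 3 - 4 / 3 * pi * 0 ^ 3)"
        by (rule nn_integral_FTC_Icc) (use True in \<open>auto intro!: derivative_eq_intros\<close>)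
      finally show ?thesis using True by simp
    next
      case False
      have "(\<integral>\<^sup>+s. ennreal (indicator {0<..} s * (4 * pi * s\<^sup>2)) * indicator {..r} s \<partial>lborel) = (\<integral>\<^sup>+s. 0 \<partial>(lborel :: real measure))"
        by (rule nn_integral_cong) (use False in \<open>auto split: split_indicator\<close>)
      then show ?thesis using False by simp
    qed
    finally show ?thesis using M r by simp
  qed
  show "sets ?M = sigma_sets UNIV (range atMost)" "sets ?N = sigma_sets UNIV (range atMost)"
    by (simp_all add: borel_eq_atMost)
  show "(\<Union>n. {..real n}) = UNIV" by (auto intro: real_arch_simple)
  show "emeasure ?M {..real n} \<noteq> \<infinity>" for n by (simp add: M)
qed auto

lemma integral_radial:
  fixes f :: "real \<Rightarrow> real"
  assumes [measurable]: "f \<in> borel_measurable borel"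
  shows "(\<integral>x. f (norm (x::real^3)) \<partial>lborel) = (\<integral>r. indicator {0<..} r * (4 * pi * r\<^sup>2) * f r \<partial>lborel)"
    and "integrable lborel (\<lambda>x. f (norm (x::real^3))) \<longleftrightarrow> integrable lborel (\<lambda>r. indicator {0<..} r * (4 * pi * r\<^sup>2) * f r)"
proof -
  have "(\<integral>x. f (norm (x::real^3)) \<partial>lborel) = (\<integral>r. f r \<partial>distr lborel borel (norm :: real^3 \<Rightarrow> real))"
    by (subst integral_distr) auto
  then show "(\<integral>x. f (norm (x::real^3)) \<partial>lborel) = (\<integral>r. indicator {0<..} r * (4 * pi * r\<^sup>2) * f r \<partial>lborel)"
    unfolding distr_norm_real3 by (subst (asm) integral_density) auto
  have "integrable lborel (\<lambda>x. f (norm (x::real^3))) \<longleftrightarrow> integrable (distr lborel borel (norm :: real^3 \<Rightarrow> real)) f"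
    by (subst integrable_distr_eq) auto
  then show "integrable lborel (\<lambda>x. f (norm (x::real^3))) \<longleftrightarrow> integrable lborel (\<lambda>r. indicator {0<..} r * (4 * pi * r\<^sup>2) * f r)"
    unfolding distr_norm_real3 by (subst (asm) integrable_density) auto
qed

section \<open>The sine transform and its Gaussian regularisation\<close>

abbreviation L1_norm :: "(real \<Rightarrow> real) \<Rightarrow> real" where
  "L1_norm f \<equiv> \<integral>y. \<bar>f y\<bar> \<partial>lborel"

definition sine_transform :: "(real \<Rightarrow> real) \<Rightarrow> real \<Rightarrow> real" where
  "sine_transform \<phi> k = (\<integral>y. \<phi> y * sin (k * y) \<partial>lborel)"

definition cosine_transform :: "(real \<Rightarrow> real) \<Rightarrow> real \<Rightarrow> real" where
  "cosine_transform \<phi> k = (\<integral>y. \<phi> y * cos (k * y) \<partial>lborel)"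

lemma integrable_bounded_support:
  fixes \<phi> :: "real \<Rightarrow> real"
  assumes "\<phi> \<in> borel_measurable borel" "\<And>y. \<bar>\<phi> y\<bar> \<le> B" "\<And>y. \<bar>y\<bar> > R \<Longrightarrow> \<phi> y = 0"
  shows "integrable lborel \<phi>"
proof (rule Bochner_Integration.integrable_bound)
  show "integrable lborel (\<lambda>y. B * indicator {-R..R} y)"
    by (intro integrable_mult_right integrable_real_indicator) (auto simp: emeasure_lborel_Icc_eq)
  show "AE y in lborel. norm (\<phi> y) \<le> norm (B * indicator {-R..R} y)"
  proof (rule AE_I2)
    fix y
    show "norm (\<phi> y) \<le> norm (B * indicator {-R..R} y)"
    proof (cases "\<bar>y\<bar> > R")
      case True
      then show ?thesis using assms(3) by simp
    next
      case False
      then have "y \<in> {-R..R}" by auto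
      then show ?thesis using assms(2)[of y] by simp
    qed
  qed
qed (use assms(1) in simp)

lemma sine_transform_integrable:
  fixes \<phi> :: "real \<Rightarrow> real"
  assumes "integrable lborel \<phi>"
  shows "integrable lborel (\<lambda>y. \<phi> y * sin (k * y))" "integrable lborel (\<lambda>y. \<phi> y * cos (k * y))"
proof -
  have [measurable]: "\<phi> \<in> borel_measurable borel" using borel_measurable_integrable[OF assms] by simp
  have le: "\<bar>\<phi> y * sin z\<bar> \<le> \<bar>\<phi> y\<bar>" "\<bar>\<phi> y * cos z\<bar> \<le> \<bar>\<phi> y\<bar>" for y z
    using mult_left_mono[OF abs_sin_le_one, of "\<bar>\<phi> y\<bar>" z] mult_left_mono[OF abs_cos_le_one, of "\<bar>\<phi> y\<bar>" z]
    by (auto simp: abs_mult)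
  show "integrable lborel (\<lambda>y. \<phi> y * sin (k * y))"
    by (rule Bochner_Integration.integrable_bound[OF assms]) (use le in auto)
  show "integrable lborel (\<lambda>y. \<phi> y * cos (k * y))"
    by (rule Bochner_Integration.integrable_bound[OF assms]) (use le in auto)
qed

lemma transform_measurable [measurable]:
  assumes [measurable]: "\<phi> \<in> borel_measurable borel"
  shows "sine_transform \<phi> \<in> borel_measurable borel" "cosine_transform \<phi> \<in> borel_measurable borel"
  unfolding sine_transform_def[abs_def] cosine_transform_def[abs_def] by measurable

text \<open>Integrating the series of sin (y k) / k against \<phi> term by term gives the
  coefficients, and |y| \<le> R on the support bounds them by a multiple of R^(2 n + 1) / n!. Hence
  a Gaussian times the sine transform divided by |xi| agrees, away from the origin, with a Gaussian
  test function.\<close>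

lemma sine_transform_egf:
  fixes \<phi> :: "real \<Rightarrow> real"
  assumes \<phi>: "integrable lborel \<phi>" and supp: "\<And>y. \<bar>y\<bar> > R \<Longrightarrow> \<phi> y = 0" and R: "R \<ge> 0"
  defines "c \<equiv> \<lambda>n. \<integral>y. \<phi> y * sinc_seq y n \<partial>lborel"
  shows "slow_seq c" and "egf c (k\<^sup>2) * k = sine_transform \<phi> k"
proof -
  have [measurable]: "\<phi> \<in> borel_measurable borel" using borel_measurable_integrable[OF \<phi>] by simp
  have [measurable]: "(\<lambda>y. sinc_seq y n) \<in> borel_measurable borel" for n
    unfolding sinc_seq_def by measurable
  have le: "\<bar>\<phi> y * sinc_seq y n\<bar> \<le> \<bar>\<phi> y\<bar> * (R * (R\<^sup>2) ^ n / fact n)" for y n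
  proof (cases "\<bar>y\<bar> > R")
    case False
    then have y: "\<bar>y\<bar> \<le> R" by simp
    then have "y\<^sup>2 \<le> R\<^sup>2" using R by (simp add: abs_le_square_iff[symmetric])
    then have p: "(y\<^sup>2) ^ n \<le> (R\<^sup>2) ^ n" by (rule power_mono) simp
    have "\<bar>y\<bar> * (y\<^sup>2) ^ n / fact n \<le> R * (R\<^sup>2) ^ n / fact n"
      by (intro divide_right_mono mult_mono p y R) auto
    with sinc_seq_le[of y n] have "\<bar>sinc_seq y n\<bar> \<le> R * (R\<^sup>2) ^ n / fact n" by linarith
    then show ?thesis by (simp only: abs_mult mult_left_mono abs_ge_zero)
  qed (simp add: supp)
  have int: "integrable lborel (\<lambda>y. \<phi> y * sinc_seq y n)" for n
  proof (rule Bochner_Integration.integrable_bound)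
    show "integrable lborel (\<lambda>y. \<bar>\<phi> y\<bar> * (R * (R\<^sup>2) ^ n / fact n))"
      using \<phi> by simp
    show "AE y in lborel. norm (\<phi> y * sinc_seq y n) \<le> norm (\<bar>\<phi> y\<bar> * (R * (R\<^sup>2) ^ n / fact n))"
      using le R by (auto intro!: AE_I2 order_trans[OF le])
  qed measurable
  show c: "slow_seq c"
  proof (rule slow_seqI_factorial[where Y = "R\<^sup>2" and B = "L1_norm \<phi> * R"])
    fix n
    have "\<bar>c n\<bar> \<le> (\<integral>y. \<bar>\<phi> y * sinc_seq y n\<bar> \<partial>lborel)"
      unfolding c_def using integral_norm_bound[of lborel "\<lambda>y. \<phi> y * sinc_seq y n"] by simp
    also have "\<dots> \<le> (\<integral>y. \<bar>\<phi> y\<bar> * (R * (R\<^sup>2) ^ n / fact n) \<partial>lborel)"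
      by (rule integral_mono) (use le \<phi> int in auto)
    also have "\<dots> = L1_norm \<phi> * R * (R\<^sup>2) ^ n / fact n" by simp
    finally show "\<bar>c n\<bar> \<le> L1_norm \<phi> * R * (R\<^sup>2) ^ n / fact n" .
  qed simp
  let ?s = "\<lambda>N y. \<Sum>n<N. \<phi> y * sinc_seq y n * ((k\<^sup>2) ^ n / fact n * k)"
  have "(\<lambda>N. \<integral>y. ?s N y \<partial>lborel) \<longlonglongrightarrow> (\<integral>y. \<phi> y * sin (k * y) \<partial>lborel)"
  proof (rule integral_dominated_convergence[where w = "\<lambda>y. \<bar>\<phi> y\<bar> * (R * \<bar>k\<bar> * exp (R\<^sup>2 * k\<^sup>2))"])
    show "integrable lborel (\<lambda>y. \<bar>\<phi> y\<bar> * (R * \<bar>k\<bar> * exp (R\<^sup>2 * k\<^sup>2)))" using \<phi> by simp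
    show "AE y in lborel. (\<lambda>N. ?s N y) \<longlonglongrightarrow> \<phi> y * sin (k * y)"
    proof (rule AE_I2)
      fix y
      have "(\<lambda>n. \<phi> y * (sinc_seq y n * (k\<^sup>2) ^ n / fact n * k)) sums (\<phi> y * sin (y * k))"
        by (intro sums_mult sinc_seq_sums)
      then show "(\<lambda>N. ?s N y) \<longlonglongrightarrow> \<phi> y * sin (k * y)"
        by (simp add: sums_def mult_ac)
    qed
    show "AE y in lborel. norm (?s N y) \<le> \<bar>\<phi> y\<bar> * (R * \<bar>k\<bar> * exp (R\<^sup>2 * k\<^sup>2))" for N
    proof (rule AE_I2)
      fix y
      have "norm (?s N y) \<le> (\<Sum>n<N. \<bar>\<phi> y * sinc_seq y n\<bar> * ((k\<^sup>2) ^ n / fact n * \<bar>k\<bar>))"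
        using sum_abs[of "\<lambda>n. \<phi> y * sinc_seq y n * ((k\<^sup>2) ^ n / fact n * k)" "{..<N}"] by (simp add: abs_mult)
      also have "\<dots> \<le> (\<Sum>n<N. \<bar>\<phi> y\<bar> * R * \<bar>k\<bar> * ((R\<^sup>2 * k\<^sup>2) ^ n / fact n))"
      proof (rule sum_mono)
        fix n
        \<comment> \<open>The factorial in \<open>le\<close> already sums the series to exp (R^2
          k^2), so this one may be dropped.\<close>
        have "(k\<^sup>2) ^ n / fact n \<le> (k\<^sup>2) ^ n / 1" by (rule divide_left_mono) (auto simp: fact_ge_1)
        then have "(k\<^sup>2) ^ n / fact n * \<bar>k\<bar> \<le> (k\<^sup>2) ^ n * \<bar>k\<bar>" by (intro mult_right_mono) auto
        with le[of y n] have "\<bar>\<phi> y * sinc_seq y n\<bar> * ((k\<^sup>2) ^ n / fact n * \<bar>k\<bar>)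
           \<le> (\<bar>\<phi> y\<bar> * (R * (R\<^sup>2) ^ n / fact n)) * ((k\<^sup>2) ^ n * \<bar>k\<bar>)"
          by (rule mult_mono) (use R in auto)
        then show "\<bar>\<phi> y * sinc_seq y n\<bar> * ((k\<^sup>2) ^ n / fact n * \<bar>k\<bar>) \<le> \<bar>\<phi> y\<bar> * R * \<bar>k\<bar> * ((R\<^sup>2 * k\<^sup>2) ^ n / fact n)"
          by (simp add: power_mult_distrib mult_ac)
      qed
      also have "\<dots> = \<bar>\<phi> y\<bar> * R * \<bar>k\<bar> * (\<Sum>n<N. (R\<^sup>2 * k\<^sup>2) ^ n / fact n)" by (simp add: sum_distrib_left)
      also have "(\<Sum>n<N. (R\<^sup>2 * k\<^sup>2) ^ n / fact n) \<le> exp (R\<^sup>2 * k\<^sup>2)"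
      proof -
        have "(\<Sum>n<N. (R\<^sup>2 * k\<^sup>2) ^ n / fact n) \<le> (\<Sum>n. (R\<^sup>2 * k\<^sup>2) ^ n / fact n)"
          by (intro sum_le_suminf summable_exp_real) auto
        then show ?thesis by (simp add: exp_def divide_inverse mult.commute)
      qed
      finally show "norm (?s N y) \<le> \<bar>\<phi> y\<bar> * (R * \<bar>k\<bar> * exp (R\<^sup>2 * k\<^sup>2))"
        using R by (simp add: mult_left_mono mult.assoc)
    qed
  qed measurable
  moreover have "(\<integral>y. ?s N y \<partial>lborel) = (\<Sum>n<N. c n * ((k\<^sup>2) ^ n / fact n * k))" for N
    unfolding c_def by (subst Bochner_Integration.integral_sum) (use int in auto)
  ultimately have "(\<lambda>n. c n * ((k\<^sup>2) ^ n / fact n * k)) sums sine_transform \<phi> k"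
    by (simp add: sums_def sine_transform_def)
  moreover have "(\<lambda>n. c n * ((k\<^sup>2) ^ n / fact n * k)) sums (egf c (k\<^sup>2) * k)"
    using sums_mult2[OF egf_sums[OF c, of "k\<^sup>2"], of k] by (simp add: mult.assoc)
  ultimately show "egf c (k\<^sup>2) * k = sine_transform \<phi> k"
    using sums_unique2 by blast
qed

text \<open>Twice the odd part of \<phi> mollified by a normal density of standard deviation
  \<open>h\<close>. The scale \<open>h\<close> is put into the argument of \<phi>, so that h -> 0 is
  a pointwise limit under a fixed probability density.\<close>

definition heat_diff :: "(real \<Rightarrow> real) \<Rightarrow> real \<Rightarrow> real \<Rightarrow> real" where
  "heat_diff \<phi> h r = (\<integral>s. (\<phi> (r - h * s) - \<phi> (- r - h * s)) * std_normal_density s \<partial>lborel)"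

text \<open>A product of sines is half a difference of cosines, and for a = h^2 / 2 the integral in
  \<open>gaussian_cos\<close> is 2 pi times a normal density of standard deviation
  \<open>h\<close>.\<close>

lemma gaussian_sin_sin:
  assumes h: "h > 0"
  shows "(\<integral>k. exp (- (h\<^sup>2 / 2) * k\<^sup>2) * (sin (k * y) * sin (r * k)) \<partial>lborel)
    = pi * (normal_density 0 h (r - y) - normal_density 0 h (- r - y))"
proof -
  have a: "h\<^sup>2 / 2 > 0" using h by simp
  have eq: "exp (- (h\<^sup>2 / 2) * k\<^sup>2) * (sin (k * y) * sin (r * k))
     = 1/2 * (exp (- (h\<^sup>2 / 2) * k\<^sup>2) * cos ((r - y) * k) - exp (- (h\<^sup>2 / 2) * k\<^sup>2) * cos ((- r - y) * k))" for k
  proof -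
    have "cos ((- r - y) * k) = cos (r * k + k * y)"
      by (subst cos_minus[symmetric]) (simp add: algebra_simps)
    moreover have "cos ((r - y) * k) = cos (r * k - k * y)" by (simp add: algebra_simps)
    ultimately show ?thesis by (simp add: cos_add cos_diff algebra_simps)
  qed
  have s: "sqrt (pi / (h\<^sup>2 / 2)) * exp (- x\<^sup>2 / (4 * (h\<^sup>2 / 2))) = 2 * pi * normal_density 0 h x" for x
  proof -
    have "sqrt (pi / (h\<^sup>2 / 2)) = sqrt (2 * pi) / h"
      using h by (simp add: real_sqrt_divide real_sqrt_mult mult.commute)
    also have "\<dots> = (2 * pi) / (sqrt (2 * pi) * h)"
      using h real_div_sqrt[of "2 * pi"] by (simp add: field_simps)
    also have "\<dots> = 2 * pi * (1 / sqrt (2 * pi * h\<^sup>2))"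
      using h by (simp add: real_sqrt_mult)
    finally show ?thesis by (simp add: normal_density_def)
  qed
  show ?thesis
    unfolding eq integral_mult_right_zero
      Bochner_Integration.integral_diff[OF gaussian_cos(1)[OF a] gaussian_cos(1)[OF a]]
      gaussian_cos(2)[OF a] s by (simp add: algebra_simps)
qed

lemma heat_diff_eq:
  assumes \<phi>: "integrable lborel \<phi>" and h: "h > 0"
  shows "heat_diff \<phi> h r = (\<integral>y. \<phi> y * (normal_density 0 h (r - y) - normal_density 0 h (- r - y)) \<partial>lborel)"
    and "integrable lborel (\<lambda>s. \<phi> (r - h * s) * std_normal_density s)"
proof -
  have [measurable]: "\<phi> \<in> borel_measurable borel" using borel_measurable_integrable[OF \<phi>] by simp
  have bd: "\<bar>normal_density 0 h x\<bar> \<le> 1 / sqrt (2 * pi * h\<^sup>2)" for x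
    by (simp add: normal_density_def divide_right_mono)
  have i: "integrable lborel (\<lambda>y. \<phi> y * normal_density 0 h (r - y))" for r
  proof (rule Bochner_Integration.integrable_bound)
    show "integrable lborel (\<lambda>y. \<phi> y * (1 / sqrt (2 * pi * h\<^sup>2)))" using \<phi> by simp
    show "AE y in lborel. norm (\<phi> y * normal_density 0 h (r - y)) \<le> norm (\<phi> y * (1 / sqrt (2 * pi * h\<^sup>2)))"
      using mult_left_mono[OF bd] by (auto simp: abs_mult intro!: AE_I2)
  qed measurable
  have e: "\<phi> (r + - h * s) * normal_density 0 h (r - (r + - h * s)) = (1 / h) * (\<phi> (r - h * s) * std_normal_density s)" for r s
    using h by (simp add: normal_density_def real_sqrt_mult power_mult_distrib)
  have i2: "integrable lborel (\<lambda>s. \<phi> (r - h * s) * std_normal_density s)" for r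
  proof -
    have "integrable lborel (\<lambda>s. h * ((1 / h) * (\<phi> (r - h * s) * std_normal_density s)))"
      by (rule integrable_mult_right) (use lborel_integrable_real_affine[OF i[of r], of "- h" r] h e in simp)
    then show ?thesis using h by simp
  qed
  then show "integrable lborel (\<lambda>s. \<phi> (r - h * s) * std_normal_density s)" .
  have E: "(\<integral>y. \<phi> y * normal_density 0 h (r - y) \<partial>lborel) = (\<integral>s. \<phi> (r - h * s) * std_normal_density s \<partial>lborel)" for r
    using lborel_integral_real_affine[of "- h" "\<lambda>y. \<phi> y * normal_density 0 h (r - y)" r] h unfolding e by simp
  have "heat_diff \<phi> h r = (\<integral>s. \<phi> (r - h * s) * std_normal_density s \<partial>lborel) - (\<integral>s. \<phi> (- r - h * s) * std_normal_density s \<partial>lborel)"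
    unfolding heat_diff_def left_diff_distrib by (rule Bochner_Integration.integral_diff[OF i2 i2])
  also have "\<dots> = (\<integral>y. \<phi> y * (normal_density 0 h (r - y) - normal_density 0 h (- r - y)) \<partial>lborel)"
    unfolding E[symmetric] right_diff_distrib by (rule Bochner_Integration.integral_diff[OF i i, symmetric])
  finally show "heat_diff \<phi> h r = (\<integral>y. \<phi> y * (normal_density 0 h (r - y) - normal_density 0 h (- r - y)) \<partial>lborel)" .
qed

text \<open>Fubini and \<open>gaussian_sin_sin\<close>: damping the sine transform by a Gaussian
  before inverting it amounts to mollifying \<phi>.\<close>

lemma gaussian_sine_transform:
  assumes \<phi>: "integrable lborel \<phi>" and h: "h > 0"
  shows "(\<integral>k. exp (- (h\<^sup>2 / 2) * k\<^sup>2) * (sine_transform \<phi> k * sin (r * k)) \<partial>lborel) = pi * heat_diff \<phi> h r"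
proof -
  have [measurable]: "\<phi> \<in> borel_measurable borel" using borel_measurable_integrable[OF \<phi>] by simp
  have a: "h\<^sup>2 / 2 > 0" using h by simp
  let ?E = "\<lambda>k. exp (- (h\<^sup>2 / 2) * k\<^sup>2)"
  let ?f = "\<lambda>y k. \<phi> y * (?E k * (sin (k * y) * sin (r * k)))"
  have le: "\<bar>sin (k * y) * sin (r * k)\<bar> \<le> 1" for k y :: real
    by (simp add: abs_mult mult_le_one)
  have le2: "\<bar>?E k * (sin (k * y) * sin (r * k))\<bar> \<le> ?E k" for k y
    using mult_left_mono[OF le, of "?E k"] by (simp add: abs_mult)
  have i1: "integrable lborel (\<lambda>k. ?f y k)" for y
    by (rule integrable_mult_right, rule Bochner_Integration.integrable_bound[OF gaussian_real_integrable[OF a]])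
      (use le2 in auto)
  have "integrable (lborel \<Otimes>\<^sub>M lborel) (case_prod ?f)"
  proof (rule lborel_pair.Fubini_integrable)
    show "case_prod ?f \<in> borel_measurable (lborel \<Otimes>\<^sub>M lborel)" by measurable
    show "AE y in lborel. integrable lborel (\<lambda>k. case_prod ?f (y, k))" using i1 by simp
    show "integrable lborel (\<lambda>y. \<integral>k. norm (case_prod ?f (y, k)) \<partial>lborel)"
    proof (rule Bochner_Integration.integrable_bound)
      show "integrable lborel (\<lambda>y. \<phi> y * (\<integral>k. ?E k \<partial>lborel))" using \<phi> by simp
      show "AE y in lborel. norm (\<integral>k. norm (case_prod ?f (y, k)) \<partial>lborel) \<le> norm (\<phi> y * (\<integral>k. ?E k \<partial>lborel))"
      proof (rule AE_I2)
        fix y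
        have "(\<integral>k. norm (case_prod ?f (y, k)) \<partial>lborel) \<le> (\<integral>k. \<bar>\<phi> y\<bar> * ?E k \<partial>lborel)"
        proof (rule integral_mono)
          show "integrable lborel (\<lambda>k. norm (case_prod ?f (y, k)))" using i1[of y] by (simp only: prod.case integrable_norm)
          show "integrable lborel (\<lambda>k. \<bar>\<phi> y\<bar> * ?E k)" by (intro integrable_mult_right gaussian_real_integrable[OF a])
          show "norm (case_prod ?f (y, k)) \<le> \<bar>\<phi> y\<bar> * ?E k" for k
            using mult_left_mono[OF le2[of k y], of "\<bar>\<phi> y\<bar>"] by (simp add: abs_mult)
        qed
        moreover have "0 \<le> (\<integral>k. ?E k \<partial>lborel)" by simp
        ultimately show "norm (\<integral>k. norm (case_prod ?f (y, k)) \<partial>lborel) \<le> norm (\<phi> y * (\<integral>k. ?E k \<partial>lborel))"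
          by (simp add: abs_mult)
      qed
    qed measurable
  qed
  from lborel_pair.Fubini_integral[OF this]
  have "(\<integral>k. (\<integral>y. ?f y k \<partial>lborel) \<partial>lborel) = (\<integral>y. (\<integral>k. ?f y k \<partial>lborel) \<partial>lborel)" .
  moreover have "(\<integral>y. ?f y k \<partial>lborel) = ?E k * (sine_transform \<phi> k * sin (r * k))" for k
  proof -
    have "?f y k = (?E k * sin (r * k)) * (\<phi> y * sin (k * y))" for y by simp
    then have "(\<integral>y. ?f y k \<partial>lborel) = (?E k * sin (r * k)) * (\<integral>y. \<phi> y * sin (k * y) \<partial>lborel)"
      by (simp only: integral_mult_right_zero)
    then show ?thesis by (simp add: sine_transform_def)
  qed
  moreover have "(\<integral>k. ?f y k \<partial>lborel) = pi * (\<phi> y * (normal_density 0 h (r - y) - normal_density 0 h (- r - y)))" for y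
    unfolding integral_mult_right_zero gaussian_sin_sin[OF h] by simp
  ultimately show ?thesis
    by (simp only: integral_mult_right_zero heat_diff_eq(1)[OF \<phi> h])
qed

lemma heat_diff_tendsto:
  assumes cont: "continuous_on UNIV \<phi>" and bd: "\<And>y. \<bar>\<phi> y\<bar> \<le> B" and h: "h \<longlonglongrightarrow> 0"
  shows "(\<lambda>n. heat_diff \<phi> (h n) r) \<longlonglongrightarrow> \<phi> r - \<phi> (- r)"
proof -
  have [measurable]: "\<phi> \<in> borel_measurable borel" by (rule borel_measurable_continuous_onI[OF cont])
  have "(\<lambda>n. heat_diff \<phi> (h n) r) \<longlonglongrightarrow> (\<integral>s. (\<phi> r - \<phi> (- r)) * std_normal_density s \<partial>lborel)"
    unfolding heat_diff_def
  proof (rule integral_dominated_convergence[where w = "\<lambda>s. (2 * B) * std_normal_density s"])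
    show "AE s in lborel. (\<lambda>n. (\<phi> (r - h n * s) - \<phi> (- r - h n * s)) * std_normal_density s)
        \<longlonglongrightarrow> (\<phi> r - \<phi> (- r)) * std_normal_density s"
    proof (rule AE_I2)
      fix s
      have "(\<lambda>n. \<phi> (x - h n * s)) \<longlonglongrightarrow> \<phi> x" for x
      proof (rule continuous_on_tendsto_compose[OF cont])
        have "(\<lambda>n. x - h n * s) \<longlonglongrightarrow> x - 0 * s" by (intro tendsto_intros h)
        then show "(\<lambda>n. x - h n * s) \<longlonglongrightarrow> x" by simp
      qed auto
      then show "(\<lambda>n. (\<phi> (r - h n * s) - \<phi> (- r - h n * s)) * std_normal_density s)
        \<longlonglongrightarrow> (\<phi> r - \<phi> (- r)) * std_normal_density s"
        by (intro tendsto_intros)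
    qed
    show "AE s in lborel. norm ((\<phi> (r - h n * s) - \<phi> (- r - h n * s)) * std_normal_density s)
        \<le> (2 * B) * std_normal_density s" for n
    proof (rule AE_I2)
      fix s
      have "\<bar>\<phi> (r - h n * s) - \<phi> (- r - h n * s)\<bar> \<le> 2 * B"
        using bd[of "r - h n * s"] bd[of "- r - h n * s"] by linarith
      then show "norm ((\<phi> (r - h n * s) - \<phi> (- r - h n * s)) * std_normal_density s) \<le> (2 * B) * std_normal_density s"
        by (simp add: abs_mult mult_right_mono)
    qed
  qed auto
  then show ?thesis by simp
qed

text \<open>A dominating function uniform in h \<le> 1, of the Gaussian kind that a tempered
  function can be integrated against. For r \<le> 1 the division by r is paid for by the Lipschitz
  bound, the two arguments of \<phi> being 2 r apart; for r > 1 the bounded support gives the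
  decay.\<close>

lemma heat_diff_bound:
  assumes [measurable]: "\<phi> \<in> borel_measurable borel" and bd: "\<And>y. \<bar>\<phi> y\<bar> \<le> B" and supp: "\<And>y. \<bar>y\<bar> > R \<Longrightarrow> \<phi> y = 0"
    and lip: "\<And>x y. \<bar>\<phi> x - \<phi> y\<bar> \<le> L * \<bar>x - y\<bar>" and R: "R \<ge> 0"
  shows "\<exists>C\<ge>0. \<forall>h r. 0 < h \<longrightarrow> h \<le> 1 \<longrightarrow> r > 0 \<longrightarrow> \<bar>heat_diff \<phi> h r\<bar> / r \<le> C * exp (- (1/8) * r\<^sup>2)"
proof -
  have L: "L \<ge> 0" using lip[of 1 0] by simp
  have B: "B \<ge> 0" using bd[of 0] by simp
  have \<phi>: "integrable lborel \<phi>" by (rule integrable_bounded_support[of _ B R]) (use assms in auto)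
  define K where "K = (\<integral>s. std_normal_density s * exp (s\<^sup>2 / 4) \<partial>lborel)"
  have nd: "std_normal_density s * exp (s\<^sup>2 / 4) = (1 / sqrt (2 * pi)) * exp (- (1/4) * s\<^sup>2)" for s
    unfolding std_normal_density_def by (simp flip: exp_add)
  have iK: "integrable lborel (\<lambda>s. std_normal_density s * exp (s\<^sup>2 / 4))"
    unfolding nd by (intro integrable_mult_right gaussian_real_integrable) simp
  have K: "K \<ge> 0" unfolding K_def by simp
  have g: "\<bar>\<phi> x\<bar> \<le> (B * exp (R\<^sup>2 / 4)) * exp (- x\<^sup>2 / 4)" for x
  proof (cases "\<bar>x\<bar> > R")
    case False
    then have "x\<^sup>2 \<le> R\<^sup>2" using R by (simp add: abs_le_square_iff[symmetric])
    then have "1 \<le> exp (R\<^sup>2 / 4 + - x\<^sup>2 / 4)" by simp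
    then have "B * 1 \<le> B * (exp (R\<^sup>2 / 4) * exp (- x\<^sup>2 / 4))"
      unfolding exp_add using B by (intro mult_left_mono) auto
    with bd[of x] show ?thesis by simp
  qed (use supp B in simp)
  define B' where "B' = B * exp (R\<^sup>2 / 4)"
  have B': "B' \<ge> 0" using B by (simp add: B'_def)
  \<comment> \<open>From x^2 / 2 - (h s)^2 \<le> (x - h s)^2 the rate 1/4 in x - h s drops to 1/8 in
    x at the price of exp (s^2 / 4), which the normal density absorbs in \<open>K\<close>.\<close>
  have d: "\<bar>\<phi> (x - h * s)\<bar> \<le> B' * exp (- (1/8) * x\<^sup>2) * exp (s\<^sup>2 / 4)" if "0 < h" "h \<le> 1" for x h s
  proof -
    have "(h * s)\<^sup>2 \<le> s\<^sup>2" using that by (simp add: power_mult_distrib power_le_one mult_left_le_one_le)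
    moreover have "0 \<le> (x - 2 * (h * s))\<^sup>2" by simp
    then have "x\<^sup>2 / 2 - (h * s)\<^sup>2 \<le> (x - h * s)\<^sup>2" by (simp add: power2_eq_square algebra_simps)
    ultimately have "- (x - h * s)\<^sup>2 / 4 \<le> - (1/8) * x\<^sup>2 + s\<^sup>2 / 4" by simp
    then have "B' * exp (- (x - h * s)\<^sup>2 / 4) \<le> B' * exp (- (1/8) * x\<^sup>2 + s\<^sup>2 / 4)"
      using B' by (intro mult_left_mono) auto
    with g[of "x - h * s"] show ?thesis unfolding exp_add B'_def by simp
  qed
  have b1: "\<bar>heat_diff \<phi> h r\<bar> \<le> 2 * B' * K * exp (- (1/8) * r\<^sup>2)" if h: "0 < h" "h \<le> 1" for h r
  proof -
    have "\<bar>heat_diff \<phi> h r\<bar> \<le> (\<integral>s. \<bar>(\<phi> (r - h * s) - \<phi> (- r - h * s)) * std_normal_density s\<bar> \<partial>lborel)"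
      unfolding heat_diff_def by (rule integral_abs_bound)
    also have "\<dots> \<le> (\<integral>s. (2 * B' * exp (- (1/8) * r\<^sup>2)) * (std_normal_density s * exp (s\<^sup>2 / 4)) \<partial>lborel)"
    proof (rule integral_mono)
      show "integrable lborel (\<lambda>s. \<bar>(\<phi> (r - h * s) - \<phi> (- r - h * s)) * std_normal_density s\<bar>)"
        unfolding left_diff_distrib
        by (intro integrable_abs Bochner_Integration.integrable_diff heat_diff_eq(2)[OF \<phi> h(1)])
      show "integrable lborel (\<lambda>s. (2 * B' * exp (- (1/8) * r\<^sup>2)) * (std_normal_density s * exp (s\<^sup>2 / 4)))"
        by (intro integrable_mult_right iK)
      fix s
      have "\<bar>\<phi> (r - h * s) - \<phi> (- r - h * s)\<bar> \<le> (2 * B' * exp (- (1/8) * r\<^sup>2)) * exp (s\<^sup>2 / 4)"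
        using d[OF h, of r s] d[OF h, of "- r" s] unfolding power2_minus by linarith
      from mult_right_mono[OF this normal_density_nonneg[of 0 1 s]]
      show "\<bar>(\<phi> (r - h * s) - \<phi> (- r - h * s)) * std_normal_density s\<bar>
          \<le> (2 * B' * exp (- (1/8) * r\<^sup>2)) * (std_normal_density s * exp (s\<^sup>2 / 4))"
        by (simp add: abs_mult mult_ac)
    qed
    also have "\<dots> = 2 * B' * K * exp (- (1/8) * r\<^sup>2)"
      unfolding integral_mult_right_zero K_def by simp
    finally show ?thesis .
  qed
  have b2: "\<bar>heat_diff \<phi> h r\<bar> \<le> 2 * L * r" if h: "0 < h" and r: "r > 0" for h r
  proof -
    have "\<bar>heat_diff \<phi> h r\<bar> \<le> (\<integral>s. \<bar>(\<phi> (r - h * s) - \<phi> (- r - h * s)) * std_normal_density s\<bar> \<partial>lborel)"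
      unfolding heat_diff_def by (rule integral_abs_bound)
    also have "\<dots> \<le> (\<integral>s. (2 * L * r) * std_normal_density s \<partial>lborel)"
    proof (rule integral_mono)
      show "integrable lborel (\<lambda>s. \<bar>(\<phi> (r - h * s) - \<phi> (- r - h * s)) * std_normal_density s\<bar>)"
        unfolding left_diff_distrib
        by (intro integrable_abs Bochner_Integration.integrable_diff heat_diff_eq(2)[OF \<phi> h(1)])
      show "integrable lborel (\<lambda>s. (2 * L * r) * std_normal_density s)" by simp
      fix s
      have "\<bar>\<phi> (r - h * s) - \<phi> (- r - h * s)\<bar> \<le> 2 * L * r"
        using lip[of "r - h * s" "- r - h * s"] r by simp
      from mult_right_mono[OF this normal_density_nonneg[of 0 1 s]]
      show "\<bar>(\<phi> (r - h * s) - \<phi> (- r - h * s)) * std_normal_density s\<bar> \<le> (2 * L * r) * std_normal_density s"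
        by (simp add: abs_mult)
    qed
    also have "\<dots> = 2 * L * r" by simp
    finally show ?thesis .
  qed
  show ?thesis
  \<comment> \<open>The sum of the constants of the two regimes; exp (1/8) exp (- r^2 / 8) is at
    least 1 up to r = 1.\<close>
  proof (intro exI[of _ "2 * B' * K + 2 * L * exp (1/8)"] conjI allI impI)
    show "0 \<le> 2 * B' * K + 2 * L * exp (1/8)" using B' K L by simp
    fix h r :: real assume h: "0 < h" "h \<le> 1" and r: "r > 0"
    show "\<bar>heat_diff \<phi> h r\<bar> / r \<le> (2 * B' * K + 2 * L * exp (1/8)) * exp (- (1/8) * r\<^sup>2)"
    proof (cases "r \<le> 1")
      case True
      then have "r\<^sup>2 \<le> 1" using r by (simp add: power_le_one)
      then have "1 \<le> exp (1/8 + - (1/8) * r\<^sup>2)" by simp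
      then have "2 * L * 1 \<le> 2 * L * (exp (1/8) * exp (- (1/8) * r\<^sup>2))"
        unfolding exp_add using L by (intro mult_left_mono) auto
      moreover have "\<bar>heat_diff \<phi> h r\<bar> / r \<le> 2 * L" using b2[OF h(1) r] r by (simp add: field_simps)
      moreover have "0 \<le> 2 * B' * K * exp (- (1/8) * r\<^sup>2)" using B' K by simp
      ultimately show ?thesis by (simp add: distrib_right)
    next
      case False
      then have "\<bar>heat_diff \<phi> h r\<bar> / r \<le> \<bar>heat_diff \<phi> h r\<bar> / 1" using r by (intro divide_left_mono) auto
      moreover have "0 \<le> 2 * L * exp (1/8) * exp (- (1/8) * r\<^sup>2)" using L by simp
      ultimately show ?thesis using b1[OF h, of r] by (simp add: distrib_right)
    qed
  qed
qed

section \<open>Tempered functions paired with Gaussian tests\<close>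

definition gaussian_test :: "real \<Rightarrow> (nat \<Rightarrow> real) \<Rightarrow> 'a::euclidean_space \<Rightarrow> complex" where
  "gaussian_test a c \<xi> = complex_of_real (exp (- a * (norm \<xi>)\<^sup>2) * egf c ((norm \<xi>)\<^sup>2))"

lemma schwartz_gaussian_test:
  "a > 0 \<Longrightarrow> slow_seq c \<Longrightarrow> schwartz (gaussian_test a c :: 'a::euclidean_space \<Rightarrow> complex)"
  unfolding gaussian_test_def[abs_def] by (rule gaussian_class_schwartz[OF gaussian_class.base])

lemma gaussian_weight_measurable:
  fixes g :: "'a::euclidean_space \<Rightarrow> complex"
  assumes "integrable lborel (\<lambda>x. g x * of_real (exp (- 1 * (norm x)\<^sup>2)))"
  shows "g \<in> borel_measurable borel"
proof -
  have [measurable]: "(\<lambda>x. g x * of_real (exp (- 1 * (norm x)\<^sup>2))) \<in> borel_measurable borel"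
    using borel_measurable_integrable[OF assms] by simp
  have "(\<lambda>x. (g x * of_real (exp (- 1 * (norm x)\<^sup>2))) * complex_of_real (exp ((norm x)\<^sup>2))) \<in> borel_measurable borel"
    by measurable
  moreover have "(g x * of_real (exp (- 1 * (norm x)\<^sup>2))) * complex_of_real (exp ((norm x)\<^sup>2)) = g x" for x
    unfolding mult.assoc of_real_mult[symmetric] exp_add[symmetric] by simp
  ultimately show ?thesis by (simp only:)
qed

lemma tempered_gaussian:
  fixes g :: "'a::euclidean_space \<Rightarrow> complex"
  assumes "tempered g"
  shows "a > 0 \<Longrightarrow> integrable lborel (\<lambda>x. g x * of_real (exp (- a * (norm x)\<^sup>2)))"
    and "g \<in> borel_measurable borel"
proof -
  show i: "integrable lborel (\<lambda>x. g x * of_real (exp (- a * (norm x)\<^sup>2)))" if "a > 0" for a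
  proof -
    have "integrable lborel (\<lambda>x. g x * gaussian_test a (\<lambda>k. if k = 0 then 1 else 0) x)"
      using assms schwartz_gaussian_test[OF that egf_const(1)] unfolding tempered_def by blast
    then show ?thesis by (simp add: gaussian_test_def egf_const(2))
  qed
  show "g \<in> borel_measurable borel" by (rule gaussian_weight_measurable[OF i[OF zero_less_one]])
qed

text \<open>The Fourier relation restricted to Gaussian tests. These are stable under multiplication
  by cos (t |xi|) and, up to a null set, by sin (t |xi|) / |xi|, which lets the relation follow the
  wave in time.\<close>

definition gaussian_pair :: "('a::euclidean_space \<Rightarrow> real) \<Rightarrow> ('a \<Rightarrow> complex) \<Rightarrow> bool" where
  "gaussian_pair w g \<longleftrightarrow> (\<forall>a c. a > 0 \<longrightarrow> slow_seq c \<longrightarrow>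
     integrable lborel (\<lambda>\<xi>. g \<xi> * gaussian_test a c \<xi>) \<and>
     (\<integral>x. complex_of_real (w x) * fourier (gaussian_test a c) x \<partial>lborel) = (\<integral>\<xi>. g \<xi> * gaussian_test a c \<xi> \<partial>lborel))"

lemma has_fourier_gaussian_pair:
  "has_fourier (\<lambda>x. complex_of_real (w x)) g \<Longrightarrow> gaussian_pair w g"
  unfolding has_fourier_def gaussian_pair_def tempered_def using schwartz_gaussian_test by blast

text \<open>The factors \<open>cos (t |\<xi>|)\<close> and \<open>sin (t |\<xi>|) / |\<xi>|\<close> are absorbed into the test function, so that
  each Fourier transform of the data may be replaced by any other one.\<close>

lemma gaussian_pair_wave:
  fixes w w0 w1 :: "'a::euclidean_space \<Rightarrow> real"
  assumes w: "gaussian_pair w (\<lambda>\<xi>. of_real (cos (t * norm \<xi>)) * G0 \<xi> + of_real (sin (t * norm \<xi>) / norm \<xi>) * G1 \<xi>)"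
    and G: "gaussian_pair w0 G0" "gaussian_pair w1 G1"
    and g: "gaussian_pair w0 g0" "gaussian_pair w1 g1"
  shows "gaussian_pair w (\<lambda>\<xi>. of_real (cos (t * norm \<xi>)) * g0 \<xi> + of_real (sin (t * norm \<xi>) / norm \<xi>) * g1 \<xi>)"
  unfolding gaussian_pair_def
proof (intro allI impI)
  fix a :: real and c assume a: "a > 0" and c: "slow_seq c"
  let ?W = "\<lambda>h0 h1 \<xi>::'a. of_real (cos (t * norm \<xi>)) * h0 \<xi> + of_real (sin (t * norm \<xi>) / norm \<xi>) * h1 \<xi> :: complex"
  let ?c0 = "\<lambda>k. \<Sum>i\<le>k. (k choose i) * cos_seq t i * c (k - i)"
  let ?c1 = "\<lambda>k. \<Sum>i\<le>k. (k choose i) * sinc_seq t i * c (k - i)"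
  let ?F1 = "\<integral>x. complex_of_real (w1 x) * fourier (gaussian_test a ?c1) x \<partial>lborel"
  let ?F0 = "\<integral>x. complex_of_real (w0 x) * fourier (gaussian_test a ?c0) x \<partial>lborel"
  have c0: "slow_seq ?c0" and c1: "slow_seq ?c1"
    using egf_binomial_mult(1) c cos_seq(1) sinc_seq(1) by blast+
  have e0: "of_real (cos (t * norm \<xi>)) * gaussian_test a c \<xi> = gaussian_test a ?c0 \<xi>" for \<xi> :: 'a
    unfolding gaussian_test_def egf_binomial_mult(2)[OF cos_seq(1) c] cos_seq(2)
    by (simp add: mult_ac)
  have e1: "of_real (sin (t * norm \<xi>) / norm \<xi>) * gaussian_test a c \<xi> = gaussian_test a ?c1 \<xi>"
    if "\<xi> \<noteq> 0" for \<xi> :: 'a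
    using that unfolding gaussian_test_def egf_binomial_mult(2)[OF sinc_seq(1) c]
    by (simp add: sinc_seq(2) mult_ac)
  have AE0: "AE \<xi> in lborel. (\<xi>::'a) \<noteq> 0" by (rule AE_lborel_singleton)
  \<comment> \<open>The right-hand side depends on \<open>w0\<close> and \<open>w1\<close> alone, so
    any two choices of Fourier transforms of the data yield the same pairing.\<close>
  have main: "integrable lborel (\<lambda>\<xi>. ?W h0 h1 \<xi> * gaussian_test a c \<xi>)
     \<and> (\<integral>\<xi>. ?W h0 h1 \<xi> * gaussian_test a c \<xi> \<partial>lborel)
       = ?F0
       + ?F1"
    if h0: "gaussian_pair w0 h0" and h1: "gaussian_pair w1 h1"
      and m: "(\<lambda>\<xi>. ?W h0 h1 \<xi> * gaussian_test a c \<xi>) \<in> borel_measurable lborel"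
    for h0 h1
  proof -
    have ae: "AE \<xi> in lborel. h0 \<xi> * gaussian_test a ?c0 \<xi> + h1 \<xi> * gaussian_test a ?c1 \<xi>
      = ?W h0 h1 \<xi> * gaussian_test a c \<xi>"
      using AE0
    proof eventually_elim
      case (elim \<xi>)
      show ?case unfolding e0[symmetric] e1[OF elim, symmetric] by (simp only: distrib_right distrib_left mult_ac)
    qed
    have i0: "integrable lborel (\<lambda>\<xi>. h0 \<xi> * gaussian_test a ?c0 \<xi>)"
      and i1: "integrable lborel (\<lambda>\<xi>. h1 \<xi> * gaussian_test a ?c1 \<xi>)"
      using h0 h1 a c0 c1 unfolding gaussian_pair_def by blast+
    have i: "integrable lborel (\<lambda>\<xi>. h0 \<xi> * gaussian_test a ?c0 \<xi> + h1 \<xi> * gaussian_test a ?c1 \<xi>)"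
      by (rule Bochner_Integration.integrable_add[OF i0 i1])
    have "integrable lborel (\<lambda>\<xi>. ?W h0 h1 \<xi> * gaussian_test a c \<xi>)"
      by (rule integrable_cong_AE_imp[OF i m ae])
    moreover have "(\<integral>\<xi>. ?W h0 h1 \<xi> * gaussian_test a c \<xi> \<partial>lborel)
      = (\<integral>\<xi>. h0 \<xi> * gaussian_test a ?c0 \<xi> + h1 \<xi> * gaussian_test a ?c1 \<xi> \<partial>lborel)"
      by (rule integral_cong_AE[OF m borel_measurable_integrable[OF i]]) (use ae in auto)
    moreover have "\<dots> = (\<integral>\<xi>. h0 \<xi> * gaussian_test a ?c0 \<xi> \<partial>lborel) + (\<integral>\<xi>. h1 \<xi> * gaussian_test a ?c1 \<xi> \<partial>lborel)"
      by (rule Bochner_Integration.integral_add[OF i0 i1])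
    moreover have "(\<integral>\<xi>. h0 \<xi> * gaussian_test a ?c0 \<xi> \<partial>lborel) = ?F0"
       "(\<integral>\<xi>. h1 \<xi> * gaussian_test a ?c1 \<xi> \<partial>lborel) = ?F1"
      using h0 h1 a c0 c1 unfolding gaussian_pair_def by simp_all
    ultimately show ?thesis by (simp only:)
  qed
  have gm: "h \<in> borel_measurable borel" if "gaussian_pair v h" for v :: "'a \<Rightarrow> real" and h
  proof -
    have "integrable lborel (\<lambda>x. h x * gaussian_test 1 (\<lambda>k. if k = 0 then 1 else 0) x)"
      using that egf_const(1) unfolding gaussian_pair_def by simp
    then show ?thesis by (intro gaussian_weight_measurable) (simp add: gaussian_test_def egf_const(2))
  qed
  have gt [measurable]: "(gaussian_test a c :: 'a \<Rightarrow> complex) \<in> borel_measurable borel"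
  proof -
    note [measurable] = egf_measurable[OF c]
    show ?thesis unfolding gaussian_test_def[abs_def] by measurable
  qed
  have m: "(\<lambda>\<xi>. ?W h0 h1 \<xi> * gaussian_test a c \<xi>) \<in> borel_measurable lborel"
    if "gaussian_pair w0 h0" "gaussian_pair w1 h1" for h0 h1
  proof -
    note [measurable] = gm[OF that(1)] gm[OF that(2)]
    show ?thesis by measurable
  qed
  have "(\<integral>x. complex_of_real (w x) * fourier (gaussian_test a c) x \<partial>lborel)
     = (\<integral>\<xi>. ?W G0 G1 \<xi> * gaussian_test a c \<xi> \<partial>lborel)"
    using w a c unfolding gaussian_pair_def by blast
  with main[OF G m[OF G]] main[OF g m[OF g]]
  show "integrable lborel (\<lambda>\<xi>. ?W g0 g1 \<xi> * gaussian_test a c \<xi>) \<and>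
     (\<integral>x. complex_of_real (w x) * fourier (gaussian_test a c) x \<partial>lborel)
     = (\<integral>\<xi>. ?W g0 g1 \<xi> * gaussian_test a c \<xi> \<partial>lborel)"
    by simp
qed

section \<open>Radial functions tested on the half-line\<close>

lemma radial_eq_profile: "radial w \<Longrightarrow> w x = radial_profile w (norm x)"
  unfolding radial_def radial_profile_def by (auto simp: norm_axis_1)

lemma radial_profile_measurable [measurable]:
  assumes [measurable]: "w \<in> borel_measurable borel"
  shows "radial_profile w \<in> borel_measurable borel"
  unfolding radial_profile_def[abs_def]
  by (rule measurable_compose[OF _ assms]) simp

lemma tempered_real:
  assumes "tempered (\<lambda>x::'a::euclidean_space. complex_of_real (w x))"
  shows "a > 0 \<Longrightarrow> integrable lborel (\<lambda>x. w x * exp (- a * (norm x)\<^sup>2))" "w \<in> borel_measurable borel"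
proof -
  show "integrable lborel (\<lambda>x. w x * exp (- a * (norm x)\<^sup>2))" if "a > 0"
    using integrable_Re[OF tempered_gaussian(1)[OF assms that]] by simp
  note [measurable] = tempered_gaussian(2)[OF assms]
  have "(\<lambda>x. Re (complex_of_real (w x))) \<in> borel_measurable borel" by measurable
  then show "w \<in> borel_measurable borel" by simp
qed

text \<open>Testing with a Gaussian in polar coordinates controls r^2 times the profile; on a
  compact subset of r > 0 both r and the Gaussian are bounded below.\<close>

lemma radial_profile_locally_integrable:
  fixes w :: "real^3 \<Rightarrow> real"
  assumes rad: "radial w" and temp: "tempered (\<lambda>x. complex_of_real (w x))"
  shows "locally_integrable_on (\<lambda>r. r * radial_profile w r) {0<..}"
  unfolding locally_integrable_on_def
proof (intro allI impI)
  fix K :: "real set" assume K: "compact K" "K \<subseteq> {0<..}"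
  note [measurable] = tempered_real(2)[OF temp]
  show "set_integrable lborel K (\<lambda>r. r * radial_profile w r)"
  proof (cases "K = {}")
    case False
    obtain \<alpha> where \<alpha>: "\<alpha> \<in> K" "\<And>x. x \<in> K \<Longrightarrow> \<alpha> \<le> x" using compact_attains_inf[OF K(1) False] by blast
    obtain \<beta> where \<beta>: "\<beta> \<in> K" "\<And>x. x \<in> K \<Longrightarrow> x \<le> \<beta>" using compact_attains_sup[OF K(1) False] by blast
    have \<alpha>0: "\<alpha> > 0" using \<alpha>(1) K(2) by auto
    let ?u = "\<lambda>r. indicat_real K r *\<^sub>R (r * radial_profile w r)"
    let ?F = "\<lambda>r. (exp (\<beta>\<^sup>2) / (4 * pi * \<alpha>)) * (indicator {0<..} r * (4 * pi * r\<^sup>2) * (radial_profile w r * exp (- 1 * r\<^sup>2)))"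
    have "integrable lborel (\<lambda>x. w x * exp (- 1 * (norm x)\<^sup>2))" by (rule tempered_real(1)[OF temp]) simp
    then have "integrable lborel (\<lambda>x::real^3. (\<lambda>r. radial_profile w r * exp (- 1 * r\<^sup>2)) (norm x))"
      by (subst (asm) radial_eq_profile[OF rad]) simp
    then have i: "integrable lborel (\<lambda>r. indicator {0<..} r * (4 * pi * r\<^sup>2) * (radial_profile w r * exp (- 1 * r\<^sup>2)))"
      by (subst (asm) integral_radial(2)) auto
    show ?thesis
      unfolding set_integrable_def
    proof (rule Bochner_Integration.integrable_bound)
      show "integrable lborel (\<lambda>r. ?F r)"
        by (rule integrable_mult_right[OF i])
      show "(\<lambda>r. ?u r) \<in> borel_measurable lborel"
        using borel_compact[OF K(1)] by measurable
      show "AE r in lborel. norm (?u r)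
         \<le> norm (?F r)"
      proof (rule AE_I2)
        fix r
        show "norm (?u r)
         \<le> norm (?F r)"
        proof (cases "r \<in> K")
          case True
          have r: "\<alpha> \<le> r" "r \<le> \<beta>" "0 < r" using \<alpha>(2)[OF True] \<beta>(2)[OF True] \<alpha>0 by auto
          have "r\<^sup>2 \<le> \<beta>\<^sup>2" using r by (intro power_mono) auto
          then have e: "1 \<le> exp (\<beta>\<^sup>2) * exp (- 1 * r\<^sup>2)" unfolding exp_add[symmetric] by simp
          have "1 \<le> r / \<alpha>" using r \<alpha>0 by simp
          then have "1 * 1 \<le> (r / \<alpha>) * (exp (\<beta>\<^sup>2) * exp (- 1 * r\<^sup>2))" using e by (intro mult_mono) auto
          then have "\<bar>r * radial_profile w r\<bar> * 1 \<le> \<bar>r * radial_profile w r\<bar> * ((r / \<alpha>) * (exp (\<beta>\<^sup>2) * exp (- 1 * r\<^sup>2)))"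
            by (intro mult_left_mono) auto
          then show ?thesis using True r \<alpha>0 by (simp add: abs_mult power2_eq_square mult_ac)
        qed simp
      qed
    qed
  qed (simp add: set_integrable_def)
qed

text \<open>The test is exp (- a |xi|^2) times the sine transform over |xi|, with a -> 0. Its
  Fourier transform is a mollification of \<phi> (|x|) / |x|, so both sides of the pairing converge
  by domination. The constant arises from (2 pi / r) * pi in the transform and 4 pi r^2 in polar
  coordinates; one power of r remains beside the profile.\<close>

lemma radial_sine_formula:
  fixes w :: "real^3 \<Rightarrow> real"
  assumes rad: "radial w" and temp: "tempered (\<lambda>x. complex_of_real (w x))" and pair: "gaussian_pair w g"
    and cont: "continuous_on UNIV \<phi>" and bd: "\<And>y. \<bar>\<phi> y\<bar> \<le> B" and supp: "\<And>y. \<bar>y\<bar> > R \<Longrightarrow> \<phi> y = 0"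
    and lip: "\<And>x y. \<bar>\<phi> x - \<phi> y\<bar> \<le> L * \<bar>x - y\<bar>" and R: "R \<ge> 0" and pos: "\<And>y. y \<le> 0 \<Longrightarrow> \<phi> y = 0"
    and int: "integrable lborel (\<lambda>\<xi>. g \<xi> * of_real (sine_transform \<phi> (norm \<xi>) / norm \<xi>))"
  shows "complex_of_real (8 * pi ^ 3 * (\<integral>r. r * radial_profile w r * \<phi> r \<partial>lborel))
     = (\<integral>\<xi>. g \<xi> * of_real (sine_transform \<phi> (norm \<xi>) / norm \<xi>) \<partial>lborel)"
proof -
  let ?S = "\<lambda>\<xi>::real^3. complex_of_real (sine_transform \<phi> (norm \<xi>) / norm \<xi>)"
  have m\<phi>[measurable]: "\<phi> \<in> borel_measurable borel" by (rule borel_measurable_continuous_onI[OF cont])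
  note mw[measurable] = tempered_real(2)[OF temp]
  have \<phi>: "integrable lborel \<phi>" by (rule integrable_bounded_support[of _ B R]) (use bd supp in auto)
  define c where "c = (\<lambda>n. \<integral>y. \<phi> y * sinc_seq y n \<partial>lborel)"
  have c: "slow_seq c" and cS: "\<And>k. egf c (k\<^sup>2) * k = sine_transform \<phi> k"
    unfolding c_def using sine_transform_egf[OF \<phi> supp R] by auto
  define h where "h n = inverse (real (Suc n))" for n
  have h: "h n > 0" "h n \<le> 1" for n by (auto simp: h_def field_simps)
  have h0: "h \<longlonglongrightarrow> 0" unfolding h_def[abs_def] by (rule LIMSEQ_inverse_real_of_nat)
  \<comment> \<open>This choice makes \<open>h n\<close> the standard deviation of the
    mollifier.\<close>
  define a where "a n = (h n)\<^sup>2 / 2" for n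
  have a: "a n > 0" for n using h[of n] by (simp add: a_def)
  have AE0: "AE \<xi> in lborel. (\<xi>::real^3) \<noteq> 0" by (rule AE_lborel_singleton)
  let ?H = "\<lambda>n x. w x * (2 * pi\<^sup>2 * (heat_diff \<phi> (h n) (norm x) / norm x))"
  have ip: "integrable lborel (\<lambda>\<xi>. g \<xi> * gaussian_test (a n) c \<xi>)" for n
    using pair a c unfolding gaussian_pair_def by blast
  have test: "gaussian_test (a n) c \<xi> = of_real (exp (- a n * (norm \<xi>)\<^sup>2)) * ?S \<xi>"
    if "\<xi> \<noteq> 0" for n and \<xi> :: "real^3"
    using that unfolding gaussian_test_def cS[symmetric] by simp
  have lim1: "(\<lambda>n. \<integral>\<xi>. g \<xi> * gaussian_test (a n) c \<xi> \<partial>lborel)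
     \<longlonglongrightarrow> (\<integral>\<xi>. g \<xi> * ?S \<xi> \<partial>lborel)"
  proof (rule integral_dominated_convergence[where w = "\<lambda>\<xi>. norm (g \<xi> * ?S \<xi>)"])
    show "(\<lambda>\<xi>. g \<xi> * ?S \<xi>) \<in> borel_measurable lborel"
      by (rule borel_measurable_integrable[OF int])
    show "(\<lambda>\<xi>. g \<xi> * gaussian_test (a n) c \<xi>) \<in> borel_measurable lborel" for n
      by (rule borel_measurable_integrable[OF ip])
    show "integrable lborel (\<lambda>\<xi>. norm (g \<xi> * ?S \<xi>))"
      by (rule integrable_norm[OF int])
    show "AE \<xi> in lborel. (\<lambda>n. g \<xi> * gaussian_test (a n) c \<xi>) \<longlonglongrightarrow> g \<xi> * ?S \<xi>"
      using AE0
    proof eventually_elim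
      case (elim \<xi>)
      have "(\<lambda>n. exp (- a n * (norm \<xi>)\<^sup>2)) \<longlonglongrightarrow> exp (- (0\<^sup>2 / 2) * (norm \<xi>)\<^sup>2)"
        unfolding a_def by (intro tendsto_intros h0) auto
      then have "(\<lambda>n. of_real (exp (- a n * (norm \<xi>)\<^sup>2)) :: complex) \<longlonglongrightarrow> of_real (exp (- (0\<^sup>2 / 2) * (norm \<xi>)\<^sup>2))"
        by (rule tendsto_of_real)
      then have "(\<lambda>n. g \<xi> * (of_real (exp (- a n * (norm \<xi>)\<^sup>2)) * ?S \<xi>))
         \<longlonglongrightarrow> g \<xi> * (of_real (exp (- (0\<^sup>2 / 2) * (norm \<xi>)\<^sup>2)) * ?S \<xi>)"
        by (intro tendsto_mult tendsto_const)
      then show ?case unfolding test[OF elim] by simp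
    qed
    show "AE \<xi> in lborel. norm (g \<xi> * gaussian_test (a n) c \<xi>) \<le> norm (g \<xi> * ?S \<xi>)" for n
      using AE0
    proof eventually_elim
      case (elim \<xi>)
      have "exp (- a n * (norm \<xi>)\<^sup>2) \<le> 1" using a[of n] by simp
      then have "exp (- a n * (norm \<xi>)\<^sup>2) * norm (g \<xi> * ?S \<xi>)
        \<le> 1 * norm (g \<xi> * ?S \<xi>)"
        by (intro mult_right_mono) auto
      moreover have "norm (g \<xi> * gaussian_test (a n) c \<xi>)
        = exp (- a n * (norm \<xi>)\<^sup>2) * norm (g \<xi> * ?S \<xi>)"
        unfolding test[OF elim] mult.left_commute[of "g \<xi>"] norm_mult[of "of_real (exp _)"] by simp
      ultimately show ?case by (simp only: mult_1_left)
    qed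
  qed
  have F: "fourier (gaussian_test (a n) c) x = complex_of_real (2 * pi\<^sup>2 * (heat_diff \<phi> (h n) (norm x) / norm x))"
    if x: "x \<noteq> 0" for n and x :: "real^3"
  proof -
    have "fourier (gaussian_test (a n) c) x
      = complex_of_real (2 * pi / norm x * (\<integral>k. exp (- a n * k\<^sup>2) * egf c (k\<^sup>2) * (k * sin (norm x * k)) \<partial>lborel))"
      unfolding gaussian_test_def[abs_def] by (rule fourier_gaussian_egf[OF a c x])
    also have "(\<integral>k. exp (- a n * k\<^sup>2) * egf c (k\<^sup>2) * (k * sin (norm x * k)) \<partial>lborel)
       = (\<integral>k. exp (- ((h n)\<^sup>2 / 2) * k\<^sup>2) * (sine_transform \<phi> k * sin (norm x * k)) \<partial>lborel)"
      unfolding cS[symmetric] a_def by (intro Bochner_Integration.integral_cong refl) simp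
    also have "\<dots> = pi * heat_diff \<phi> (h n) (norm x)" by (rule gaussian_sine_transform[OF \<phi> h(1)])
    finally show ?thesis by (simp add: power2_eq_square)
  qed
  obtain C where C: "C \<ge> 0" "\<And>h r. 0 < h \<Longrightarrow> h \<le> 1 \<Longrightarrow> r > 0 \<Longrightarrow> \<bar>heat_diff \<phi> h r\<bar> / r \<le> C * exp (- (1/8) * r\<^sup>2)"
    using heat_diff_bound[OF m\<phi> bd supp lip R] by blast
  have hm[measurable]: "heat_diff \<phi> h' \<in> borel_measurable borel" for h'
    unfolding heat_diff_def[abs_def] by measurable
  have lim2: "(\<lambda>n. \<integral>x. ?H n x \<partial>lborel)
     \<longlonglongrightarrow> (\<integral>x. w x * (2 * pi\<^sup>2 * (\<phi> (norm x) / norm x)) \<partial>lborel)"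
  proof (rule integral_dominated_convergence[where w = "\<lambda>x. 2 * pi\<^sup>2 * C * \<bar>w x * exp (- (1/8) * (norm x)\<^sup>2)\<bar>"])
    show "integrable lborel (\<lambda>x. 2 * pi\<^sup>2 * C * \<bar>w x * exp (- (1/8) * (norm x)\<^sup>2)\<bar>)"
      by (intro integrable_mult_right integrable_abs tempered_real(1)[OF temp]) simp
    show "AE x in lborel. (\<lambda>n. ?H n x)
       \<longlonglongrightarrow> w x * (2 * pi\<^sup>2 * (\<phi> (norm x) / norm x))"
    proof (rule AE_I2)
      fix x :: "real^3"
      \<comment> \<open>Since \<phi> vanishes on the left half-line, the reflected term drops out of
        the limit.\<close>
      have "(\<lambda>n. heat_diff \<phi> (h n) (norm x)) \<longlonglongrightarrow> \<phi> (norm x)"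
        using heat_diff_tendsto[OF cont bd h0, of "norm x"] pos[of "- norm x"] by simp
      then show "(\<lambda>n. ?H n x)
       \<longlonglongrightarrow> w x * (2 * pi\<^sup>2 * (\<phi> (norm x) / norm x))"
        unfolding divide_inverse by (intro tendsto_intros)
    qed
    show "AE x in lborel. norm (?H n x)
       \<le> 2 * pi\<^sup>2 * C * \<bar>w x * exp (- (1/8) * (norm x)\<^sup>2)\<bar>" for n
      using AE0
    proof eventually_elim
      case (elim x)
      have "\<bar>heat_diff \<phi> (h n) (norm x)\<bar> / norm x \<le> C * exp (- (1/8) * (norm x)\<^sup>2)"
        by (rule C(2)[OF h]) (use elim in simp)
      then have "(\<bar>w x\<bar> * 2 * pi\<^sup>2) * (\<bar>heat_diff \<phi> (h n) (norm x)\<bar> / norm x) \<le> (\<bar>w x\<bar> * 2 * pi\<^sup>2) * (C * exp (- (1/8) * (norm x)\<^sup>2))"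
        by (intro mult_left_mono) auto
      then show ?case by (simp add: abs_mult mult_ac)
    qed
  qed measurable
  have eq: "(\<integral>\<xi>. g \<xi> * gaussian_test (a n) c \<xi> \<partial>lborel)
     = complex_of_real (\<integral>x. ?H n x \<partial>lborel)" for n
  proof -
    have "(\<integral>\<xi>. g \<xi> * gaussian_test (a n) c \<xi> \<partial>lborel) = (\<integral>x. complex_of_real (w x) * fourier (gaussian_test (a n) c) x \<partial>lborel)"
      using pair a c unfolding gaussian_pair_def by simp
    also have "\<dots> = (\<integral>x. complex_of_real (?H n x) \<partial>lborel)"
    proof (rule integral_cong_AE)
      show "(\<lambda>x. complex_of_real (?H n x)) \<in> borel_measurable lborel"
        by measurable
      show ae: "AE x in lborel. complex_of_real (w x) * fourier (gaussian_test (a n) c) x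
        = complex_of_real (?H n x)"
        using AE0 by eventually_elim (simp add: F)
      note [measurable] = egf_measurable[OF c]
      have cis[measurable]: "cis \<in> borel_measurable borel"
        by (intro borel_measurable_continuous_onI continuous_intros)
      have "(\<lambda>x. fourier (gaussian_test (a n) c) x) \<in> borel_measurable (lborel :: (real^3) measure)"
        unfolding fourier_def gaussian_test_def by measurable
      then show "(\<lambda>x. complex_of_real (w x) * fourier (gaussian_test (a n) c) x) \<in> borel_measurable lborel"
        by measurable
    qed
    also have "\<dots> = complex_of_real (\<integral>x. ?H n x \<partial>lborel)"
      by (rule integral_complex_of_real)
    finally show ?thesis .
  qed
  have "(\<lambda>n. \<integral>\<xi>. g \<xi> * gaussian_test (a n) c \<xi> \<partial>lborel)
     \<longlonglongrightarrow> complex_of_real (\<integral>x. w x * (2 * pi\<^sup>2 * (\<phi> (norm x) / norm x)) \<partial>lborel)"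
    unfolding eq by (rule tendsto_of_real[OF lim2])
  then have "complex_of_real (\<integral>x. w x * (2 * pi\<^sup>2 * (\<phi> (norm x) / norm x)) \<partial>lborel)
    = (\<integral>\<xi>. g \<xi> * ?S \<xi> \<partial>lborel)"
    using lim1 by (rule LIMSEQ_unique)
  moreover have "(\<integral>x. w x * (2 * pi\<^sup>2 * (\<phi> (norm x) / norm x)) \<partial>lborel)
     = 8 * pi ^ 3 * (\<integral>r. r * radial_profile w r * \<phi> r \<partial>lborel)"
  proof -
    have "(\<integral>x. w x * (2 * pi\<^sup>2 * (\<phi> (norm x) / norm x)) \<partial>lborel)
       = (\<integral>x. (\<lambda>r. radial_profile w r * (2 * pi\<^sup>2 * (\<phi> r / r))) (norm (x::real^3)) \<partial>lborel)"
      by (subst radial_eq_profile[OF rad]) simp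
    also have "\<dots> = (\<integral>r. indicator {0<..} r * (4 * pi * r\<^sup>2) * (radial_profile w r * (2 * pi\<^sup>2 * (\<phi> r / r))) \<partial>lborel)"
      by (rule integral_radial(1)) measurable
    also have "\<dots> = (\<integral>r. 8 * pi ^ 3 * (r * radial_profile w r * \<phi> r) \<partial>lborel)"
    proof (rule Bochner_Integration.integral_cong[OF refl])
      fix r
      show "indicator {0<..} r * (4 * pi * r\<^sup>2) * (radial_profile w r * (2 * pi\<^sup>2 * (\<phi> r / r))) = 8 * pi ^ 3 * (r * radial_profile w r * \<phi> r)"
      proof (cases "r > 0")
        case True
        then show ?thesis by (simp add: power2_eq_square power3_eq_cube)
      next
        case False
        then show ?thesis using pos[of r] by simp
      qed
    qed
    finally show ?thesis by simp
  qed
  ultimately show ?thesis by simp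
qed

section \<open>Smooth functions of one variable\<close>

definition deriv_seq :: "(nat \<Rightarrow> real \<Rightarrow> real) \<Rightarrow> bool" where
  "deriv_seq D \<longleftrightarrow> (\<forall>n x. (D n has_real_derivative D (Suc n) x) (at x))"

text \<open>The only basis vector of the line is 1, so the iterated directional derivatives form a
  single sequence.\<close>

lemma smooth_real_iff: "smooth f \<longleftrightarrow> (\<exists>D. D 0 = f \<and> deriv_seq D)" for f :: "real \<Rightarrow> real"
proof
  assume s: "smooth f"
  let ?D = "\<lambda>n. iter_deriv (replicate n (1::real)) f"
  have "(?D n has_real_derivative ?D (Suc n) x) (at x)" for n x
  proof -
    have "set (replicate n (1::real)) \<subseteq> Basis" by (auto simp: set_replicate_conv_if)
    then have "?D n differentiable_on UNIV" using s unfolding smooth_def by blast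
    then have "?D n differentiable (at x)" unfolding differentiable_on_def by auto
    then have fd: "(?D n has_derivative frechet_derivative (?D n) (at x)) (at x)"
      using frechet_derivative_works by blast
    then have lin: "linear (frechet_derivative (?D n) (at x))"
      using has_derivative_linear by blast
    have "frechet_derivative (?D n) (at x) h = ?D (Suc n) x * h" for h
      using linear_scale[OF lin, of h 1] by simp
    then have "frechet_derivative (?D n) (at x) = (\<lambda>h. ?D (Suc n) x * h)" by (rule ext)
    with fd show ?thesis unfolding has_field_derivative_def by (simp only:)
  qed
  then show "\<exists>D. D 0 = f \<and> deriv_seq D"
    unfolding deriv_seq_def by (intro exI[of _ ?D]) auto
next
  assume "\<exists>D. D 0 = f \<and> deriv_seq D"
  then obtain D where D: "D 0 = f" "\<And>n x. (D n has_real_derivative D (Suc n) x) (at x)"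
    unfolding deriv_seq_def by auto
  have it: "iter_deriv bs f = D (length bs)" if "set bs \<subseteq> {1}" for bs
    using that
  proof (induction bs)
    case (Cons b bs)
    have "frechet_derivative (D (length bs)) (at x) = (\<lambda>h. D (Suc (length bs)) x * h)" for x
      using frechet_derivative_at[of "D (length bs)"] D(2)[of "length bs" x]
      unfolding has_field_derivative_def by metis
    with Cons show ?case by simp
  qed (simp add: D(1))
  show "smooth f"
    unfolding smooth_def
  proof (intro allI impI)
    fix bs :: "real list" assume "set bs \<subseteq> Basis"
    then have "iter_deriv bs f = D (length bs)" using it by simp
    then show "iter_deriv bs f differentiable_on UNIV"
      using D(2) unfolding differentiable_on_def differentiable_def has_field_derivative_def by auto
  qed
qed

text \<open>Sums, products and composites are shown to be smooth without formulas for their higher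
  derivatives: the elementary differentiation rules keep the derivative inside this class, and that
  can be iterated.\<close>

inductive smooth_closure :: "(real \<Rightarrow> real) \<Rightarrow> bool" where
  base: "deriv_seq D \<Longrightarrow> smooth_closure (D n)"
| add: "smooth_closure f \<Longrightarrow> smooth_closure g \<Longrightarrow> smooth_closure (\<lambda>x. f x + g x)"
| mult: "smooth_closure f \<Longrightarrow> smooth_closure g \<Longrightarrow> smooth_closure (\<lambda>x. f x * g x)"
| comp: "smooth_closure f \<Longrightarrow> smooth_closure g \<Longrightarrow> smooth_closure (\<lambda>x. f (g x))"

lemma smooth_closure_deriv:
  "smooth_closure f \<Longrightarrow> \<exists>f'. smooth_closure f' \<and> (\<forall>x. (f has_real_derivative f' x) (at x))"
proof (induction rule: smooth_closure.induct)
  case (base D n)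
  then show ?case by (intro exI[of _ "D (Suc n)"]) (auto intro: smooth_closure.base simp: deriv_seq_def)
next
  case (add f g)
  then obtain f' g' where "smooth_closure f'" "\<And>x. (f has_real_derivative f' x) (at x)"
    "smooth_closure g'" "\<And>x. (g has_real_derivative g' x) (at x)" by auto
  then show ?case
    by (intro exI[of _ "\<lambda>x. f' x + g' x"]) (auto intro: smooth_closure.add DERIV_add)
next
  case (mult f g)
  then obtain f' g' where d: "smooth_closure f'" "\<And>x. (f has_real_derivative f' x) (at x)"
    "smooth_closure g'" "\<And>x. (g has_real_derivative g' x) (at x)" by auto
  have "smooth_closure (\<lambda>x. f' x * g x + g' x * f x)"
    by (intro smooth_closure.add smooth_closure.mult d mult.hyps)
  moreover have "((\<lambda>x. f x * g x) has_real_derivative f' x * g x + g' x * f x) (at x)" for x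
    by (rule DERIV_mult[OF d(2,4)])
  ultimately show ?case by blast
next
  case (comp f g)
  then obtain f' g' where d: "smooth_closure f'" "\<And>x. (f has_real_derivative f' x) (at x)"
    "smooth_closure g'" "\<And>x. (g has_real_derivative g' x) (at x)" by auto
  have "smooth_closure (\<lambda>x. f' (g x) * g' x)"
    by (rule smooth_closure.mult[OF smooth_closure.comp[OF d(1) comp.hyps(2)] d(3)])
  moreover have "((\<lambda>x. f (g x)) has_real_derivative f' (g x) * g' x) (at x)" for x
    by (rule DERIV_chain2[OF d(2,4)])
  ultimately show ?case by blast
qed

lemma smooth_iff_closure: "smooth f \<longleftrightarrow> smooth_closure f" for f :: "real \<Rightarrow> real"
proof
  assume "smooth f"
  then obtain D where "D 0 = f" "deriv_seq D" unfolding smooth_real_iff by auto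
  then show "smooth_closure f" using smooth_closure.base[of D 0] by simp
next
  assume f: "smooth_closure f"
  \<comment> \<open>One derivative inside the class is chosen at each stage, so that iterating the
    choice yields a \<open>deriv_seq\<close>.\<close>
  define next_deriv where "next_deriv g = (SOME g'. smooth_closure g' \<and> (\<forall>x. (g has_real_derivative g' x) (at x)))" for g
  have nd: "smooth_closure (next_deriv g) \<and> (\<forall>x. (g has_real_derivative next_deriv g x) (at x))"
    if "smooth_closure g" for g
    unfolding next_deriv_def by (rule someI_ex[OF smooth_closure_deriv[OF that]])
  define D where "D n = (next_deriv ^^ n) f" for n
  have D: "smooth_closure (D n)" for n
    by (induction n) (auto simp: D_def f nd)
  have "deriv_seq D"
    unfolding deriv_seq_def using nd[OF D] by (simp add: D_def)
  moreover have "D 0 = f" by (simp add: D_def)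
  ultimately show "smooth f" unfolding smooth_real_iff by blast
qed

lemma smooth_real_add: "smooth f \<Longrightarrow> smooth g \<Longrightarrow> smooth (\<lambda>x. f x + g x)" for f g :: "real \<Rightarrow> real"
  unfolding smooth_iff_closure by (rule smooth_closure.add)

lemma smooth_real_mult: "smooth f \<Longrightarrow> smooth g \<Longrightarrow> smooth (\<lambda>x. f x * g x)" for f g :: "real \<Rightarrow> real"
  unfolding smooth_iff_closure by (rule smooth_closure.mult)

lemma smooth_real_compose: "smooth f \<Longrightarrow> smooth g \<Longrightarrow> smooth (\<lambda>x. f (g x))" for f g :: "real \<Rightarrow> real"
  unfolding smooth_iff_closure by (rule smooth_closure.comp)

lemma smooth_real_affine: "smooth (\<lambda>x. a * x + b)" for a b :: real
proof -
  have "deriv_seq (\<lambda>n x. if n = 0 then a * x + b else if n = 1 then a else 0)"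
    unfolding deriv_seq_def by (auto intro!: derivative_eq_intros)
  then show ?thesis unfolding smooth_real_iff by (intro exI conjI) auto
qed

lemma smooth_real_has_derivative:
  fixes f :: "real \<Rightarrow> real"
  assumes "smooth f"
  shows "(f has_real_derivative deriv f x) (at x)" "smooth (deriv f)"
proof -
  obtain f' where f': "smooth_closure f'" "\<And>x. (f has_real_derivative f' x) (at x)"
    using smooth_closure_deriv assms unfolding smooth_iff_closure by blast
  have "deriv f = f'" using f'(2) by (auto intro: DERIV_imp_deriv)
  with f' show "(f has_real_derivative deriv f x) (at x)" "smooth (deriv f)"
    by (simp_all add: smooth_iff_closure)
qed

section \<open>A flat function and monotone cutoffs at the origin\<close>

definition flat_poly :: "real poly \<Rightarrow> real \<Rightarrow> real" where
  "flat_poly p x = (if x > 0 then poly p (1 / x) * exp (- (1 / x)) else 0)"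

abbreviation flat :: "real \<Rightarrow> real" where
  "flat \<equiv> flat_poly 1"

lemma flat_poly_tendsto: "((\<lambda>x. poly p (1 / x) * exp (- (1 / x))) \<longlongrightarrow> 0) (at_right (0::real))"
proof -
  have "((\<lambda>t::real. \<Sum>i\<le>degree p. coeff p i * (t ^ i / exp t)) \<longlongrightarrow> (\<Sum>i\<le>degree p. coeff p i * 0)) at_top"
    by (intro tendsto_sum tendsto_mult tendsto_const tendsto_power_div_exp_0)
  moreover have "(\<Sum>i\<le>degree p. coeff p i * (t ^ i / exp t)) = poly p t * exp (- t)" for t :: real
    by (simp add: poly_altdef sum_distrib_right exp_minus divide_inverse mult.assoc)
  ultimately have "((\<lambda>t::real. poly p t * exp (- t)) \<longlongrightarrow> 0) at_top" by simp
  moreover have "filterlim (\<lambda>x::real. 1 / x) at_top (at_right 0)"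
    using filterlim_inverse_at_top_right by (simp add: divide_inverse)
  ultimately show ?thesis by (rule filterlim_compose)
qed

text \<open>With t = 1 / x one has d/dx = - t^2 d/dt, so the derivative of p(t) exp (- t) is t^2 (p
  - p')(t) exp (- t), again of this form. At 0 the right-hand difference quotient is t p(t) exp (-
  t), which tends to 0.\<close>

lemma flat_poly_deriv:
  "(flat_poly p has_real_derivative flat_poly ([:0, 0, 1:] * (p - pderiv p)) x) (at x)"
proof (cases "x = 0")
  case False
  show ?thesis
  proof (cases "x > 0")
    case True
    have "((\<lambda>x. poly p (1 / x) * exp (- (1 / x))) has_real_derivative
       flat_poly ([:0, 0, 1:] * (p - pderiv p)) x) (at x)"
      using True unfolding flat_poly_def
      by (auto intro!: derivative_eq_intros DERIV_chain2[OF poly_DERIV]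
          simp: field_simps power2_eq_square)
    then show ?thesis
      by (rule has_field_derivative_transform_within_open[of _ _ _ "{0<..}"])
        (use True in \<open>auto simp: flat_poly_def\<close>)
  next
    case False
    with \<open>x \<noteq> 0\<close> have "x < 0" by simp
    have "((\<lambda>x. 0) has_real_derivative flat_poly ([:0, 0, 1:] * (p - pderiv p)) x) (at x)"
      using \<open>x < 0\<close> by (simp add: flat_poly_def)
    then show ?thesis
      by (rule has_field_derivative_transform_within_open[of _ _ _ "{..<0}"])
        (use \<open>x < 0\<close> in \<open>auto simp: flat_poly_def\<close>)
  qed
next
  case True
  have "((\<lambda>x. (flat_poly p x - flat_poly p 0) / (x - 0)) \<longlongrightarrow> 0) (at 0)"
    unfolding filterlim_at_split
  proof
    show "((\<lambda>x. (flat_poly p x - flat_poly p 0) / (x - 0)) \<longlongrightarrow> 0) (at_left 0)"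
      by (rule tendsto_eventually) (auto simp: eventually_at_filter flat_poly_def)
    have "((\<lambda>x. poly ([:0, 1:] * p) (1 / x) * exp (- (1 / x))) \<longlongrightarrow> 0) (at_right 0)"
      by (rule flat_poly_tendsto)
    then show "((\<lambda>x. (flat_poly p x - flat_poly p 0) / (x - 0)) \<longlongrightarrow> 0) (at_right 0)"
      by (rule Lim_transform_eventually) (auto simp: eventually_at_filter flat_poly_def)
  qed
  then show ?thesis
    unfolding True has_field_derivative_iff by (simp add: flat_poly_def)
qed

lemma smooth_flat: "smooth flat"
proof -
  define D where "D n = flat_poly (((\<lambda>p. [:0, 0, 1:] * (p - pderiv p)) ^^ n) 1)" for n
  have "deriv_seq D" unfolding deriv_seq_def D_def funpow.simps o_apply by (intro allI flat_poly_deriv)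
  moreover have "D 0 = flat" by (simp add: D_def)
  ultimately show ?thesis unfolding smooth_real_iff by blast
qed

text \<open>The factor n + 1 drives the argument to infinity at every x > 0, while the shift keeps
  the function 0 up to 1 / (n + 1)^2, so that products with it are supported away from 0. Being
  monotone with values in [0, 1], each cutoff has total variation at most 1.\<close>

definition cutoff :: "nat \<Rightarrow> real \<Rightarrow> real" where
  "cutoff n x = flat (real (Suc n) * x + - (1 / real (Suc n)))"

lemma smooth_cutoff: "smooth (cutoff n)"
  unfolding cutoff_def[abs_def] by (rule smooth_real_compose[OF smooth_flat smooth_real_affine])

lemma cutoff_bounds: "0 \<le> cutoff n x" "cutoff n x \<le> 1"
  by (auto simp: cutoff_def flat_poly_def)

lemma cutoff_eq_0: "x \<le> 1 / (real (Suc n))\<^sup>2 \<Longrightarrow> cutoff n x = 0"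
proof -
  assume "x \<le> 1 / (real (Suc n))\<^sup>2"
  then have "real (Suc n) * x \<le> real (Suc n) * (1 / (real (Suc n))\<^sup>2)" by (intro mult_left_mono) auto
  also have "\<dots> = 1 / real (Suc n)" by (simp add: power2_eq_square)
  finally show ?thesis by (simp add: cutoff_def flat_poly_def)
qed

lemma cutoff_deriv_nonneg: "deriv (cutoff n) x \<ge> 0"
proof -
  let ?y = "real (Suc n) * x + - (1 / real (Suc n))"
  have "((\<lambda>x. real (Suc n) * x + - (1 / real (Suc n))) has_real_derivative real (Suc n)) (at x)"
    by (auto intro!: derivative_eq_intros)
  from DERIV_chain2[OF flat_poly_deriv this]
  have "deriv (cutoff n) x = flat_poly ([:0, 0, 1:] * (1 - pderiv 1)) ?y * real (Suc n)"
    unfolding cutoff_def[abs_def] by (rule DERIV_imp_deriv)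
  moreover have "flat_poly ([:0, 0, 1:] * (1 - pderiv 1)) ?y \<ge> 0"
    by (simp add: flat_poly_def)
  ultimately show ?thesis by simp
qed

lemma cutoff_tendsto: "x > 0 \<Longrightarrow> (\<lambda>n. cutoff n x) \<longlonglongrightarrow> 1"
proof -
  assume x: "x > 0"
  have lim: "filterlim (\<lambda>n. real (Suc n) * x + - (1 / real (Suc n))) at_top sequentially"
    using x by real_asymp
  have "((\<lambda>t::real. exp (- (1 / t))) \<longlongrightarrow> 1) at_top" by real_asymp
  from filterlim_compose[OF this lim]
  have "(\<lambda>n. exp (- (1 / (real (Suc n) * x + - (1 / real (Suc n)))))) \<longlonglongrightarrow> 1" .
  moreover have "eventually (\<lambda>n. exp (- (1 / (real (Suc n) * x + - (1 / real (Suc n))))) = cutoff n x) sequentially"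
    using filterlim_at_top_dense[THEN iffD1, OF lim, rule_format, of 0]
    by eventually_elim (simp add: cutoff_def flat_poly_def)
  ultimately show ?thesis by (rule Lim_transform_eventually)
qed

lemma has_derivative_support:
  assumes "\<And>x. (f has_real_derivative f' x) (at x)" "\<And>x. \<bar>x\<bar> > R \<Longrightarrow> f x = 0" "\<bar>x\<bar> > R"
  shows "f' x = (0::real)"
proof -
  have "open {x::real. \<bar>x\<bar> > R}" by (intro open_Collect_less continuous_intros)
  then have "((\<lambda>x. 0) has_real_derivative f' x) (at x)"
    by (rule has_field_derivative_transform_within_open[OF assms(1)]) (use assms in auto)
  then show ?thesis using DERIV_unique DERIV_const by blast
qed

lemma integral_derivative_eq_0:
  fixes f f' :: "real \<Rightarrow> real"
  assumes f: "\<And>x. (f has_real_derivative f' x) (at x)" and f': "continuous_on UNIV f'"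
    and supp: "\<And>x. \<bar>x\<bar> > R \<Longrightarrow> f x = 0"
  shows "(\<integral>x. f' x \<partial>lborel) = 0"
proof -
  \<comment> \<open>\<open>f\<close> is known to vanish only strictly beyond \<open>R\<close>, so
    the endpoints are moved outwards.\<close>
  define S where "S = \<bar>R\<bar> + 1"
  have S: "S > R" "S > 0" by (auto simp: S_def)
  have "f' x = f' x * indicator {-S..S} x" for x
    using has_derivative_support[where R = R and x = x, OF f supp] S by (auto split: split_indicator)
  then have "(\<integral>x. f' x \<partial>lborel) = (\<integral>x. f' x * indicator {-S..S} x \<partial>lborel)"
    by (rule Bochner_Integration.integral_cong[OF refl])
  also have "\<dots> = f S - f (- S)"
    by (rule integral_FTC_Icc_real) (use f f' S in \<open>auto simp: continuous_on_eq_continuous_at\<close>)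
  also have "\<dots> = 0" using supp[of S] supp[of "- S"] S by simp
  finally show ?thesis .
qed

section \<open>Compactly supported smooth functions and their transforms\<close>

definition bump :: "(real \<Rightarrow> real) \<Rightarrow> bool" where
  "bump \<phi> \<longleftrightarrow> smooth \<phi> \<and> (\<exists>R\<ge>0. \<forall>y. \<bar>y\<bar> > R \<longrightarrow> \<phi> y = 0)"

lemma test_function_bump:
  assumes "test_function_on S \<phi>"
  shows "bump \<phi>"
proof -
  from assms obtain K where K: "smooth \<phi>" "compact K" "\<And>x. x \<notin> K \<Longrightarrow> \<phi> x = 0"
    unfolding test_function_on_def by auto
  obtain R where R: "\<forall>x\<in>K. norm x \<le> R" using compact_imp_bounded[OF K(2)] unfolding bounded_iff by blast
  have "\<phi> y = 0" if "\<bar>y\<bar> > \<bar>R\<bar>" for y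
    using K(3)[of y] bspec[OF R, of y] that by (cases "y \<in> K") auto
  with K(1) show ?thesis unfolding bump_def by (intro conjI exI[of _ "\<bar>R\<bar>"]) auto
qed

lemma bump_continuous: "bump \<phi> \<Longrightarrow> continuous_on UNIV \<phi>"
  unfolding bump_def
  by (intro continuous_at_imp_continuous_on ballI DERIV_isCont[OF smooth_real_has_derivative(1)]) auto

lemma bump_measurable [measurable_dest]: "bump \<phi> \<Longrightarrow> \<phi> \<in> borel_measurable borel"
  by (rule borel_measurable_continuous_onI[OF bump_continuous])

lemma bump_deriv:
  assumes "bump \<phi>"
  shows "bump (deriv \<phi>)" "(\<phi> has_real_derivative deriv \<phi> x) (at x)"
proof -
  show d: "(\<phi> has_real_derivative deriv \<phi> x) (at x)" for x
    using assms smooth_real_has_derivative unfolding bump_def by blast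
  obtain R where R: "R \<ge> 0" "\<And>y. \<bar>y\<bar> > R \<Longrightarrow> \<phi> y = 0" using assms unfolding bump_def by auto
  have "deriv \<phi> y = 0" if "\<bar>y\<bar> > R" for y
    by (rule has_derivative_support[OF d R(2) that])
  then show "bump (deriv \<phi>)"
    using assms smooth_real_has_derivative R(1) unfolding bump_def by blast
qed

lemma bump_bounded:
  assumes "bump \<phi>"
  shows "\<exists>B. \<forall>y. \<bar>\<phi> y\<bar> \<le> B"
proof -
  obtain R where R: "R \<ge> 0" "\<And>y. \<bar>y\<bar> > R \<Longrightarrow> \<phi> y = 0" using assms unfolding bump_def by auto
  have "compact (\<phi> ` {-R..R})"
    by (intro compact_continuous_image continuous_on_subset[OF bump_continuous[OF assms]]) auto
  then obtain B where B: "\<And>y. y \<in> {-R..R} \<Longrightarrow> \<bar>\<phi> y\<bar> \<le> B"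
    using compact_imp_bounded bounded_iff by (metis image_eqI real_norm_def)
  have "\<bar>\<phi> y\<bar> \<le> \<bar>B\<bar>" for y
    using B[of y] R(2)[of y] by (cases "\<bar>y\<bar> > R") fastforce+
  then show ?thesis by blast
qed

lemma bump_integrable:
  assumes "bump \<phi>"
  shows "integrable lborel \<phi>"
proof -
  obtain R where R: "R \<ge> 0" "\<And>y. \<bar>y\<bar> > R \<Longrightarrow> \<phi> y = 0" using assms unfolding bump_def by auto
  obtain B where B: "\<And>y. \<bar>\<phi> y\<bar> \<le> B" using bump_bounded[OF assms] by auto
  show ?thesis by (rule integrable_bounded_support[OF bump_measurable[OF assms] B R(2)])
qed

lemma bump_mult:
  assumes "bump \<phi>" "smooth \<psi>"
  shows "bump (\<lambda>x. \<phi> x * \<psi> x)"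
  using assms unfolding bump_def by (auto intro!: smooth_real_mult)

lemma bump_affine:
  assumes "bump \<phi>" "a \<noteq> 0"
  shows "bump (\<lambda>x. \<phi> (a * x + b))"
proof -
  obtain R where R: "R \<ge> 0" "\<And>y. \<bar>y\<bar> > R \<Longrightarrow> \<phi> y = 0" using assms(1) unfolding bump_def by auto
  have "\<phi> (a * y + b) = 0" if y: "\<bar>y\<bar> > (R + \<bar>b\<bar>) / \<bar>a\<bar>" for y
  proof (rule R(2))
    have "R + \<bar>b\<bar> < \<bar>y\<bar> * \<bar>a\<bar>" using y assms(2) by (simp add: divide_less_eq)
    then have "R + \<bar>b\<bar> < \<bar>a * y\<bar>" by (simp add: abs_mult mult.commute)
    then show "\<bar>a * y + b\<bar> > R" by linarith
  qed
  moreover have "(R + \<bar>b\<bar>) / \<bar>a\<bar> \<ge> 0" using R(1) by simp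
  moreover have "smooth (\<lambda>x. \<phi> (a * x + b))"
    using assms(1) smooth_real_compose[OF _ smooth_real_affine] unfolding bump_def by blast
  ultimately show ?thesis unfolding bump_def by blast
qed

lemma transform_deriv:
  assumes \<phi>: "bump \<phi>"
  shows "sine_transform (deriv \<phi>) k = - k * cosine_transform \<phi> k"
    and "cosine_transform (deriv \<phi>) k = k * sine_transform \<phi> k"
proof -
  note d = bump_deriv[OF \<phi>]
  obtain R where R: "R \<ge> 0" "\<And>y. \<bar>y\<bar> > R \<Longrightarrow> \<phi> y = 0" using \<phi> unfolding bump_def by auto
  note i = sine_transform_integrable[OF bump_integrable[OF \<phi>], of k]
    sine_transform_integrable[OF bump_integrable[OF d(1)], of k]
  have "(\<integral>y. deriv \<phi> y * sin (k * y) + k * (\<phi> y * cos (k * y)) \<partial>lborel) = 0"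
  proof (rule integral_derivative_eq_0[where f = "\<lambda>y. \<phi> y * sin (k * y)" and R = R])
    show "((\<lambda>y. \<phi> y * sin (k * y)) has_real_derivative deriv \<phi> y * sin (k * y) + k * (\<phi> y * cos (k * y))) (at y)" for y
      by (auto intro!: derivative_eq_intros d(2) simp: mult_ac)
    show "continuous_on UNIV (\<lambda>y. deriv \<phi> y * sin (k * y) + k * (\<phi> y * cos (k * y)))"
      by (intro continuous_intros bump_continuous[OF \<phi>] bump_continuous[OF d(1)])
  qed (use R in simp)
  then show "sine_transform (deriv \<phi>) k = - k * cosine_transform \<phi> k"
    unfolding sine_transform_def cosine_transform_def using i by simp
  have "(\<integral>y. deriv \<phi> y * cos (k * y) + - k * (\<phi> y * sin (k * y)) \<partial>lborel) = 0"
  proof (rule integral_derivative_eq_0[where f = "\<lambda>y. \<phi> y * cos (k * y)" and R = R])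
    show "((\<lambda>y. \<phi> y * cos (k * y)) has_real_derivative deriv \<phi> y * cos (k * y) + - k * (\<phi> y * sin (k * y))) (at y)" for y
      by (auto intro!: derivative_eq_intros d(2) simp: mult_ac)
    show "continuous_on UNIV (\<lambda>y. deriv \<phi> y * cos (k * y) + - k * (\<phi> y * sin (k * y)))"
      by (intro continuous_intros bump_continuous[OF \<phi>] bump_continuous[OF d(1)])
  qed (use R in simp)
  then show "cosine_transform (deriv \<phi>) k = k * sine_transform \<phi> k"
    unfolding sine_transform_def cosine_transform_def using i by simp
qed

lemma transform_le:
  assumes "integrable lborel \<phi>"
  shows "\<bar>sine_transform \<phi> k\<bar> \<le> L1_norm \<phi>" "\<bar>cosine_transform \<phi> k\<bar> \<le> L1_norm \<phi>"
proof -
  have le: "\<bar>\<phi> y * sin (k * y)\<bar> \<le> \<bar>\<phi> y\<bar>" "\<bar>\<phi> y * cos (k * y)\<bar> \<le> \<bar>\<phi> y\<bar>" for y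
    using mult_left_mono[OF abs_sin_le_one, of "\<bar>\<phi> y\<bar>" "k * y"] mult_left_mono[OF abs_cos_le_one, of "\<bar>\<phi> y\<bar>" "k * y"]
    by (auto simp: abs_mult)
  show "\<bar>sine_transform \<phi> k\<bar> \<le> L1_norm \<phi>"
    unfolding sine_transform_def
    by (rule order_trans[OF integral_abs_bound integral_mono])
      (use le sine_transform_integrable[OF assms] assms in auto)
  show "\<bar>cosine_transform \<phi> k\<bar> \<le> L1_norm \<phi>"
    unfolding cosine_transform_def
    by (rule order_trans[OF integral_abs_bound integral_mono])
      (use le sine_transform_integrable[OF assms] assms in auto)
qed

text \<open>Integration by parts bounds k times a transform by the L1 norm of the derivative. The
  constant is kept explicit because it must stay bounded along a sequence of cut off
  functions.\<close>

lemma transform_decay: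
  assumes \<phi>: "bump \<phi>" and k: "k \<ge> 0"
  shows "\<bar>sine_transform \<phi> k\<bar> \<le> (L1_norm \<phi> + L1_norm (deriv \<phi>)) / (1 + k)"
    and "\<bar>cosine_transform \<phi> k\<bar> \<le> (L1_norm \<phi> + L1_norm (deriv \<phi>)) / (1 + k)"
proof -
  note t = transform_le[OF bump_integrable[OF \<phi>], of k]
    transform_le[OF bump_integrable[OF bump_deriv(1)[OF \<phi>]], of k, unfolded transform_deriv[OF \<phi>]]
  show "\<bar>sine_transform \<phi> k\<bar> \<le> (L1_norm \<phi> + L1_norm (deriv \<phi>)) / (1 + k)"
    using t(1,4) k by (simp add: abs_mult pos_le_divide_eq algebra_simps)
  show "\<bar>cosine_transform \<phi> k\<bar> \<le> (L1_norm \<phi> + L1_norm (deriv \<phi>)) / (1 + k)"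
    using t(2,3) k by (simp add: abs_mult pos_le_divide_eq algebra_simps)
qed

text \<open>Two estimates are added: |sin (k y)| \<le> k R on the support, for small k, and
  boundedness of the transform, for large k. At k = 0 the quotient is 0 by convention.\<close>

lemma sine_transform_over_k_decay:
  assumes \<phi>: "bump \<phi>"
  shows "\<exists>C. \<forall>k\<ge>0. \<bar>sine_transform \<phi> k / k\<bar> \<le> C / (1 + k)"
proof -
  obtain R where R: "R \<ge> 0" "\<And>y. \<bar>y\<bar> > R \<Longrightarrow> \<phi> y = 0" using \<phi> unfolding bump_def by auto
  let ?N = "\<integral>y. \<bar>\<phi> y\<bar> \<partial>lborel"
  have N: "?N \<ge> 0" by simp
  have small: "\<bar>sine_transform \<phi> k\<bar> \<le> k * R * ?N" if k: "k \<ge> 0" for k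
  proof -
    have le: "\<bar>\<phi> y * sin (k * y)\<bar> \<le> k * R * \<bar>\<phi> y\<bar>" for y
    proof (cases "\<bar>y\<bar> > R")
      case False
      have "\<bar>sin (k * y)\<bar> \<le> \<bar>k * y\<bar>" by (rule abs_sin_x_le_abs_x)
      also have "\<dots> \<le> k * R" using k False by (simp add: abs_mult mult_left_mono)
      finally have "\<bar>\<phi> y\<bar> * \<bar>sin (k * y)\<bar> \<le> \<bar>\<phi> y\<bar> * (k * R)" by (rule mult_left_mono) simp
      then show ?thesis by (simp add: abs_mult mult_ac)
    qed (simp add: R)
    have "\<bar>sine_transform \<phi> k\<bar> \<le> (\<integral>y. k * R * \<bar>\<phi> y\<bar> \<partial>lborel)"
      unfolding sine_transform_def
      by (rule order_trans[OF integral_abs_bound integral_mono])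
        (use le sine_transform_integrable[OF bump_integrable[OF \<phi>]] bump_integrable[OF \<phi>] in auto)
    then show ?thesis by simp
  qed
  have "\<bar>sine_transform \<phi> k / k\<bar> \<le> (R * ?N + ?N) / (1 + k)" if k: "k \<ge> 0" for k
  proof (cases "k = 0")
    case False
    with k have k: "k > 0" by simp
    have "\<bar>sine_transform \<phi> k\<bar> * k \<le> ?N * k"
      using k by (intro mult_right_mono transform_le(1)[OF bump_integrable[OF \<phi>]]) simp
    with small[of k] k have "\<bar>sine_transform \<phi> k\<bar> + \<bar>sine_transform \<phi> k\<bar> * k \<le> k * R * ?N + ?N * k"
      by linarith
    then have "\<bar>sine_transform \<phi> k\<bar> * (1 + k) \<le> (R * ?N + ?N) * k"
      by (simp add: algebra_simps)
    then show ?thesis using k by (simp add: divide_simps mult_ac)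
  qed (use N R in simp)
  then show ?thesis by blast
qed

text \<open>Translation by \<open>t\<close> rotates the pair of transforms through the angle t k;
  this is transport seen on the frequency side.\<close>

lemma transform_shift:
  assumes \<phi>: "integrable lborel \<phi>"
  shows "sine_transform (\<lambda>y. \<phi> (y - t)) k = sin (t * k) * cosine_transform \<phi> k + cos (t * k) * sine_transform \<phi> k"
    and "cosine_transform (\<lambda>y. \<phi> (y - t)) k = cos (t * k) * cosine_transform \<phi> k - sin (t * k) * sine_transform \<phi> k"
proof -
  note i = sine_transform_integrable[OF \<phi>, of k]
  have "sine_transform (\<lambda>y. \<phi> (y - t)) k = (\<integral>y. \<phi> y * sin (k * (t + 1 * y)) \<partial>lborel)"
    unfolding sine_transform_def
    by (subst lborel_integral_real_affine[of 1 _ t]) auto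
  also have "\<dots> = (\<integral>y. sin (t * k) * (\<phi> y * cos (k * y)) + cos (t * k) * (\<phi> y * sin (k * y)) \<partial>lborel)"
    by (intro Bochner_Integration.integral_cong refl) (simp add: distrib_left sin_add algebra_simps)
  finally show "sine_transform (\<lambda>y. \<phi> (y - t)) k = sin (t * k) * cosine_transform \<phi> k + cos (t * k) * sine_transform \<phi> k"
    using i by (simp add: sine_transform_def cosine_transform_def)
  have "cosine_transform (\<lambda>y. \<phi> (y - t)) k = (\<integral>y. \<phi> y * cos (k * (t + 1 * y)) \<partial>lborel)"
    unfolding cosine_transform_def
    by (subst lborel_integral_real_affine[of 1 _ t]) auto
  also have "\<dots> = (\<integral>y. cos (t * k) * (\<phi> y * cos (k * y)) - sin (t * k) * (\<phi> y * sin (k * y)) \<partial>lborel)"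
    by (intro Bochner_Integration.integral_cong refl) (simp add: distrib_left cos_add algebra_simps)
  finally show "cosine_transform (\<lambda>y. \<phi> (y - t)) k = cos (t * k) * cosine_transform \<phi> k - sin (t * k) * sine_transform \<phi> k"
    using i by (simp add: sine_transform_def cosine_transform_def)
qed

lemma transform_reflect:
  "sine_transform (\<lambda>y. \<phi> (- y)) k = - sine_transform \<phi> k"
  "cosine_transform (\<lambda>y. \<phi> (- y)) k = cosine_transform \<phi> k"
  unfolding sine_transform_def cosine_transform_def
  by (subst lborel_integral_real_affine[of "-1" _ 0]; simp)+

section \<open>Test functions and local integrability on the half-line\<close>

lemma test_function_deriv:
  fixes \<phi> :: "real \<Rightarrow> real"
  assumes "test_function_on S \<phi>"
  shows "test_function_on S (deriv \<phi>)"
proof -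
  from assms obtain K where K: "smooth \<phi>" "compact K" "K \<subseteq> S" "\<And>x. x \<notin> K \<Longrightarrow> \<phi> x = 0"
    unfolding test_function_on_def by auto
  have "deriv \<phi> x = 0" if "x \<notin> K" for x
  proof -
    have "open (- K)" using K(2) by (simp add: compact_imp_closed open_Compl)
    then have "((\<lambda>x. 0) has_real_derivative deriv \<phi> x) (at x)"
      by (rule has_field_derivative_transform_within_open[OF smooth_real_has_derivative(1)[OF K(1)]])
        (use K(4) that in auto)
    then show ?thesis using DERIV_unique DERIV_const by blast
  qed
  then show ?thesis
    unfolding test_function_on_def using K smooth_real_has_derivative(2) by blast
qed

lemma test_function_halfline_eq_0: "test_function_on {0<..} \<phi> \<Longrightarrow> y \<le> (0::real) \<Longrightarrow> \<phi> y = 0"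
  unfolding test_function_on_def by (metis greaterThan_iff leD subsetD)

text \<open>The compact intervals from 1 / (n + 1) to n + 1 exhaust r > 0, and integrability on each
  of them includes measurability.\<close>

lemma locally_integrable_measurable:
  assumes "locally_integrable_on v {0::real<..}"
  shows "(\<lambda>r. indicator {0<..} r * v r) \<in> borel_measurable borel"
proof (rule borel_measurable_LIMSEQ_metric)
  fix n
  have "0 < 1 / real (Suc n)" by simp
  then have "{1 / real (Suc n)..real (Suc n)} \<subseteq> {0<..}"
    by (metis atLeastAtMost_iff greaterThan_iff less_le_trans subsetI)
  then have "set_integrable lborel {1 / real (Suc n)..real (Suc n)} v"
    using assms unfolding locally_integrable_on_def by blast
  from borel_measurable_integrable[OF this[unfolded set_integrable_def]]
  show "(\<lambda>r. indicator {1 / real (Suc n)..real (Suc n)} r * v r) \<in> borel_measurable borel" by simp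
next
  fix r :: real
  show "(\<lambda>n. indicator {1 / real (Suc n)..real (Suc n)} r * v r) \<longlonglongrightarrow> indicator {0<..} r * v r"
  proof (cases "r > 0")
    case True
    have "eventually (\<lambda>n. r \<le> real (Suc n)) sequentially" "eventually (\<lambda>n. 1 / real (Suc n) < r) sequentially"
      using True by real_asymp+
    then have "eventually (\<lambda>n. indicator {1 / real (Suc n)..real (Suc n)} r * v r = indicator {0<..} r * v r) sequentially"
      by eventually_elim (use True in \<open>auto simp: indicator_def\<close>)
    then show ?thesis by (rule tendsto_eventually)
  next
    case False
    have "indicator {1 / real (Suc n)..real (Suc n)} r = (0::real)" for n
    proof -
      have "0 < 1 / real (Suc n)" by simp
      with False have "r < 1 / real (Suc n)" by linarith
      then show ?thesis by (simp add: indicator_def)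
    qed
    then show ?thesis using False by simp
  qed
qed

lemma locally_integrable_bump:
  fixes G :: "real \<Rightarrow> real"
  assumes G: "\<And>K. compact K \<Longrightarrow> set_integrable lborel K G" and \<phi>: "bump \<phi>"
  shows "integrable lborel (\<lambda>s. G s * \<phi> s)"
proof -
  obtain R where R: "R \<ge> 0" "\<And>y. \<bar>y\<bar> > R \<Longrightarrow> \<phi> y = 0" using \<phi> unfolding bump_def by auto
  obtain B where B: "\<And>y. \<bar>\<phi> y\<bar> \<le> B" using bump_bounded[OF \<phi>] by auto
  note [measurable] = bump_measurable[OF \<phi>]
  have i: "integrable lborel (\<lambda>s. indicator {-R..R} s *\<^sub>R G s)"
    using G[of "{-R..R}"] unfolding set_integrable_def by simp
  note [measurable] = borel_measurable_integrable[OF i]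
  have "integrable lborel (\<lambda>s. (indicator {-R..R} s *\<^sub>R G s) * \<phi> s)"
  proof (rule Bochner_Integration.integrable_bound)
    show "integrable lborel (\<lambda>s. B * (indicator {-R..R} s *\<^sub>R G s))" by (rule integrable_mult_right[OF i])
    show "AE s in lborel. norm ((indicator {-R..R} s *\<^sub>R G s) * \<phi> s) \<le> norm (B * (indicator {-R..R} s *\<^sub>R G s))"
    proof (rule AE_I2)
      fix s
      have "\<bar>\<phi> s\<bar> \<le> \<bar>B\<bar>" using B[of s] by linarith
      from mult_right_mono[OF this, of "\<bar>indicator {-R..R} s *\<^sub>R G s\<bar>"]
      show "norm ((indicator {-R..R} s *\<^sub>R G s) * \<phi> s) \<le> norm (B * (indicator {-R..R} s *\<^sub>R G s))"
        by (simp add: abs_mult mult_ac)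
    qed
  qed measurable
  moreover have "(indicator {-R..R} s *\<^sub>R G s) * \<phi> s = G s * \<phi> s" for s
    using R(2)[of s] by (cases "\<bar>s\<bar> > R") (auto simp: indicator_def)
  ultimately show ?thesis by (simp only:)
qed

text \<open>Cutting \<open>v\<close> down to the compact support of \<phi> makes it integrable on
  every compact set, also on those that reach 0.\<close>

lemma locally_integrable_test:
  assumes v: "locally_integrable_on v {0::real<..}" and \<phi>: "test_function_on {0<..} \<phi>"
  shows "integrable lborel (\<lambda>r. v r * \<phi> r)"
proof -
  from \<phi> obtain K where K: "compact K" "K \<subseteq> {0<..}" "\<And>x. x \<notin> K \<Longrightarrow> \<phi> x = 0"
    unfolding test_function_on_def by auto
  have "set_integrable lborel Q (\<lambda>r. indicator K r * v r)" if "compact Q" for Q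
  proof -
    have e: "indicator Q r * (indicator K r * v r) = indicator (Q \<inter> K) r * v r" for r :: real
      by (simp add: indicator_inter_arith mult.assoc)
    have "compact (Q \<inter> K)" "Q \<inter> K \<subseteq> {0<..}" using that K by auto
    then have "set_integrable lborel (Q \<inter> K) v" using v unfolding locally_integrable_on_def by blast
    then show ?thesis unfolding set_integrable_def real_scaleR_def e .
  qed
  from locally_integrable_bump[OF this test_function_bump[OF \<phi>]]
  have "integrable lborel (\<lambda>r. indicator K r * v r * \<phi> r)" .
  moreover have "indicator K r * v r * \<phi> r = v r * \<phi> r" for r
    using K(3)[of r] by (cases "r \<in> K") auto
  ultimately show ?thesis by (simp only:)
qed

section \<open>Inequalities for m-th powers\<close>

lemma powr_abs_add_le:
  fixes a b m :: real
  assumes "m \<ge> 0"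
  shows "\<bar>a + b\<bar> powr m \<le> 2 powr m * (\<bar>a\<bar> powr m + \<bar>b\<bar> powr m)"
proof -
  define c where "c = max \<bar>a\<bar> \<bar>b\<bar>"
  have "\<bar>a + b\<bar> powr m \<le> (2 * c) powr m"
    using assms by (intro powr_mono2) (auto simp: c_def)
  also have "\<dots> = 2 powr m * c powr m" by (simp add: powr_mult c_def)
  also have "c powr m \<le> \<bar>a\<bar> powr m + \<bar>b\<bar> powr m" by (auto simp: c_def max_def)
  finally show ?thesis by (simp add: mult_left_mono)
qed

text \<open>A mean is at most the larger absolute value, so halving removes the factor
  \<open>2 powr m\<close>.\<close>

lemma powr_abs_half_add_le:
  fixes a b m :: real
  assumes "m \<ge> 0"
  shows "\<bar>(a + b) / 2\<bar> powr m \<le> \<bar>a\<bar> powr m + \<bar>b\<bar> powr m"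
proof -
  define c where "c = max \<bar>a\<bar> \<bar>b\<bar>"
  have "\<bar>(a + b) / 2\<bar> powr m \<le> c powr m"
    using assms by (intro powr_mono2) (auto simp: c_def)
  also have "c powr m \<le> \<bar>a\<bar> powr m + \<bar>b\<bar> powr m" by (auto simp: c_def max_def)
  finally show ?thesis .
qed

text \<open>For m \<ge> 1 one has |G| \<le> 1 + |G|^m, and the constant 1 is integrable on a compact
  set.\<close>

lemma powr_locally_integrable:
  fixes G :: "real \<Rightarrow> real"
  assumes [measurable]: "G \<in> borel_measurable borel" and m: "m \<ge> 1"
    and fin: "(\<integral>\<^sup>+s. ennreal (\<bar>G s\<bar> powr m) \<partial>lborel) < \<infinity>" and K: "compact K"
  shows "set_integrable lborel K G"
  unfolding set_integrable_def
proof (rule Bochner_Integration.integrable_bound)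
  have i: "integrable lborel (\<lambda>s. \<bar>G s\<bar> powr m)"
    by (rule integrableI_bounded) (use fin in auto)
  have [measurable]: "K \<in> sets borel" using borel_compact[OF K] .
  have "integrable lborel (indicat_real K)"
    using emeasure_compact_finite[OF K] by (intro integrable_real_indicator) auto
  with i show "integrable lborel (\<lambda>s. indicat_real K s + \<bar>G s\<bar> powr m)" by simp
  show "(\<lambda>s. indicat_real K s *\<^sub>R G s) \<in> borel_measurable lborel" by measurable
  show "AE s in lborel. norm (indicat_real K s *\<^sub>R G s) \<le> norm (indicat_real K s + \<bar>G s\<bar> powr m)"
  proof (rule AE_I2)
    fix s
    have "\<bar>G s\<bar> \<le> 1 + \<bar>G s\<bar> powr m"
    proof (cases "\<bar>G s\<bar> \<le> 1")
      case False
      then have "\<bar>G s\<bar> powr 1 \<le> \<bar>G s\<bar> powr m" using m by (intro powr_mono) auto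
      then show ?thesis using False by simp
    qed (simp add: add_increasing2)
    then show "norm (indicat_real K s *\<^sub>R G s) \<le> norm (indicat_real K s + \<bar>G s\<bar> powr m)"
      by (auto simp: indicator_def)
  qed
qed

lemma bump_add: "bump \<phi> \<Longrightarrow> bump \<psi> \<Longrightarrow> bump (\<lambda>y. \<phi> y + \<psi> y)"
proof -
  assume a: "bump \<phi>" "bump \<psi>"
  obtain R where R: "R \<ge> 0" "\<And>y. \<bar>y\<bar> > R \<Longrightarrow> \<phi> y = 0" using a unfolding bump_def by auto
  obtain Q where Q: "Q \<ge> 0" "\<And>y. \<bar>y\<bar> > Q \<Longrightarrow> \<psi> y = 0" using a unfolding bump_def by auto
  have "smooth (\<lambda>y. \<phi> y + \<psi> y)" using a unfolding bump_def by (auto intro: smooth_real_add)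
  then show ?thesis unfolding bump_def using R Q by (intro conjI exI[of _ "R + Q"]) auto
qed

lemma transform_add:
  assumes "bump \<phi>" "bump \<psi>"
  shows "sine_transform (\<lambda>y. \<phi> y + \<psi> y) k = sine_transform \<phi> k + sine_transform \<psi> k"
    and "cosine_transform (\<lambda>y. \<phi> y + \<psi> y) k = cosine_transform \<phi> k + cosine_transform \<psi> k"
  unfolding sine_transform_def cosine_transform_def
  using sine_transform_integrable[OF bump_integrable[OF assms(1)], of k]
    sine_transform_integrable[OF bump_integrable[OF assms(2)], of k]
  by (simp_all add: distrib_right)

lemma transform_diff:
  assumes "bump \<phi>" "bump \<psi>"
  shows "sine_transform (\<lambda>y. \<phi> y - \<psi> y) k = sine_transform \<phi> k - sine_transform \<psi> k"
    and "cosine_transform (\<lambda>y. \<phi> y - \<psi> y) k = cosine_transform \<phi> k - cosine_transform \<psi> k"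
  unfolding sine_transform_def cosine_transform_def
  using sine_transform_integrable[OF bump_integrable[OF assms(1)], of k]
    sine_transform_integrable[OF bump_integrable[OF assms(2)], of k]
  by (simp_all add: left_diff_distrib)

text \<open>Multiplying by a cutoff that vanishes near \<open>0\<close> costs a bounded amount of total variation,
  although the derivative of the cutoff is unbounded.\<close>

lemma bump_cutoff_variation:
  assumes \<phi>: "bump \<phi>" and B: "\<And>y. \<bar>\<phi> y\<bar> \<le> B"
  shows "(\<integral>y. \<bar>deriv (\<lambda>y. \<phi> y * cutoff n y) y\<bar> \<partial>lborel) \<le> L1_norm (deriv \<phi>) + B"
    and "(\<integral>y. \<bar>\<phi> y * cutoff n y\<bar> \<partial>lborel) \<le> L1_norm \<phi>"
proof -
  note d = bump_deriv[OF \<phi>]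
  note dc = smooth_real_has_derivative[OF smooth_cutoff[of n]]
  obtain R where R: "R \<ge> 0" "\<And>y. \<bar>y\<bar> > R \<Longrightarrow> \<phi> y = 0" using \<phi> unfolding bump_def by auto
  have b: "bump (\<lambda>y. \<phi> y * cutoff n y)" by (rule bump_mult[OF \<phi> smooth_cutoff])
  have B0: "B \<ge> 0" using B[of 0] by linarith
  have D: "deriv (\<lambda>y. \<phi> y * cutoff n y) y = deriv \<phi> y * cutoff n y + deriv (cutoff n) y * \<phi> y" for y
    by (rule DERIV_imp_deriv[OF DERIV_mult[OF d(2) dc(1)]])
  have cc: "continuous_on UNIV (deriv (cutoff n))"
    by (intro continuous_at_imp_continuous_on ballI DERIV_isCont[OF smooth_real_has_derivative(1)[OF dc(2)]])
  \<comment> \<open>As \<open>deriv (cutoff n)\<close> is nonnegative, its L1 norm on an interval is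
    an increment of \<open>cutoff n\<close>, at most 1 for every n; the cutoff therefore costs just
    the bound \<open>B\<close> of \<phi>.\<close>
  have FTC: "(\<integral>y. deriv (cutoff n) y * indicator {-R..R} y \<partial>lborel) = cutoff n R - cutoff n (- R)"
    by (rule integral_FTC_Icc_real) (use dc cc R in \<open>auto simp: continuous_on_eq_continuous_at\<close>)
  have iI: "integrable lborel (\<lambda>y. deriv (cutoff n) y * indicator {-R..R} y)"
    using borel_integrable_atLeastAtMost'[of "-R" R "deriv (cutoff n)"] continuous_on_subset[OF cc]
    unfolding set_integrable_def by (simp add: mult.commute)
  have le: "\<bar>deriv (\<lambda>y. \<phi> y * cutoff n y) y\<bar> \<le> \<bar>deriv \<phi> y\<bar> + B * (deriv (cutoff n) y * indicator {-R..R} y)" for y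
  proof -
    have "\<bar>deriv \<phi> y * cutoff n y\<bar> \<le> \<bar>deriv \<phi> y\<bar> * 1"
      unfolding abs_mult using cutoff_bounds[of n y] by (intro mult_left_mono) auto
    moreover have "\<bar>deriv (cutoff n) y * \<phi> y\<bar> \<le> B * (deriv (cutoff n) y * indicator {-R..R} y)"
    proof (cases "\<bar>y\<bar> > R")
      case False
      then have "y \<in> {-R..R}" by auto
      then show ?thesis
        using mult_left_mono[OF B[of y] cutoff_deriv_nonneg[of n y]] cutoff_deriv_nonneg[of n y]
        by (simp add: abs_mult mult.commute)
    qed (use R B0 cutoff_deriv_nonneg in simp)
    ultimately show ?thesis unfolding D by linarith
  qed
  have "(\<integral>y. \<bar>deriv (\<lambda>y. \<phi> y * cutoff n y) y\<bar> \<partial>lborel)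
     \<le> (\<integral>y. \<bar>deriv \<phi> y\<bar> + B * (deriv (cutoff n) y * indicator {-R..R} y) \<partial>lborel)"
    by (rule integral_mono)
      (use le bump_integrable[OF bump_deriv(1)[OF b]] bump_integrable[OF d(1)] iI in auto)
  also have "\<dots> = L1_norm (deriv \<phi>) + B * (cutoff n R - cutoff n (- R))"
    using bump_integrable[OF d(1)] iI FTC by simp
  also have "B * (cutoff n R - cutoff n (- R)) \<le> B * 1"
    using cutoff_bounds[of n R] cutoff_bounds[of n "- R"] B0 by (intro mult_left_mono) auto
  finally show "(\<integral>y. \<bar>deriv (\<lambda>y. \<phi> y * cutoff n y) y\<bar> \<partial>lborel) \<le> L1_norm (deriv \<phi>) + B" by simp
  show "(\<integral>y. \<bar>\<phi> y * cutoff n y\<bar> \<partial>lborel) \<le> L1_norm \<phi>"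
  proof (rule integral_mono)
    show "\<bar>\<phi> y * cutoff n y\<bar> \<le> \<bar>\<phi> y\<bar>" for y
      using mult_left_mono[of "cutoff n y" 1 "\<bar>\<phi> y\<bar>"] cutoff_bounds[of n y] by (simp add: abs_mult)
  qed (use bump_integrable[OF b] bump_integrable[OF \<phi>] in auto)
qed

lemma test_function_cutoff:
  assumes "bump \<phi>"
  shows "test_function_on {0<..} (\<lambda>y. \<phi> y * cutoff n y)"
proof -
  obtain R where R: "R \<ge> 0" "\<And>y. \<bar>y\<bar> > R \<Longrightarrow> \<phi> y = 0" using assms unfolding bump_def by auto
  have "smooth (\<lambda>y. \<phi> y * cutoff n y)"
    using assms smooth_cutoff unfolding bump_def by (auto intro: smooth_real_mult)
  moreover have "0 < 1 / (real (Suc n))\<^sup>2" by simp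
  then have "{1 / (real (Suc n))\<^sup>2..R} \<subseteq> {0<..}"
    by (metis atLeastAtMost_iff greaterThan_iff less_le_trans subsetI)
  moreover have "\<phi> y * cutoff n y = 0" if "y \<notin> {1 / (real (Suc n))\<^sup>2..R}" for y
    using that R(2)[of y] cutoff_eq_0[of y n] by force
  ultimately show ?thesis unfolding test_function_on_def
    by (intro conjI exI[of _ "{1 / (real (Suc n))\<^sup>2..R}"]) auto
qed

section \<open>Transport of the one-dimensional wave\<close>

text \<open>A superposition of oscillations of frequency \<rho>. In the application \<open>M\<close>
  is Lebesgue measure on R^3, \<rho> is the norm, and \<open>A\<close>, \<open>B\<close> are, up to
  a constant, the real parts of the Fourier transforms of the data, the second divided by |xi|. The
  weight 1 / (1 + \<rho>) matches the decay of the transforms of a test function.\<close>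

locale wave_representation =
  fixes M :: "'a measure" and \<rho> A B :: "'a \<Rightarrow> real" and u :: "real \<Rightarrow> real \<Rightarrow> real"
  assumes rho_measurable [measurable]: "\<rho> \<in> borel_measurable M"
    and rho_nonneg: "\<And>x. \<rho> x \<ge> 0"
    and rho_pos: "AE x in M. \<rho> x > 0"
    and A_int: "integrable M (\<lambda>x. A x / (1 + \<rho> x))"
    and B_int: "integrable M (\<lambda>x. B x / (1 + \<rho> x))"
    and u_loc: "\<And>t. locally_integrable_on (u t) {0<..}"
    and u_eq: "\<And>t \<phi>. test_function_on {0<..} \<phi> \<Longrightarrow> (\<integral>r. u t r * \<phi> r \<partial>lborel)
        = (\<integral>x. (cos (t * \<rho> x) * A x + sin (t * \<rho> x) * B x) * (sine_transform \<phi> (\<rho> x) / \<rho> x) \<partial>M)"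
begin

lemma AB_measurable [measurable]: "A \<in> borel_measurable M" "B \<in> borel_measurable M"
proof -
  have 1: "1 + \<rho> x \<noteq> 0" for x using rho_nonneg[of x] by linarith
  note [measurable] = borel_measurable_integrable[OF A_int] borel_measurable_integrable[OF B_int]
  have "(\<lambda>x. A x / (1 + \<rho> x) * (1 + \<rho> x)) \<in> borel_measurable M" by measurable
  then show "A \<in> borel_measurable M" using 1 by simp
  have "(\<lambda>x. B x / (1 + \<rho> x) * (1 + \<rho> x)) \<in> borel_measurable M" by measurable
  then show "B \<in> borel_measurable M" using 1 by simp
qed

definition dominator :: "'a \<Rightarrow> real" where
  "dominator x = \<bar>A x\<bar> / (1 + \<rho> x) + \<bar>B x\<bar> / (1 + \<rho> x)"

lemma dominator_integrable: "integrable M (\<lambda>x. K * dominator x)"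
proof -
  have e: "\<bar>A x / (1 + \<rho> x)\<bar> = \<bar>A x\<bar> / (1 + \<rho> x)" "\<bar>B x / (1 + \<rho> x)\<bar> = \<bar>B x\<bar> / (1 + \<rho> x)" for x
    using rho_nonneg[of x] by (simp_all add: abs_divide)
  have "integrable M (\<lambda>x. \<bar>A x\<bar> / (1 + \<rho> x))" "integrable M (\<lambda>x. \<bar>B x\<bar> / (1 + \<rho> x))"
    using integrable_abs[OF A_int] integrable_abs[OF B_int] by (simp_all only: e)
  then show ?thesis unfolding dominator_def by (intro integrable_mult_right Bochner_Integration.integrable_add)
qed

lemma rotation_le:
  assumes "\<bar>f\<bar> \<le> K / (1 + \<rho> x)"
  shows "\<bar>(cos s * A x + sin s * B x) * f\<bar> \<le> K * dominator x"
    "\<bar>(cos s * B x - sin s * A x) * f\<bar> \<le> K * dominator x"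
proof -
  have c: "\<bar>cos s * a\<bar> \<le> \<bar>a\<bar>" "\<bar>sin s * a\<bar> \<le> \<bar>a\<bar>" for a :: real
    using mult_right_mono[OF abs_cos_le_one, of "\<bar>a\<bar>" s] mult_right_mono[OF abs_sin_le_one, of "\<bar>a\<bar>" s]
    by (auto simp: abs_mult)
  have 1: "\<bar>cos s * A x + sin s * B x\<bar> \<le> \<bar>A x\<bar> + \<bar>B x\<bar>"
    using c(1)[of "A x"] c(2)[of "B x"] by linarith
  have 2: "\<bar>cos s * B x - sin s * A x\<bar> \<le> \<bar>A x\<bar> + \<bar>B x\<bar>"
    using c(1)[of "B x"] c(2)[of "A x"] by linarith
  have 3: "K * dominator x = (\<bar>A x\<bar> + \<bar>B x\<bar>) * (K / (1 + \<rho> x))"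
    by (simp add: dominator_def distrib_left distrib_right mult.commute)
  show "\<bar>(cos s * A x + sin s * B x) * f\<bar> \<le> K * dominator x"
    unfolding 3 abs_mult by (rule mult_mono[OF 1 assms]) auto
  show "\<bar>(cos s * B x - sin s * A x) * f\<bar> \<le> K * dominator x"
    unfolding 3 abs_mult by (rule mult_mono[OF 2 assms]) auto
qed

text \<open>The state (A, B) at time \<open>t\<close>: every frequency turns the pair through the
  angle t \<rho>, and the t-derivative of \<open>rotated_A t x\<close> is
  \<open>\<rho> x * rotated_B t x\<close>.\<close>

abbreviation rotated_A :: "real \<Rightarrow> 'a \<Rightarrow> real" where
  "rotated_A t x \<equiv> cos (t * \<rho> x) * A x + sin (t * \<rho> x) * B x"

abbreviation rotated_B :: "real \<Rightarrow> 'a \<Rightarrow> real" where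
  "rotated_B t x \<equiv> cos (t * \<rho> x) * B x - sin (t * \<rho> x) * A x"

text \<open>The parts of \<open>wave_functional\<close> below that come from \<open>\<partial>\<^sub>r u\<close> and from \<open>\<partial>\<^sub>t u\<close>.\<close>

definition functional_r :: "real \<Rightarrow> (real \<Rightarrow> real) \<Rightarrow> real" where
  "functional_r t \<phi> = (\<integral>x. rotated_A t x * cosine_transform \<phi> (\<rho> x) \<partial>M)"

definition functional_t :: "real \<Rightarrow> (real \<Rightarrow> real) \<Rightarrow> real" where
  "functional_t t \<phi> = (\<integral>x. rotated_B t x * sine_transform \<phi> (\<rho> x) \<partial>M)"

text \<open>The r-derivative extended evenly plus the t-derivative extended oddly, paired with
  \<phi>. The spectral formula gives it a meaning for every \<phi> on the line, including those that
  do not vanish at 0.\<close>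

definition wave_functional :: "real \<Rightarrow> (real \<Rightarrow> real) \<Rightarrow> real" where
  "wave_functional t \<phi> = functional_r t \<phi> + functional_t t \<phi>"

lemma functional_integrable:
  assumes "bump \<phi>"
  shows "integrable M (\<lambda>x. rotated_A t x * cosine_transform \<phi> (\<rho> x))"
    "integrable M (\<lambda>x. rotated_B t x * sine_transform \<phi> (\<rho> x))"
proof -
  note [measurable] = bump_measurable[OF assms]
  let ?K = "L1_norm \<phi> + L1_norm (deriv \<phi>)"
  show "integrable M (\<lambda>x. rotated_A t x * cosine_transform \<phi> (\<rho> x))"
    by (rule Bochner_Integration.integrable_bound[OF dominator_integrable[of ?K]])
      (auto intro!: AE_I2 order_trans[OF rotation_le(1)[OF transform_decay(2)[OF assms rho_nonneg]]])
  show "integrable M (\<lambda>x. rotated_B t x * sine_transform \<phi> (\<rho> x))"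
    by (rule Bochner_Integration.integrable_bound[OF dominator_integrable[of ?K]])
      (auto intro!: AE_I2 order_trans[OF rotation_le(2)[OF transform_decay(1)[OF assms rho_nonneg]]])
qed

text \<open>The sine transform of \<open>deriv \<phi>\<close> is - k times the cosine transform, and
  the division by \<rho> removes the factor k.\<close>

lemma functional_r_eq:
  assumes \<phi>: "test_function_on {0<..} \<phi>"
  shows "(\<integral>r. u t r * deriv \<phi> r \<partial>lborel) = - functional_r t \<phi>"
proof -
  note b = test_function_bump[OF \<phi>]
  note [measurable] = bump_measurable[OF b] bump_measurable[OF bump_deriv(1)[OF b]]
  have "(\<integral>r. u t r * deriv \<phi> r \<partial>lborel)
     = (\<integral>x. rotated_A t x * (sine_transform (deriv \<phi>) (\<rho> x) / \<rho> x) \<partial>M)"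
    by (rule u_eq[OF test_function_deriv[OF \<phi>]])
  also have "\<dots> = (\<integral>x. - (rotated_A t x * cosine_transform \<phi> (\<rho> x)) \<partial>M)"
  proof (rule integral_cong_AE)
    show "AE x in M. rotated_A t x * (sine_transform (deriv \<phi>) (\<rho> x) / \<rho> x)
       = - (rotated_A t x * cosine_transform \<phi> (\<rho> x))"
      using rho_pos by eventually_elim (simp add: transform_deriv[OF b])
  qed measurable
  finally show ?thesis by (simp add: functional_r_def)
qed

text \<open>Differentiating the rotation in time produces a factor \<rho> that cancels the division,
  and the remaining integrand is dominated uniformly in time.\<close>

lemma functional_t_eq:
  assumes \<phi>: "test_function_on {0<..} \<phi>"
  shows "((\<lambda>\<tau>. \<integral>r. u \<tau> r * \<phi> r \<partial>lborel) has_real_derivative functional_t t \<phi>) (at t)"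
proof -
  note b = test_function_bump[OF \<phi>]
  note [measurable] = bump_measurable[OF b]
  obtain C where C: "\<And>k. k \<ge> 0 \<Longrightarrow> \<bar>sine_transform \<phi> k / k\<bar> \<le> C / (1 + k)"
    using sine_transform_over_k_decay[OF b] by auto
  let ?K = "L1_norm \<phi> + L1_norm (deriv \<phi>)"
  let ?f = "\<lambda>t x. rotated_A t x * (sine_transform \<phi> (\<rho> x) / \<rho> x)"
  let ?f' = "\<lambda>t x. rotated_B t x * sine_transform \<phi> (\<rho> x)"
  have "((\<lambda>t. \<integral>x. ?f t x \<partial>M) has_vector_derivative (\<integral>x. ?f' t x \<partial>M)) (at t)"
  proof (rule has_vector_derivative_integral(2)[where \<delta> = 1 and B = "\<lambda>x. ?K * dominator x"])
    show "integrable M (?f t)" for t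
    proof (rule Bochner_Integration.integrable_bound[OF dominator_integrable[of C]])
      show "AE x in M. norm (?f t x) \<le> norm (C * dominator x)"
      proof (rule AE_I2)
        fix x
        show "norm (?f t x) \<le> norm (C * dominator x)"
          unfolding real_norm_def
          by (rule order_trans[OF rotation_le(1)[OF C[OF rho_nonneg]] abs_ge_self])
      qed
    qed measurable
    show "((\<lambda>t. ?f t x) has_vector_derivative ?f' t x) (at t)" for t x
    \<comment> \<open>Where \<rho> vanishes, both the quotient and the sine transform are 0.\<close>
    proof (cases "\<rho> x = 0")
      case True
      then show ?thesis by (simp add: sine_transform_def)
    next
      case False
      then show ?thesis
        unfolding has_real_derivative_iff_has_vector_derivative[symmetric]
        by (auto intro!: derivative_eq_intros simp: field_simps)
    qed
    show "norm (?f' t x) \<le> ?K * dominator x" for t x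
      unfolding real_norm_def by (rule rotation_le(2)[OF transform_decay(1)[OF b rho_nonneg]])
    show "integrable M (\<lambda>x. ?K * dominator x)" by (rule dominator_integrable)
  qed simp
  then show ?thesis
    unfolding u_eq[OF \<phi>] functional_t_def has_real_derivative_iff_has_vector_derivative .
qed

text \<open>Parity of the cosine and the sine transform; this is the sense in which the r-derivative
  is extended evenly and the t-derivative oddly.\<close>

lemma functional_reflect:
  "functional_r t (\<lambda>y. \<phi> (- y)) = functional_r t \<phi>"
  "functional_t t (\<lambda>y. \<phi> (- y)) = - functional_t t \<phi>"
  unfolding functional_r_def functional_t_def transform_reflect by simp_all

lemma functional_add:
  assumes "bump \<phi>" "bump \<psi>"
  shows "wave_functional t (\<lambda>y. \<phi> y + \<psi> y) = wave_functional t \<phi> + wave_functional t \<psi>"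
  unfolding wave_functional_def functional_r_def functional_t_def transform_add[OF assms] distrib_left
  by (simp add: Bochner_Integration.integral_add[OF functional_integrable(1)[OF assms(1)] functional_integrable(1)[OF assms(2)]]
      Bochner_Integration.integral_add[OF functional_integrable(2)[OF assms(1)] functional_integrable(2)[OF assms(2)]])

lemma wave_functional_alt:
  assumes "bump \<phi>"
  shows "wave_functional t \<phi> = (\<integral>x. A x * (cos (t * \<rho> x) * cosine_transform \<phi> (\<rho> x) - sin (t * \<rho> x) * sine_transform \<phi> (\<rho> x))
     + B x * (sin (t * \<rho> x) * cosine_transform \<phi> (\<rho> x) + cos (t * \<rho> x) * sine_transform \<phi> (\<rho> x)) \<partial>M)"
  unfolding wave_functional_def functional_r_def functional_t_def
  by (subst Bochner_Integration.integral_add[OF functional_integrable[OF assms], symmetric])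
    (auto intro!: Bochner_Integration.integral_cong simp: algebra_simps)

text \<open>Translating \<phi> and letting time pass both rotate through angles proportional to
  \<rho>, and in the sum of the two functionals these angles add. The two parts taken separately are
  not transported.\<close>

lemma wave_functional_shift:
  assumes "bump \<phi>"
  shows "wave_functional t (\<lambda>y. \<phi> (y - s)) = wave_functional (t + s) \<phi>"
proof -
  have b: "bump (\<lambda>y. \<phi> (y - s))" using bump_affine[OF assms, of 1 "- s"] by simp
  show ?thesis
    unfolding wave_functional_alt[OF b] wave_functional_alt[OF assms] transform_shift[OF bump_integrable[OF assms]]
    by (intro Bochner_Integration.integral_cong refl)
      (simp add: distrib_right[of t s] cos_add sin_add algebra_simps)
qed

text \<open>L1 convergence gives pointwise convergence of the transforms, and \<open>K\<close> gives
  them the common decay K / (1 + \<rho>) for domination. The derivatives themselves need not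
  converge.\<close>

lemma wave_functional_tendsto:
  assumes b: "bump \<phi>" "\<And>n. bump (\<psi> n)"
    and lim: "(\<lambda>n. \<integral>y. \<bar>\<psi> n y - \<phi> y\<bar> \<partial>lborel) \<longlonglongrightarrow> 0"
    and bd: "\<And>n. L1_norm (\<psi> n) + L1_norm (deriv (\<psi> n)) \<le> K"
  shows "(\<lambda>n. wave_functional t (\<psi> n)) \<longlonglongrightarrow> wave_functional t \<phi>"
proof -
  note [measurable] = bump_measurable[OF b(1)] bump_measurable[OF b(2)]
  have d: "integrable lborel (\<lambda>y. \<psi> n y - \<phi> y)" for n
    by (intro Bochner_Integration.integrable_diff bump_integrable b)
  have S: "(\<lambda>n. sine_transform (\<psi> n) k) \<longlonglongrightarrow> sine_transform \<phi> k" for k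
  proof -
    have "(\<lambda>n. sine_transform (\<psi> n) k - sine_transform \<phi> k) \<longlonglongrightarrow> 0"
      by (rule Lim_null_comparison[OF _ lim])
        (use transform_le(1)[OF d] transform_diff(1)[OF b(2,1)] in auto)
    then show ?thesis by (rule LIM_zero_cancel)
  qed
  have C: "(\<lambda>n. cosine_transform (\<psi> n) k) \<longlonglongrightarrow> cosine_transform \<phi> k" for k
  proof -
    have "(\<lambda>n. cosine_transform (\<psi> n) k - cosine_transform \<phi> k) \<longlonglongrightarrow> 0"
      by (rule Lim_null_comparison[OF _ lim])
        (use transform_le(2)[OF d] transform_diff(2)[OF b(2,1)] in auto)
    then show ?thesis by (rule LIM_zero_cancel)
  qed
  have le: "\<bar>sine_transform (\<psi> n) (\<rho> x)\<bar> \<le> K / (1 + \<rho> x)" "\<bar>cosine_transform (\<psi> n) (\<rho> x)\<bar> \<le> K / (1 + \<rho> x)" for n x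
  proof -
    have "(L1_norm (\<psi> n) + L1_norm (deriv (\<psi> n))) / (1 + \<rho> x) \<le> K / (1 + \<rho> x)"
      using rho_nonneg[of x] bd[of n] by (intro divide_right_mono) auto
    then show "\<bar>sine_transform (\<psi> n) (\<rho> x)\<bar> \<le> K / (1 + \<rho> x)" "\<bar>cosine_transform (\<psi> n) (\<rho> x)\<bar> \<le> K / (1 + \<rho> x)"
      using transform_decay[OF b(2) rho_nonneg[of x], of n] by linarith+
  qed
  have 1: "(\<lambda>n. functional_r t (\<psi> n)) \<longlonglongrightarrow> functional_r t \<phi>"
    unfolding functional_r_def
  proof (rule integral_dominated_convergence[OF _ _ dominator_integrable[of K]])
    show "AE x in M. norm (rotated_A t x * cosine_transform (\<psi> n) (\<rho> x)) \<le> K * dominator x" for n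
      unfolding real_norm_def by (intro AE_I2 rotation_le le)
    show "AE x in M. (\<lambda>n. rotated_A t x * cosine_transform (\<psi> n) (\<rho> x))
       \<longlonglongrightarrow> rotated_A t x * cosine_transform \<phi> (\<rho> x)"
      by (intro AE_I2 tendsto_mult tendsto_const C)
  qed measurable
  have 2: "(\<lambda>n. functional_t t (\<psi> n)) \<longlonglongrightarrow> functional_t t \<phi>"
    unfolding functional_t_def
  proof (rule integral_dominated_convergence[OF _ _ dominator_integrable[of K]])
    show "AE x in M. norm (rotated_B t x * sine_transform (\<psi> n) (\<rho> x)) \<le> K * dominator x" for n
      unfolding real_norm_def by (intro AE_I2 rotation_le le)
    show "AE x in M. (\<lambda>n. rotated_B t x * sine_transform (\<psi> n) (\<rho> x))
       \<longlonglongrightarrow> rotated_B t x * sine_transform \<phi> (\<rho> x)"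
      by (intro AE_I2 tendsto_mult tendsto_const S)
  qed measurable
  from tendsto_add[OF 1 2] show ?thesis unfolding wave_functional_def .
qed

end

section \<open>Reflection and translation of integrals on the line\<close>

lemma integral_reflect: "(\<integral>s. f (- s) \<partial>lborel) = (\<integral>s. f s \<partial>lborel)" for f :: "real \<Rightarrow> real"
  using lborel_integral_real_affine[of "-1" f 0] by simp

lemma nn_integral_reflect:
  fixes f :: "real \<Rightarrow> ennreal"
  assumes "f \<in> borel_measurable borel"
  shows "(\<integral>\<^sup>+s. f (- s) \<partial>lborel) = (\<integral>\<^sup>+s. f s \<partial>lborel)"
  using nn_integral_real_affine[OF assms, of "-1" 0] by simp

lemma integral_shift: "(\<integral>s. f (s + d) \<partial>lborel) = (\<integral>s. f s \<partial>lborel)" for f :: "real \<Rightarrow> real"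
  using lborel_integral_real_affine[of 1 f d] by (simp add: add.commute)

lemma nn_integral_shift:
  fixes f :: "real \<Rightarrow> ennreal"
  assumes "f \<in> borel_measurable borel"
  shows "(\<integral>\<^sup>+s. f (s + d) \<partial>lborel) = (\<integral>\<^sup>+s. f s \<partial>lborel)"
  using nn_integral_real_affine[OF assms, of 1 d] by (simp add: add.commute)

lemma bump_reflect: "bump \<phi> \<Longrightarrow> bump (\<lambda>y. \<phi> (- y))"
  using bump_affine[of \<phi> "-1" 0] by simp

context wave_representation
begin

text \<open>The functional has no mass at the origin: test functions are cut off near \<open>0\<close>, and the error is
  controlled by the bounded total variation of the cutoffs.\<close>

lemma wave_functional_extend:
  assumes G: "\<And>K. compact K \<Longrightarrow> set_integrable lborel K G"
    and pos: "\<And>\<phi>. test_function_on {0<..} \<phi> \<Longrightarrow> wave_functional t \<phi> = (\<integral>s. G s * \<phi> s \<partial>lborel)"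
    and neg: "\<And>\<phi>. test_function_on {0<..} \<phi> \<Longrightarrow> wave_functional t (\<lambda>y. \<phi> (- y)) = (\<integral>s. G s * \<phi> (- s) \<partial>lborel)"
    and \<phi>: "bump \<phi>"
  shows "wave_functional t \<phi> = (\<integral>s. G s * \<phi> s \<partial>lborel)"
proof -
  note \<phi>' = bump_reflect[OF \<phi>]
  obtain B where B: "\<And>y. \<bar>\<phi> y\<bar> \<le> B" using bump_bounded[OF \<phi>] by auto
  \<comment> \<open>The left half of \<phi> is reflected before it is cut off, so that
    \<open>f1 n\<close> and \<open>f2 n\<close> are both test functions on r > 0, to which
    \<open>pos\<close> and \<open>neg\<close> apply.\<close>
  define f1 where "f1 n y = \<phi> y * cutoff n y" for n y
  define f2 where "f2 n y = \<phi> (- y) * cutoff n y" for n y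
  define \<psi> where "\<psi> n y = f1 n y + f2 n (- y)" for n y
  have t1: "test_function_on {0<..} (f1 n)" and t2: "test_function_on {0<..} (f2 n)" for n
    unfolding f1_def[abs_def] f2_def[abs_def] by (intro test_function_cutoff \<phi> \<phi>')+
  note b1 = test_function_bump[OF t1] and b2 = test_function_bump[OF t2]
  have b2': "bump (\<lambda>y. f2 n (- y))" for n by (rule bump_reflect[OF b2])
  have b\<psi>: "bump (\<psi> n)" for n unfolding \<psi>_def[abs_def] by (rule bump_add[OF b1 b2'])
  have \<psi>_le: "\<bar>\<psi> n y\<bar> \<le> 2 * \<bar>\<phi> y\<bar>" and \<psi>_diff: "\<bar>\<psi> n y - \<phi> y\<bar> \<le> 3 * \<bar>\<phi> y\<bar>" for n y
  proof -
    have "\<bar>f1 n y\<bar> \<le> \<bar>\<phi> y\<bar> * 1" "\<bar>f2 n (- y)\<bar> \<le> \<bar>\<phi> y\<bar> * 1"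
      unfolding f1_def f2_def abs_mult minus_minus
      using cutoff_bounds[of n y] cutoff_bounds[of n "- y"] by (auto intro!: mult_left_le)
    then show "\<bar>\<psi> n y\<bar> \<le> 2 * \<bar>\<phi> y\<bar>" "\<bar>\<psi> n y - \<phi> y\<bar> \<le> 3 * \<bar>\<phi> y\<bar>"
      unfolding \<psi>_def by linarith+
  qed
  have \<psi>_lim: "(\<lambda>n. \<psi> n y) \<longlonglongrightarrow> \<phi> y" if "y \<noteq> 0" for y
  proof (cases "y > 0")
    case True
    have "0 \<le> 1 / (real (Suc n))\<^sup>2" for n by simp
    then have "cutoff n (- y) = 0" for n
      using True by (intro cutoff_eq_0) (meson less_imp_le neg_le_0_iff_le order_trans)
    then have "\<psi> n y = \<phi> y * cutoff n y" for n by (simp add: \<psi>_def f1_def f2_def)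
    moreover have "(\<lambda>n. \<phi> y * cutoff n y) \<longlonglongrightarrow> \<phi> y * 1"
      by (intro tendsto_intros cutoff_tendsto True)
    ultimately show ?thesis by simp
  next
    case False
    with that have "y < 0" by simp
    have "0 \<le> 1 / (real (Suc n))\<^sup>2" for n by simp
    then have "cutoff n y = 0" for n
      using \<open>y < 0\<close> by (intro cutoff_eq_0) (meson less_imp_le order_trans)
    then have "\<psi> n y = \<phi> y * cutoff n (- y)" for n by (simp add: \<psi>_def f1_def f2_def)
    moreover have "(\<lambda>n. \<phi> y * cutoff n (- y)) \<longlonglongrightarrow> \<phi> y * 1"
      by (intro tendsto_intros cutoff_tendsto) (use \<open>y < 0\<close> in simp)
    ultimately show ?thesis by simp
  qed
  have AE0: "AE y in lborel. (y::real) \<noteq> 0" by (rule AE_lborel_singleton)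
  note [measurable] = bump_measurable[OF \<phi>] bump_measurable[OF b\<psi>]
  have eq: "wave_functional t (\<psi> n) = (\<integral>s. G s * \<psi> n s \<partial>lborel)" for n
  proof -
    have "wave_functional t (\<psi> n) = (\<integral>s. G s * f1 n s \<partial>lborel) + (\<integral>s. G s * f2 n (- s) \<partial>lborel)"
      unfolding \<psi>_def[abs_def] functional_add[OF b1 b2'] pos[OF t1] neg[OF t2] ..
    also have "\<dots> = (\<integral>s. G s * f1 n s + G s * f2 n (- s) \<partial>lborel)"
      by (rule Bochner_Integration.integral_add[symmetric]; rule locally_integrable_bump[OF G]) (use b1 b2' in auto)
    finally show ?thesis by (simp add: \<psi>_def distrib_left)
  qed
  \<comment> \<open>The bounds of \<open>bump_cutoff_variation\<close> for \<phi> and for its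
    reflection, independent of n.\<close>
  define K where "K = (L1_norm \<phi> + (\<integral>y. \<bar>\<phi> (- y)\<bar> \<partial>lborel))
     + ((L1_norm (deriv \<phi>) + B) + ((\<integral>y. \<bar>deriv (\<lambda>y. \<phi> (- y)) y\<bar> \<partial>lborel) + B))"
  have bd: "L1_norm (\<psi> n) + L1_norm (deriv (\<psi> n)) \<le> K" for n
  proof -
    have i1: "integrable lborel (\<lambda>y. \<bar>f1 n y\<bar>)" "integrable lborel (\<lambda>y. \<bar>f2 n (- y)\<bar>)"
      by (intro integrable_abs bump_integrable b1 b2')+
    have bd2: "bump (\<lambda>y. deriv (f2 n) (- y))" by (rule bump_reflect[OF bump_deriv(1)[OF b2]])
    have i2: "integrable lborel (\<lambda>y. \<bar>deriv (f1 n) y\<bar>)" "integrable lborel (\<lambda>y. \<bar>deriv (f2 n) (- y)\<bar>)"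
      by (intro integrable_abs bump_integrable bump_deriv(1) b1 bd2)+
    have d: "deriv (\<psi> n) y = deriv (f1 n) y - deriv (f2 n) (- y)" for y
    proof -
      have "((\<lambda>y::real. - y) has_real_derivative - 1) (at y)" by (auto intro!: derivative_eq_intros)
      from DERIV_chain2[OF bump_deriv(2)[OF b2[of n]] this]
      have "((\<lambda>y. f2 n (- y)) has_real_derivative - deriv (f2 n) (- y)) (at y)" by simp
      from DERIV_imp_deriv[OF DERIV_add[OF bump_deriv(2)[OF b1[of n]] this]]
      show ?thesis unfolding \<psi>_def[abs_def] by simp
    qed
    have "L1_norm (\<psi> n) \<le> (\<integral>y. \<bar>f1 n y\<bar> + \<bar>f2 n (- y)\<bar> \<partial>lborel)"
    proof (rule integral_mono)
      show "integrable lborel (\<lambda>y. \<bar>\<psi> n y\<bar>)" by (intro integrable_abs bump_integrable b\<psi>)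
      show "integrable lborel (\<lambda>y. \<bar>f1 n y\<bar> + \<bar>f2 n (- y)\<bar>)" by (rule Bochner_Integration.integrable_add[OF i1])
      show "\<bar>\<psi> n y\<bar> \<le> \<bar>f1 n y\<bar> + \<bar>f2 n (- y)\<bar>" for y unfolding \<psi>_def by (rule abs_triangle_ineq)
    qed
    also have "\<dots> = L1_norm (f1 n) + L1_norm (f2 n)"
      using i1 integral_reflect[of "\<lambda>y. \<bar>f2 n y\<bar>"] by simp
    also have "\<dots> \<le> L1_norm \<phi> + (\<integral>y. \<bar>\<phi> (- y)\<bar> \<partial>lborel)"
      unfolding f1_def f2_def by (intro add_mono bump_cutoff_variation(2)[OF \<phi> B] bump_cutoff_variation(2)[OF \<phi>' B])
    finally have 1: "L1_norm (\<psi> n) \<le> L1_norm \<phi> + (\<integral>y. \<bar>\<phi> (- y)\<bar> \<partial>lborel)" .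
    have "L1_norm (deriv (\<psi> n)) \<le> (\<integral>y. \<bar>deriv (f1 n) y\<bar> + \<bar>deriv (f2 n) (- y)\<bar> \<partial>lborel)"
    proof (rule integral_mono)
      show "integrable lborel (\<lambda>y. \<bar>deriv (\<psi> n) y\<bar>)" by (intro integrable_abs bump_integrable bump_deriv(1) b\<psi>)
      show "integrable lborel (\<lambda>y. \<bar>deriv (f1 n) y\<bar> + \<bar>deriv (f2 n) (- y)\<bar>)" by (rule Bochner_Integration.integrable_add[OF i2])
      show "\<bar>deriv (\<psi> n) y\<bar> \<le> \<bar>deriv (f1 n) y\<bar> + \<bar>deriv (f2 n) (- y)\<bar>" for y unfolding d by (rule abs_triangle_ineq4)
    qed
    also have "\<dots> = L1_norm (deriv (f1 n)) + L1_norm (deriv (f2 n))"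
      using i2 integral_reflect[of "\<lambda>y. \<bar>deriv (f2 n) y\<bar>"] by simp
    also have "\<dots> \<le> (L1_norm (deriv \<phi>) + B) + ((\<integral>y. \<bar>deriv (\<lambda>y. \<phi> (- y)) y\<bar> \<partial>lborel) + B)"
      unfolding f1_def[abs_def] f2_def[abs_def]
      by (intro add_mono bump_cutoff_variation(1)[OF \<phi> B] bump_cutoff_variation(1)[OF \<phi>' B])
    finally show ?thesis unfolding K_def using 1 by (intro add_mono)
  qed
  have lim: "(\<lambda>n. \<integral>y. \<bar>\<psi> n y - \<phi> y\<bar> \<partial>lborel) \<longlonglongrightarrow> (\<integral>y. 0 \<partial>(lborel :: real measure))"
  proof (rule integral_dominated_convergence[where w = "\<lambda>y. 3 * \<bar>\<phi> y\<bar>"])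
    show "integrable lborel (\<lambda>y. 3 * \<bar>\<phi> y\<bar>)" using bump_integrable[OF \<phi>] by simp
    show "AE y in lborel. (\<lambda>n. \<bar>\<psi> n y - \<phi> y\<bar>) \<longlonglongrightarrow> 0"
      using AE0
    proof eventually_elim
      case (elim y)
      show ?case using tendsto_rabs[OF LIM_zero[OF \<psi>_lim[OF elim]]] by simp
    qed
    show "AE y in lborel. norm \<bar>\<psi> n y - \<phi> y\<bar> \<le> 3 * \<bar>\<phi> y\<bar>" for n using \<psi>_diff by simp
  qed measurable
  have "(\<lambda>n. wave_functional t (\<psi> n)) \<longlonglongrightarrow> wave_functional t \<phi>"
    by (rule wave_functional_tendsto[OF \<phi> b\<psi> _ bd]) (use lim in simp)
  moreover have "(\<lambda>n. wave_functional t (\<psi> n)) \<longlonglongrightarrow> (\<integral>s. G s * \<phi> s \<partial>lborel)"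
    unfolding eq
  proof (rule integral_dominated_convergence[where w = "\<lambda>s. 2 * \<bar>G s * \<phi> s\<bar>"])
    show "(\<lambda>s. G s * \<phi> s) \<in> borel_measurable lborel"
      by (rule borel_measurable_integrable[OF locally_integrable_bump[OF G \<phi>]])
    show "(\<lambda>s. G s * \<psi> n s) \<in> borel_measurable lborel" for n
      by (rule borel_measurable_integrable[OF locally_integrable_bump[OF G b\<psi>]])
    show "integrable lborel (\<lambda>s. 2 * \<bar>G s * \<phi> s\<bar>)" using locally_integrable_bump[OF G \<phi>] by simp
    show "AE s in lborel. (\<lambda>n. G s * \<psi> n s) \<longlonglongrightarrow> G s * \<phi> s"
      using AE0 by eventually_elim (intro tendsto_mult tendsto_const \<psi>_lim)
    show "AE s in lborel. norm (G s * \<psi> n s) \<le> 2 * \<bar>G s * \<phi> s\<bar>" for n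
    proof (rule AE_I2)
      fix s
      show "norm (G s * \<psi> n s) \<le> 2 * \<bar>G s * \<phi> s\<bar>"
        using mult_left_mono[OF \<psi>_le[of n s], of "\<bar>G s\<bar>"] by (simp add: abs_mult mult_ac)
    qed
  qed
  ultimately show ?thesis by (rule LIMSEQ_unique)
qed

text \<open>Finite energy with m \<ge> 1 makes \<open>G\<close> locally integrable, so
  \<open>wave_functional t0\<close> becomes integration against \<open>G\<close> on the whole line,
  the origin included. At time \<open>t\<close> it is then integration against a translate of
  \<open>G\<close>, whose even and odd parts are the new derivatives; thus their existence as
  functions is part of the conclusion.\<close>

lemma energy_transfer:
  assumes v: "has_weak_deriv_r (u t0) v" and z: "has_weak_deriv_t u t0 z" and m: "m \<ge> 1"
    and fin: "(\<integral>\<^sup>+r\<in>{0<..}. ennreal (\<bar>v r\<bar> powr m + \<bar>z r\<bar> powr m) \<partial>lborel) < \<infinity>" (is "?J < \<infinity>")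
  shows "\<exists>v' z'. has_weak_deriv_r (u t) v' \<and> has_weak_deriv_t u t z' \<and>
    (\<integral>\<^sup>+r\<in>{0<..}. ennreal (\<bar>v' r\<bar> powr m + \<bar>z' r\<bar> powr m) \<partial>lborel) \<le> ennreal (8 * 4 powr m) * ?J"
proof -
  have m0: "m \<ge> 0" using m by simp
  have vl: "locally_integrable_on v {0<..}" and zl: "locally_integrable_on z {0<..}"
    using v z unfolding has_weak_deriv_r_def has_weak_deriv_t_def by auto
  \<comment> \<open>Extension by 0, since \<open>v\<close> and \<open>z\<close> are only known to be
    measurable on r > 0.\<close>
  define vp where "vp r = indicator {0<..} r * v r" for r
  define zp where "zp r = indicator {0<..} r * z r" for r
  have [measurable]: "vp \<in> borel_measurable borel" "zp \<in> borel_measurable borel"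
    unfolding vp_def[abs_def] zp_def[abs_def] using locally_integrable_measurable vl zl by auto
  define P where "P r = \<bar>vp r\<bar> powr m + \<bar>zp r\<bar> powr m" for r
  have [measurable]: "P \<in> borel_measurable borel" unfolding P_def[abs_def] by measurable
  have P0: "P r \<ge> 0" for r by (simp add: P_def)
  have J: "?J = (\<integral>\<^sup>+r. ennreal (P r) \<partial>lborel)"
    by (rule nn_integral_cong) (auto simp: P_def vp_def zp_def indicator_def)
  \<comment> \<open>For s > 0 this is v + z at s, for s < 0 it is v - z at - s.\<close>
  define G where "G s = vp s + zp s + (vp (- s) - zp (- s))" for s
  have mG[measurable]: "G \<in> borel_measurable borel" unfolding G_def[abs_def] by measurable
  \<comment> \<open>The two-term inequality is used at two levels, each costing
    \<open>2 powr m\<close>.\<close>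
  have G_le: "\<bar>G s\<bar> powr m \<le> 4 powr m * (P s + P (- s))" for s
  proof -
    have "\<bar>G s\<bar> powr m \<le> 2 powr m * (\<bar>vp s + zp s\<bar> powr m + \<bar>vp (- s) - zp (- s)\<bar> powr m)"
      unfolding G_def by (rule powr_abs_add_le[OF m0])
    also have "\<dots> \<le> 2 powr m * (2 powr m * P s + 2 powr m * P (- s))"
      using powr_abs_add_le[OF m0, of "vp s" "zp s"] powr_abs_add_le[OF m0, of "vp (- s)" "- zp (- s)"]
      by (intro mult_left_mono add_mono) (auto simp: P_def)
    also have "\<dots> = (2 powr m * 2 powr m) * (P s + P (- s))" by (simp add: algebra_simps)
    also have "(2::real) powr m * 2 powr m = 4 powr m" by (simp flip: powr_mult)
    finally show ?thesis .
  qed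
  have GJ: "(\<integral>\<^sup>+s. ennreal (\<bar>G s\<bar> powr m) \<partial>lborel) \<le> ennreal (2 * 4 powr m) * ?J"
  proof -
    have "(\<integral>\<^sup>+s. ennreal (\<bar>G s\<bar> powr m) \<partial>lborel) \<le> (\<integral>\<^sup>+s. ennreal (4 powr m) * (ennreal (P s) + ennreal (P (- s))) \<partial>lborel)"
    proof (rule nn_integral_mono)
      fix s
      show "ennreal (\<bar>G s\<bar> powr m) \<le> ennreal (4 powr m) * (ennreal (P s) + ennreal (P (- s)))"
        using G_le[of s] P0[of s] P0[of "- s"]
        by (simp add: ennreal_leI flip: ennreal_plus ennreal_mult)
    qed
    also have "\<dots> = ennreal (4 powr m) * ((\<integral>\<^sup>+s. ennreal (P s) \<partial>lborel) + (\<integral>\<^sup>+s. ennreal (P (- s)) \<partial>lborel))"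
      by (simp add: nn_integral_cmult nn_integral_add)
    also have "(\<integral>\<^sup>+s. ennreal (P (- s)) \<partial>lborel) = (\<integral>\<^sup>+s. ennreal (P s) \<partial>lborel)"
      by (rule nn_integral_reflect[of "\<lambda>s. ennreal (P s)"]) measurable
    also have "ennreal (4 powr m) * ((\<integral>\<^sup>+s. ennreal (P s) \<partial>lborel) + (\<integral>\<^sup>+s. ennreal (P s) \<partial>lborel)) = ennreal (2 * 4 powr m) * ?J"
      unfolding J by (simp add: ennreal_mult mult_ac flip: mult_2)
    finally show ?thesis .
  qed
  have Gfin: "(\<integral>\<^sup>+s. ennreal (\<bar>G s\<bar> powr m) \<partial>lborel) < \<infinity>"
    by (rule le_less_trans[OF GJ]) (use fin in \<open>simp add: ennreal_mult_less_top\<close>)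
  have Gint: "set_integrable lborel K G" if "compact K" for K
    by (rule powr_locally_integrable[OF mG m Gfin that])
  have Gpos: "G s * \<phi> s = v s * \<phi> s + z s * \<phi> s" and Gneg: "G (- s) * \<phi> s = v s * \<phi> s - z s * \<phi> s"
    if "test_function_on {0<..} \<phi>" for \<phi> s
    using test_function_halfline_eq_0[OF that, of s]
    by (cases "s > 0"; simp add: G_def vp_def zp_def indicator_def algebra_simps)+
  have fr: "functional_r t0 \<phi> = (\<integral>r. v r * \<phi> r \<partial>lborel)" and ft: "functional_t t0 \<phi> = (\<integral>r. z r * \<phi> r \<partial>lborel)"
    if \<phi>: "test_function_on {0<..} \<phi>" for \<phi>
  proof -
    show "functional_r t0 \<phi> = (\<integral>r. v r * \<phi> r \<partial>lborel)"
      using v functional_r_eq[OF \<phi>, of t0] \<phi> unfolding has_weak_deriv_r_def by simp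
    show "functional_t t0 \<phi> = (\<integral>r. z r * \<phi> r \<partial>lborel)"
      using z functional_t_eq[OF \<phi>, of t0] \<phi> unfolding has_weak_deriv_t_def by (blast intro: DERIV_unique)
  qed
  have ext: "wave_functional t0 \<phi> = (\<integral>s. G s * \<phi> s \<partial>lborel)" if "bump \<phi>" for \<phi>
  proof (rule wave_functional_extend[OF Gint _ _ that])
    fix \<phi> assume \<phi>: "test_function_on {0::real<..} \<phi>"
    note i = locally_integrable_test[OF vl \<phi>] locally_integrable_test[OF zl \<phi>]
    show "wave_functional t0 \<phi> = (\<integral>s. G s * \<phi> s \<partial>lborel)"
      unfolding wave_functional_def fr[OF \<phi>] ft[OF \<phi>] Gpos[OF \<phi>]
      by (rule Bochner_Integration.integral_add[OF i, symmetric])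
    have "(\<integral>s. G s * \<phi> (- s) \<partial>lborel) = (\<integral>s. G (- s) * \<phi> s \<partial>lborel)"
      using integral_reflect[of "\<lambda>s. G (- s) * \<phi> s"] by simp
    also have "\<dots> = (\<integral>r. v r * \<phi> r \<partial>lborel) - (\<integral>r. z r * \<phi> r \<partial>lborel)"
      unfolding Gneg[OF \<phi>] by (rule Bochner_Integration.integral_diff[OF i])
    finally show "wave_functional t0 (\<lambda>y. \<phi> (- y)) = (\<integral>s. G s * \<phi> (- s) \<partial>lborel)"
      unfolding wave_functional_def functional_reflect fr[OF \<phi>] ft[OF \<phi>] by simp
  qed
  define H where "H s = G (s + (t - t0))" for s
  have mH[measurable]: "H \<in> borel_measurable borel" unfolding H_def[abs_def] by measurable
  have HJ: "(\<integral>\<^sup>+s. ennreal (\<bar>H s\<bar> powr m) \<partial>lborel) = (\<integral>\<^sup>+s. ennreal (\<bar>G s\<bar> powr m) \<partial>lborel)"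
    unfolding H_def by (rule nn_integral_shift[of "\<lambda>s. ennreal (\<bar>G s\<bar> powr m)"]) measurable
  have HJ': "(\<integral>\<^sup>+s. ennreal (\<bar>H (- s)\<bar> powr m) \<partial>lborel) = (\<integral>\<^sup>+s. ennreal (\<bar>H s\<bar> powr m) \<partial>lborel)"
    by (rule nn_integral_reflect[of "\<lambda>s. ennreal (\<bar>H s\<bar> powr m)"]) measurable
  have Hint: "set_integrable lborel K H" "set_integrable lborel K (\<lambda>s. H (- s))" if "compact K" for K
  proof -
    show "set_integrable lborel K H"
      by (rule powr_locally_integrable[OF mH m _ that]) (use Gfin HJ in simp)
    show "set_integrable lborel K (\<lambda>s. H (- s))"
      by (rule powr_locally_integrable[OF _ m _ that]) (use Gfin HJ HJ' in auto)
  qed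
  have Hext: "wave_functional t \<phi> = (\<integral>s. H s * \<phi> s \<partial>lborel)" if \<phi>: "bump \<phi>" for \<phi>
  proof -
    have "y - (t - t0) = 1 * y + (t0 - t)" for y by simp
    then have b: "bump (\<lambda>y. \<phi> (y - (t - t0)))" using bump_affine[OF \<phi>, of 1 "t0 - t"] by (simp only:)
    have "wave_functional t \<phi> = wave_functional t0 (\<lambda>y. \<phi> (y - (t - t0)))"
      using wave_functional_shift[OF \<phi>, of t0 "t - t0"] by simp
    also have "\<dots> = (\<integral>s. G s * \<phi> (s - (t - t0)) \<partial>lborel)" by (rule ext[OF b])
    also have "\<dots> = (\<integral>s. H s * \<phi> s \<partial>lborel)"
      unfolding H_def using integral_shift[of "\<lambda>s. G s * \<phi> (s - (t - t0))" "t - t0"] by simp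
    finally show ?thesis .
  qed
  define v' where "v' s = (H s + H (- s)) / 2" for s
  define z' where "z' s = (H s + - H (- s)) / 2" for s
  have "set_integrable lborel K v'" "set_integrable lborel K z'" if "compact K" for K
  proof -
    have e: "indicat_real K s *\<^sub>R v' s = (indicat_real K s *\<^sub>R H s + indicat_real K s *\<^sub>R H (- s)) / 2"
      "indicat_real K s *\<^sub>R z' s = (indicat_real K s *\<^sub>R H s - indicat_real K s *\<^sub>R H (- s)) / 2" for s
      by (simp_all add: v'_def z'_def indicator_def)
    note i = Hint[OF that, unfolded set_integrable_def]
    show "set_integrable lborel K v'" "set_integrable lborel K z'"
      unfolding set_integrable_def e
      by (intro integrable_divide Bochner_Integration.integrable_add Bochner_Integration.integrable_diff i)+
  qed
  then have loc: "locally_integrable_on v' {0<..}" "locally_integrable_on z' {0<..}"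
    unfolding locally_integrable_on_def by blast+
  have fr': "functional_r t \<phi> = (\<integral>r. v' r * \<phi> r \<partial>lborel)" and ft': "functional_t t \<phi> = (\<integral>r. z' r * \<phi> r \<partial>lborel)"
    if \<phi>: "test_function_on {0<..} \<phi>" for \<phi>
  proof -
    note b = test_function_bump[OF \<phi>]
    have i: "integrable lborel (\<lambda>s. H s * \<phi> s)" "integrable lborel (\<lambda>s. H (- s) * \<phi> s)"
      by (rule locally_integrable_bump[OF _ b], erule Hint)+
    \<comment> \<open>A test function and its reflection give the sum and the difference of the two
      functionals, hence each of them.\<close>
    have "functional_r t \<phi> + functional_t t \<phi> = (\<integral>s. H s * \<phi> s \<partial>lborel)"
      using Hext[OF b] by (simp add: wave_functional_def)
    moreover have "functional_r t \<phi> - functional_t t \<phi> = (\<integral>s. H (- s) * \<phi> s \<partial>lborel)"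
      using Hext[OF bump_reflect[OF b]] integral_reflect[of "\<lambda>s. H (- s) * \<phi> s"]
      by (simp add: wave_functional_def functional_reflect)
    moreover have "(\<integral>r. v' r * \<phi> r \<partial>lborel) = ((\<integral>s. H s * \<phi> s \<partial>lborel) + (\<integral>s. H (- s) * \<phi> s \<partial>lborel)) / 2"
      using i by (simp add: v'_def distrib_right add_divide_distrib)
    moreover have "(\<integral>r. z' r * \<phi> r \<partial>lborel) = ((\<integral>s. H s * \<phi> s \<partial>lborel) - (\<integral>s. H (- s) * \<phi> s \<partial>lborel)) / 2"
      using i by (simp add: z'_def left_diff_distrib diff_divide_distrib)
    ultimately show "functional_r t \<phi> = (\<integral>r. v' r * \<phi> r \<partial>lborel)" "functional_t t \<phi> = (\<integral>r. z' r * \<phi> r \<partial>lborel)"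
      by simp_all
  qed
  have "has_weak_deriv_r (u t) v'"
    unfolding has_weak_deriv_r_def using u_loc loc(1) functional_r_eq fr' by simp
  moreover have "has_weak_deriv_t u t z'"
    unfolding has_weak_deriv_t_def
  proof (intro conjI allI impI u_loc loc(2))
    fix \<phi> assume \<phi>: "test_function_on {0::real<..} \<phi>"
    show "((\<lambda>\<tau>. \<integral>r. u \<tau> r * \<phi> r \<partial>lborel) has_real_derivative (\<integral>r. z' r * \<phi> r \<partial>lborel)) (at t)"
      using functional_t_eq[OF \<phi>, of t] unfolding ft'[OF \<phi>] .
  qed
  moreover have "(\<integral>\<^sup>+r\<in>{0<..}. ennreal (\<bar>v' r\<bar> powr m + \<bar>z' r\<bar> powr m) \<partial>lborel) \<le> ennreal (8 * 4 powr m) * ?J"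
  proof -
    have "(\<integral>\<^sup>+r\<in>{0<..}. ennreal (\<bar>v' r\<bar> powr m + \<bar>z' r\<bar> powr m) \<partial>lborel)
      \<le> (\<integral>\<^sup>+r. 2 * (ennreal (\<bar>H r\<bar> powr m) + ennreal (\<bar>H (- r)\<bar> powr m)) \<partial>lborel)"
    proof (rule nn_integral_mono)
      fix r
      have "\<bar>v' r\<bar> powr m + \<bar>z' r\<bar> powr m \<le> 2 * (\<bar>H r\<bar> powr m + \<bar>H (- r)\<bar> powr m)"
        using add_mono[OF powr_abs_half_add_le[OF m0, of "H r" "H (- r)"] powr_abs_half_add_le[OF m0, of "H r" "- H (- r)"]]
        unfolding v'_def z'_def abs_minus_cancel mult_2 .
      then have "ennreal (\<bar>v' r\<bar> powr m + \<bar>z' r\<bar> powr m) \<le> ennreal (2 * (\<bar>H r\<bar> powr m + \<bar>H (- r)\<bar> powr m))"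
        by (rule ennreal_leI)
      also have "\<dots> = 2 * (ennreal (\<bar>H r\<bar> powr m) + ennreal (\<bar>H (- r)\<bar> powr m))"
        by (simp add: ennreal_mult)
      finally show "ennreal (\<bar>v' r\<bar> powr m + \<bar>z' r\<bar> powr m) * indicator {0<..} r \<le> 2 * (ennreal (\<bar>H r\<bar> powr m) + ennreal (\<bar>H (- r)\<bar> powr m))"
        by (auto simp: indicator_def)
    qed
    also have "\<dots> = 2 * ((\<integral>\<^sup>+r. ennreal (\<bar>H r\<bar> powr m) \<partial>lborel) + (\<integral>\<^sup>+r. ennreal (\<bar>H (- r)\<bar> powr m) \<partial>lborel))"
      by (simp add: nn_integral_cmult nn_integral_add)
    \<comment> \<open>A factor 2 for the two derivatives and a factor 2 for \<open>H\<close> and its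
      reflection.\<close>
    also have "\<dots> = 4 * (\<integral>\<^sup>+s. ennreal (\<bar>G s\<bar> powr m) \<partial>lborel)"
      unfolding HJ' HJ by (simp flip: mult_2 mult.assoc)
    also have "\<dots> \<le> 4 * (ennreal (2 * 4 powr m) * ?J)" by (rule mult_left_mono[OF GJ]) simp
    also have "\<dots> = ennreal (4 * (2 * 4 powr m)) * ?J"
      by (subst ennreal_mult) (simp_all add: mult.assoc)
    finally show ?thesis by simp
  qed
  ultimately show ?thesis by blast
qed

text \<open>Every admissible pair at \<open>t0\<close> with finite integral is transferred to an
  admissible pair at \<open>t\<close>; for an infinite integral there is nothing to prove.\<close>

lemma radial_energy_le:
  assumes m: "m \<ge> 1"
  shows "radial_energy m u t \<le> ennreal (8 * 4 powr m) * radial_energy m u t0"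
proof -
  let ?c = "8 * 4 powr m"
  let ?J = "\<lambda>v z. \<integral>\<^sup>+r\<in>{0<..}. ennreal (\<bar>v r\<bar> powr m + \<bar>z r\<bar> powr m) \<partial>lborel"
  have c: "?c > 0" by simp
  have inv: "ennreal ?c * ennreal (inverse ?c) = 1"
    using c by (simp flip: ennreal_mult)
  have key: "radial_energy m u t \<le> ennreal ?c * ?J v z"
    if v: "has_weak_deriv_r (u t0) v" and z: "has_weak_deriv_t u t0 z" for v z
  proof (cases "?J v z < \<infinity>")
    case True
    obtain v' z' where *: "has_weak_deriv_r (u t) v'" "has_weak_deriv_t u t z'" "?J v' z' \<le> ennreal ?c * ?J v z"
      using energy_transfer[OF v z m True, of t] by blast
    have "radial_energy m u t \<le> ?J v' z'"
      unfolding radial_energy_def by (rule INF_lower2[of "(v', z')"]) (use * in auto)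
    then show ?thesis using *(3) by (rule order_trans)
  next
    case False
    then have "?J v z = \<infinity>" by (simp add: less_top[symmetric])
    then show ?thesis using c by (simp add: ennreal_mult_top)
  qed
  \<comment> \<open>With the constant moved to the left as its inverse, the right side is a bare
    infimum and can be bounded below pair by pair; this includes the case of no pair at all, where
    it is infinite.\<close>
  have "ennreal (inverse ?c) * radial_energy m u t \<le> radial_energy m u t0"
    unfolding radial_energy_def[of m u t0]
  proof (rule INF_greatest)
    fix p assume p: "p \<in> {(v, z). has_weak_deriv_r (u t0) v \<and> has_weak_deriv_t u t0 z}"
    obtain v z where vz: "p = (v, z)" by (cases p)
    have "ennreal (inverse ?c) * radial_energy m u t \<le> ennreal (inverse ?c) * (ennreal ?c * ?J v z)"
      by (rule mult_left_mono[OF key]) (use p vz in auto)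
    also have "\<dots> = (ennreal ?c * ennreal (inverse ?c)) * ?J v z" by (simp only: mult_ac)
    also have "\<dots> = ?J v z" unfolding inv by simp
    finally show "ennreal (inverse ?c) * radial_energy m u t \<le> (case p of (v, z) \<Rightarrow> ?J v z)" by (simp add: vz)
  qed
  from mult_left_mono[OF this, of "ennreal ?c"]
  show ?thesis unfolding mult.assoc[symmetric] inv mult_1_left by simp
qed

end

section \<open>The energy estimate\<close>

text \<open>In polar coordinates the integrand behaves like r^(2 - 2 s) near 0, integrable for s <
  3/2, and like r^(- 2 s) at infinity, integrable for s > 1/2.\<close>

lemma weight_integrable:
  fixes s :: real
  assumes s: "1/2 < s" "s < 3/2"
  shows "integrable lborel (\<lambda>\<xi>::real^3. norm \<xi> powr (- 2 * s) / (1 + norm \<xi>)\<^sup>2)"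
proof -
  let ?h = "\<lambda>r. indicator {0<..} r * r\<^sup>2 * (r powr (- 2 * s) / (1 + r)\<^sup>2)"
  let ?f = "\<lambda>r. indicator {0<..} r * (4 * pi * r\<^sup>2) * (r powr (- 2 * s) / (1 + r)\<^sup>2)"
  let ?g = "\<lambda>r. indicator {0..1} r * r powr (2 - 2 * s) + indicator {1..} r * r powr (- 2 * s)"
  have p: "integrable lborel (\<lambda>r. indicator {0..1} r * r powr (2 - 2 * s))"
  proof -
    have "(\<lambda>r. r powr (2 - 2 * s)) absolutely_integrable_on {0..1::real}"
      using has_integral_powr_from_0[of "2 - 2 * s" 1] s
      by (intro nonnegative_absolutely_integrable_1) (auto simp: integrable_on_def)
    then have "integrable lebesgue (\<lambda>r. indicator {0..1} r * r powr (2 - 2 * s))"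
      by (simp add: set_integrable_def)
    then show ?thesis by (subst (asm) integrable_completion) simp_all
  qed
  have q: "integrable lborel (\<lambda>r. indicator {1..} r * r powr (- 2 * s))"
  proof -
    have "(\<lambda>r. r powr (- 2 * s)) absolutely_integrable_on {1::real..}"
      using has_integral_powr_to_inf[of "- 2 * s" 1] s
      by (intro nonnegative_absolutely_integrable_1) (auto simp: integrable_on_def)
    then have "integrable lebesgue (\<lambda>r. indicator {1..} r * r powr (- 2 * s))"
      by (simp add: set_integrable_def)
    then show ?thesis by (subst (asm) integrable_completion) simp_all
  qed
  have "integrable lborel (\<lambda>r. ?f r)"
  proof (rule Bochner_Integration.integrable_bound)
    show "integrable lborel (\<lambda>r. 4 * pi * ?g r)"
      by (intro integrable_mult_right Bochner_Integration.integrable_add p q)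
    show "AE r in lborel. norm (?f r)
      \<le> norm (4 * pi * ?g r)"
    proof (rule AE_I2)
      fix r :: real
      have "?h r
         \<le> ?g r"
      proof (cases "r > 0")
        case True
        have e: "r powr (2 - 2 * s) = r\<^sup>2 * r powr (- 2 * s)"
          using True by (simp add: powr_diff powr_minus divide_inverse flip: powr_numeral)
        show ?thesis
        proof (cases "r \<le> 1")
          case r1: True
          have "1 \<le> (1 + r)\<^sup>2" using True by (simp add: one_le_power)
          then have "r powr (- 2 * s) / (1 + r)\<^sup>2 \<le> r powr (- 2 * s) / 1" by (intro divide_left_mono) auto
          then have "r\<^sup>2 * (r powr (- 2 * s) / (1 + r)\<^sup>2) \<le> r\<^sup>2 * (r powr (- 2 * s))" by (intro mult_left_mono) auto
          then show ?thesis using True r1 e by (simp add: add_increasing2)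
        next
          case r1: False
          have "r\<^sup>2 \<le> (1 + r)\<^sup>2" using True by (intro power_mono) auto
          then have "r\<^sup>2 / (1 + r)\<^sup>2 \<le> 1" using True by (simp add: divide_le_eq)
          then have "(r\<^sup>2 / (1 + r)\<^sup>2) * r powr (- 2 * s) \<le> 1 * r powr (- 2 * s)" by (intro mult_right_mono) auto
          then show ?thesis using True r1 by simp
        qed
      qed simp
      then have "4 * pi * ?h r
         \<le> 4 * pi * ?g r"
        by (intro mult_left_mono) auto
      moreover have "0 \<le> 4 * pi * ?h r" by simp
      ultimately have "norm (4 * pi * ?h r)
        \<le> norm (4 * pi * ?g r)"
        by (simp only: real_norm_def abs_of_nonneg order_trans[of 0])
      then show "norm (?f r)
      \<le> norm (4 * pi * ?g r)"
        by (simp only: mult_ac)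
    qed
  qed measurable
  then have "integrable lborel (\<lambda>\<xi>. (\<lambda>r. r powr (- 2 * s) / (1 + r)\<^sup>2) (norm (\<xi>::real^3)))"
    by (subst integral_radial(2)) simp_all
  then show ?thesis by simp
qed

text \<open>Cauchy--Schwarz in the form \<open>2ab \<le> a\<^sup>2 + b\<^sup>2\<close>; the weight \<open>|\<xi>|\<^sup>-\<^sup>s / (1 + |\<xi>|)\<close> is square
  integrable exactly for \<open>1/2 < s < 3/2\<close>.\<close>

lemma sobolev_weighted_integrable:
  fixes g :: "real^3 \<Rightarrow> complex"
  assumes s: "1/2 < s" "s < 3/2" and [measurable]: "g \<in> borel_measurable borel"
    and int: "integrable lborel (\<lambda>\<xi>. (norm \<xi> powr (s - j) * norm (g \<xi>))\<^sup>2)"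
  shows "integrable lborel (\<lambda>\<xi>. norm (g \<xi>) / norm \<xi> powr j / (1 + norm \<xi>))"
proof (rule Bochner_Integration.integrable_bound)
  show "integrable lborel (\<lambda>\<xi>. (norm \<xi> powr (s - j) * norm (g \<xi>))\<^sup>2 + norm \<xi> powr (- 2 * s) / (1 + norm \<xi>)\<^sup>2)"
    by (intro Bochner_Integration.integrable_add int weight_integrable s)
  have "AE \<xi> in lborel. (\<xi>::real^3) \<noteq> 0" by (rule AE_lborel_singleton)
  then show "AE \<xi> in lborel. norm (norm (g \<xi>) / norm \<xi> powr j / (1 + norm \<xi>))
    \<le> norm ((norm \<xi> powr (s - j) * norm (g \<xi>))\<^sup>2 + norm \<xi> powr (- 2 * s) / (1 + norm \<xi>)\<^sup>2)"
  proof eventually_elim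
    case (elim \<xi>)
    define r where "r = norm \<xi>"
    have r: "r > 0" using elim by (simp add: r_def)
    define a where "a = r powr (s - j) * norm (g \<xi>)"
    define b where "b = r powr (- s) / (1 + r)"
    have ab: "a \<ge> 0" "b \<ge> 0" using r by (auto simp: a_def b_def)
    have "norm (g \<xi>) / r powr j / (1 + r) = a * b"
    proof -
      have "r powr (s - j) * r powr (- s) = inverse (r powr j)"
        by (simp flip: powr_add powr_minus)
      moreover have "a * b = norm (g \<xi>) * (r powr (s - j) * r powr (- s)) / (1 + r)"
        by (simp add: a_def b_def)
      ultimately show ?thesis by (simp add: divide_inverse)
    qed
    moreover have "r powr (- 2 * s) / (1 + r)\<^sup>2 = b\<^sup>2"
    proof -
      have "(r powr (- s))\<^sup>2 = r powr (- 2 * s)" using r by (simp add: powr_power)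
      then show ?thesis by (simp add: b_def power_divide)
    qed
    moreover have "a * b \<le> a\<^sup>2 + b\<^sup>2"
    proof -
      have "2 * (a * b) \<le> a\<^sup>2 + b\<^sup>2" using sum_squares_bound[of a b] by simp
      moreover have "0 \<le> a * b" using ab by simp
      ultimately show ?thesis by linarith
    qed
    ultimately show ?case
      unfolding r_def[symmetric] a_def[symmetric] using ab by simp
  qed
qed measurable

lemma bump_lipschitz:
  assumes "bump \<phi>"
  shows "\<exists>L. \<forall>x y. \<bar>\<phi> x - \<phi> y\<bar> \<le> L * \<bar>x - y\<bar>"
proof -
  obtain L where L: "\<And>y. \<bar>deriv \<phi> y\<bar> \<le> L" using bump_bounded[OF bump_deriv(1)[OF assms]] by auto
  have "\<bar>\<phi> x - \<phi> y\<bar> \<le> L * \<bar>x - y\<bar>" for x y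
  proof -
    have "norm (\<phi> x - \<phi> y) \<le> L * norm (x - y)"
      by (rule field_differentiable_bound[of UNIV \<phi> "deriv \<phi>" L])
        (use bump_deriv(2)[OF assms] L in auto)
    then show ?thesis by simp
  qed
  then show ?thesis by blast
qed

text \<open>\<open>radial_sine_formula\<close> is the spectral formula demanded by the locale; the
  Sobolev conditions supply the integrability with weight 1 / (1 + |xi|), for the first datum
  directly and for the second after division by |xi|.\<close>

lemma wave_representation_radial:
  fixes w0 w1 :: "real^3 \<Rightarrow> real" and w :: "real \<Rightarrow> real^3 \<Rightarrow> real"
  assumes s: "1/2 < s" "s < 3/2"
    and rad: "\<And>t. radial (w t)" and w0: "hom_sobolev s w0" and w1: "hom_sobolev (s - 1) w1"
    and wave: "linear_wave_solution w w0 w1"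
  shows "\<exists>A B. wave_representation (lborel :: (real^3) measure) norm A B (\<lambda>t r. r * radial_profile (w t) r)"
proof -
  obtain g0 where g0: "has_fourier (\<lambda>x. complex_of_real (w0 x)) g0"
    "integrable lborel (\<lambda>\<xi>. (norm \<xi> powr s * norm (g0 \<xi>))\<^sup>2)" using w0 unfolding hom_sobolev_def by auto
  obtain g1 where g1: "has_fourier (\<lambda>x. complex_of_real (w1 x)) g1"
    "integrable lborel (\<lambda>\<xi>. (norm \<xi> powr (s - 1) * norm (g1 \<xi>))\<^sup>2)" using w1 unfolding hom_sobolev_def by auto
  obtain G0 G1 where G: "has_fourier (\<lambda>x. complex_of_real (w0 x)) G0" "has_fourier (\<lambda>x. complex_of_real (w1 x)) G1"
    "\<And>t. has_fourier (\<lambda>x. complex_of_real (w t x)) (\<lambda>\<xi>. complex_of_real (cos (t * norm \<xi>)) * G0 \<xi> +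
       complex_of_real (sin (t * norm \<xi>) / norm \<xi>) * G1 \<xi>)"
    using wave unfolding linear_wave_solution_def by auto
  have m[measurable]: "g0 \<in> borel_measurable borel" "g1 \<in> borel_measurable borel"
    using g0(1) g1(1) unfolding has_fourier_def by (auto intro: tempered_gaussian(2))
  have temp: "tempered (\<lambda>x. complex_of_real (w t x))" for t using G(3)[of t] unfolding has_fourier_def by simp
  define g where "g t \<xi> = complex_of_real (cos (t * norm \<xi>)) * g0 \<xi> + complex_of_real (sin (t * norm \<xi>) / norm \<xi>) * g1 \<xi>"
    for t and \<xi> :: "real^3"
  \<comment> \<open>\<open>G0\<close> and \<open>G1\<close> come from the wave equation,
    \<open>g0\<close> and \<open>g1\<close> from the Sobolev conditions, which carry the
    integrability. \<open>gaussian_pair_wave\<close> exchanges them without appeal to uniqueness of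
    Fourier transforms.\<close>
  have pair: "gaussian_pair (w t) (g t)" for t
    unfolding g_def[abs_def]
    by (rule gaussian_pair_wave[OF has_fourier_gaussian_pair[OF G(3)]
          has_fourier_gaussian_pair[OF G(1)] has_fourier_gaussian_pair[OF G(2)]
          has_fourier_gaussian_pair[OF g0(1)] has_fourier_gaussian_pair[OF g1(1)]])
  have n1: "norm \<xi> powr 1 = norm \<xi>" for \<xi> :: "real^3" by simp
  have i0: "integrable lborel (\<lambda>\<xi>. norm (g0 \<xi>) / (1 + norm \<xi>))"
  \<comment> \<open>\<open>norm \<xi> powr 0\<close> is 0 at the origin, so the two integrands are
    compared only almost everywhere.\<close>
  proof (rule integrable_cong_AE_imp)
    show "integrable lborel (\<lambda>\<xi>. norm (g0 \<xi>) / norm \<xi> powr 0 / (1 + norm \<xi>))"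
      by (rule sobolev_weighted_integrable[OF s m(1)]) (use g0(2) in simp)
    have "AE \<xi> in lborel. (\<xi>::real^3) \<noteq> 0" by (rule AE_lborel_singleton)
    then show "AE \<xi> in lborel. norm (g0 \<xi>) / norm \<xi> powr 0 / (1 + norm \<xi>) = norm (g0 \<xi>) / (1 + norm \<xi>)"
      by eventually_elim simp
  qed measurable
  have i1: "integrable lborel (\<lambda>\<xi>. norm (g1 \<xi>) / norm \<xi> / (1 + norm \<xi>))"
    using sobolev_weighted_integrable[OF s m(2), of 1] g1(2) unfolding n1 by simp
  \<comment> \<open>\<open>c\<close> inverts the constant of \<open>radial_sine_formula\<close>.
    Taking real parts is harmless since the sine transform and the left side of that formula are
    real; \<open>B\<close> carries the division by |xi| of the sine propagator.\<close>
  define c where "c = 1 / (8 * pi ^ 3)"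
  define A where "A \<xi> = c * Re (g0 \<xi>)" for \<xi>
  define B where "B \<xi> = c * (Re (g1 \<xi>) / norm \<xi>)" for \<xi>
  have "wave_representation (lborel :: (real^3) measure) norm A B (\<lambda>t r. r * radial_profile (w t) r)"
  proof
    show "(norm :: real^3 \<Rightarrow> real) \<in> borel_measurable lborel" by measurable
    show "0 \<le> norm \<xi>" for \<xi> :: "real^3" by simp
    have "AE \<xi> in lborel. (\<xi>::real^3) \<noteq> 0" by (rule AE_lborel_singleton)
    then show "AE \<xi> in lborel. 0 < norm (\<xi>::real^3)" by eventually_elim simp
    show "integrable lborel (\<lambda>\<xi>. A \<xi> / (1 + norm \<xi>))"
    proof (rule Bochner_Integration.integrable_bound)
      show "integrable lborel (\<lambda>\<xi>. c * (norm (g0 \<xi>) / (1 + norm \<xi>)))" by (rule integrable_mult_right[OF i0])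
      show "AE \<xi> in lborel. norm (A \<xi> / (1 + norm \<xi>)) \<le> norm (c * (norm (g0 \<xi>) / (1 + norm \<xi>)))"
        by (rule AE_I2) (simp add: A_def abs_mult mult_left_mono divide_right_mono abs_Re_le_cmod)
    qed (unfold A_def, measurable)
    show "integrable lborel (\<lambda>\<xi>. B \<xi> / (1 + norm \<xi>))"
    proof (rule Bochner_Integration.integrable_bound)
      show "integrable lborel (\<lambda>\<xi>. c * (norm (g1 \<xi>) / norm \<xi> / (1 + norm \<xi>)))" by (rule integrable_mult_right[OF i1])
      show "AE \<xi> in lborel. norm (B \<xi> / (1 + norm \<xi>)) \<le> norm (c * (norm (g1 \<xi>) / norm \<xi> / (1 + norm \<xi>)))"
        by (rule AE_I2) (simp add: B_def abs_mult mult_left_mono divide_right_mono abs_Re_le_cmod)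
    qed (unfold B_def, measurable)
    show "locally_integrable_on (\<lambda>r. r * radial_profile (w t) r) {0<..}" for t
      by (rule radial_profile_locally_integrable[OF rad temp])
    fix t \<phi> assume \<phi>: "test_function_on {0::real<..} \<phi>"
    note b = test_function_bump[OF \<phi>]
    let ?G = "\<lambda>\<xi>. norm (g0 \<xi>) / (1 + norm \<xi>) + norm (g1 \<xi>) / norm \<xi> / (1 + norm \<xi>)"
    let ?S = "\<lambda>\<xi>::real^3. complex_of_real (sine_transform \<phi> (norm \<xi>) / norm \<xi>)"
    note [measurable] = bump_measurable[OF b]
    obtain R where R: "R \<ge> 0" "\<And>y. \<bar>y\<bar> > R \<Longrightarrow> \<phi> y = 0" using b unfolding bump_def by auto
    obtain K where K: "\<And>y. \<bar>\<phi> y\<bar> \<le> K" using bump_bounded[OF b] by auto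
    obtain L where L: "\<And>x y. \<bar>\<phi> x - \<phi> y\<bar> \<le> L * \<bar>x - y\<bar>" using bump_lipschitz[OF b] by auto
    obtain C where C: "\<And>k. k \<ge> 0 \<Longrightarrow> \<bar>sine_transform \<phi> k / k\<bar> \<le> C / (1 + k)"
      using sine_transform_over_k_decay[OF b] by auto
    have int: "integrable lborel (\<lambda>\<xi>. g t \<xi> * ?S \<xi>)"
    proof (rule Bochner_Integration.integrable_bound)
      show "integrable lborel (\<lambda>\<xi>. C * ?G \<xi>)"
        by (intro integrable_mult_right Bochner_Integration.integrable_add i0 i1)
      show "AE \<xi> in lborel. norm (g t \<xi> * ?S \<xi>)
         \<le> norm (C * ?G \<xi>)"
      proof (rule AE_I2)
        fix \<xi> :: "real^3"
        have "norm (complex_of_real (cos (t * norm \<xi>)) * g0 \<xi>) \<le> 1 * norm (g0 \<xi>)"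
          unfolding norm_mult norm_of_real by (intro mult_right_mono abs_cos_le_one) simp
        moreover have "norm (complex_of_real (sin (t * norm \<xi>) / norm \<xi>) * g1 \<xi>) \<le> (1 / norm \<xi>) * norm (g1 \<xi>)"
          unfolding norm_mult norm_of_real abs_divide abs_norm_cancel
          by (intro mult_right_mono divide_right_mono abs_sin_le_one) auto
        ultimately have "norm (g t \<xi>) \<le> norm (g0 \<xi>) + norm (g1 \<xi>) / norm \<xi>"
          unfolding g_def by (intro order_trans[OF norm_triangle_ineq] add_mono) auto
        then have "norm (g t \<xi>) * \<bar>sine_transform \<phi> (norm \<xi>) / norm \<xi>\<bar>
          \<le> (norm (g0 \<xi>) + norm (g1 \<xi>) / norm \<xi>) * (C / (1 + norm \<xi>))"
          by (intro mult_mono C) auto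
        also have "\<dots> = C * ?G \<xi>"
          by (simp add: distrib_left distrib_right mult.commute)
        finally show "norm (g t \<xi> * ?S \<xi>)
         \<le> norm (C * ?G \<xi>)"
          unfolding norm_mult norm_of_real real_norm_def by linarith
      qed
    qed (unfold g_def, measurable)
    have F: "complex_of_real (8 * pi ^ 3 * (\<integral>r. r * radial_profile (w t) r * \<phi> r \<partial>lborel))
       = (\<integral>\<xi>. g t \<xi> * ?S \<xi> \<partial>lborel)"
      by (rule radial_sine_formula[OF rad temp pair bump_continuous[OF b] K R(2) L R(1)
            test_function_halfline_eq_0[OF \<phi>] int])
    have "8 * pi ^ 3 * (\<integral>r. r * radial_profile (w t) r * \<phi> r \<partial>lborel)
       = Re (\<integral>\<xi>. g t \<xi> * ?S \<xi> \<partial>lborel)"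
      unfolding F[symmetric] by simp
    also have "\<dots> = (\<integral>\<xi>. Re (g t \<xi> * ?S \<xi>) \<partial>lborel)"
      by (rule integral_Re[OF int, symmetric])
    finally have "(\<integral>r. r * radial_profile (w t) r * \<phi> r \<partial>lborel)
       = c * (\<integral>\<xi>. Re (g t \<xi> * ?S \<xi>) \<partial>lborel)"
      by (simp add: c_def field_simps)
    also have "\<dots> = (\<integral>\<xi>. c * Re (g t \<xi> * ?S \<xi>) \<partial>lborel)"
      by (rule integral_mult_right_zero[symmetric])
    also have "\<dots> = (\<integral>\<xi>. (cos (t * norm \<xi>) * A \<xi> + sin (t * norm \<xi>) * B \<xi>) * (sine_transform \<phi> (norm \<xi>) / norm \<xi>) \<partial>lborel)"
    proof (rule Bochner_Integration.integral_cong[OF refl])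
      fix \<xi> :: "real^3"
      have re: "Re (complex_of_real x * z) = x * Re z" "Re (z * complex_of_real x) = Re z * x" for x z by simp_all
      show "c * Re (g t \<xi> * ?S \<xi>)
         = (cos (t * norm \<xi>) * A \<xi> + sin (t * norm \<xi>) * B \<xi>) * (sine_transform \<phi> (norm \<xi>) / norm \<xi>)"
        unfolding re g_def plus_complex.sel A_def B_def by (simp add: algebra_simps)
    qed
    finally show "(\<integral>r. r * radial_profile (w t) r * \<phi> r \<partial>lborel)
      = (\<integral>\<xi>. (cos (t * norm \<xi>) * A \<xi> + sin (t * norm \<xi>) * B \<xi>) * (sine_transform \<phi> (norm \<xi>) / norm \<xi>) \<partial>lborel)" .
  qed
  then show ?thesis by blast
qed

theorem lemma3p6:
  fixes p m s_c :: real
  assumes "p > 5" and "m = (p - 1) / 2" and "s_c = 3 / 2 - 1 / m"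
  shows "\<exists>C>0. \<forall>(w0 :: real^3 \<Rightarrow> real) (w1 :: real^3 \<Rightarrow> real) (w :: real \<Rightarrow> real^3 \<Rightarrow> real).
    radial w0 \<longrightarrow> radial w1 \<longrightarrow> (\<forall>t. radial (w t)) \<longrightarrow>
    hom_sobolev s_c w0 \<longrightarrow> hom_sobolev (s_c - 1) w1 \<longrightarrow>
    linear_wave_solution w w0 w1 \<longrightarrow>
    (let E = radial_energy m (\<lambda>t r. r * radial_profile (w t) r)
     in \<forall>t. ennreal (inverse C) * E 0 \<le> E t \<and> E t \<le> ennreal C * E 0)"
proof -
  \<comment> \<open>p > 5 forces m > 2, hence s_c lies between 1 and 3/2, inside the range in which
    the weight is square integrable.\<close>
  have m: "m > 2" using assms by simp
  have "0 < 1 / m" "1 / m < 1 / 2" using m by (auto simp: field_simps)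
  then have s: "1/2 < s_c" "s_c < 3/2" using assms(3) by linarith+
  define C where "C = 8 * 4 powr m"
  have C: "C > 0" by (simp add: C_def)
  have "ennreal (inverse C) * radial_energy m (\<lambda>t r. r * radial_profile (w t) r) 0
      \<le> radial_energy m (\<lambda>t r. r * radial_profile (w t) r) t
    \<and> radial_energy m (\<lambda>t r. r * radial_profile (w t) r) t
      \<le> ennreal C * radial_energy m (\<lambda>t r. r * radial_profile (w t) r) 0"
    if rad: "\<forall>t. radial (w t)" and w: "hom_sobolev s_c w0" "hom_sobolev (s_c - 1) w1" "linear_wave_solution w w0 w1"
    for w0 w1 :: "real^3 \<Rightarrow> real" and w :: "real \<Rightarrow> real^3 \<Rightarrow> real" and t
  proof -
    let ?E = "radial_energy m (\<lambda>t r. r * radial_profile (w t) r)"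
    obtain A B where "wave_representation (lborel :: (real^3) measure) norm A B (\<lambda>t r. r * radial_profile (w t) r)"
      using wave_representation_radial[OF s _ w] rad by blast
    then interpret wave_representation "lborel :: (real^3) measure" norm A B "\<lambda>t r. r * radial_profile (w t) r" .
    have le: "?E t \<le> ennreal C * ?E t0" for t t0
      unfolding C_def by (rule radial_energy_le) (use m in simp)
    have inv: "ennreal (inverse C) * ennreal C = 1" using C by (simp flip: ennreal_mult)
    \<comment> \<open>The lower bound is the upper bound with the times 0 and t exchanged.\<close>
    have "ennreal (inverse C) * ?E 0 \<le> ennreal (inverse C) * (ennreal C * ?E t)"
      by (rule mult_left_mono[OF le]) simp
    also have "\<dots> = ?E t" unfolding mult.assoc[symmetric] inv by simp
    finally show ?thesis using le by blast
  qed
  with C show ?thesis unfolding Let_def by blast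
qed

end
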